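(* Under the hypotheses in the context, $\bar T:=T/\mathfrak mT$ is an $\mathbb F_q=S/\mathfrak m$-algebra with basis the classes $[m(v);v]$ of $\Lambda^{m(v)}x^v$, $v\in M(\bar f,\mu)$, and it is a graded $\mathbb F_q$-algebra with grading $\bar W([m(v);v])=W(m(v);v)$. For $\bar\lambda\in\overline{\mathbb F}_q^*$, the $\mathbb F_q(\bar\lambda)$-linear map $pr_{\bar\lambda}:T\otimes_{\mathbb F_q}\mathbb F_q(\bar\lambda)\to\bar R^{(\bar\lambda)}$ given by $pr_{\bar\lambda}(\Lambda^rx^v)=\bar\lambda^{m(v)}x^v$ if $r=m(v)$ and $0$ otherwise induces an isomorphism of graded $\mathbb F_q(\bar\lambda)$-algebras between $\bar T\otimes_{\mathbb F_q}\mathbb F_q(\bar\lambda)$ and $\bar R^{(\bar\lambda)}$.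
   Context: Setting: $q$ a power of the prime $p$; $\bar f\in\mathbb F_q[x_1^{\pm1},\dots,x_n^{\pm1}]$ with $\dim\Delta_\infty(\bar f)=n$ ($\Delta_\infty(\bar f)$ = convex hull of $Supp(\bar f)\cup\{0\}$), quasihomogeneous (support on the affine hyperplane $l_\sigma(x)=1$), nondegenerate with respect to $\Delta_\infty(\bar f)$; $\mu\in\mathbb Z^n$, $l_\sigma(\mu)<1$, $p\nmid\prod_{\tau\in\Gamma_1}\phi^{(\tau)}(\mu)$. $\Gamma$: codimension-2 faces of $\Delta_\infty(\bar f)$ not containing 0; $\phi^{(\tau)}$ the primitive integral linear form vanishing on $\tau\cup\{0\}$, signed so that $Cone(\bar f)=\{\phi^{(\tau)}\ge0\ \forall\tau\in\Gamma\}$; $\Delta_\infty(\bar f,\mu)$ the convex hull of $\Delta_\infty(\bar f)\cup\{\mu\}$ with cone $Cone(\bar f,\mu)$, $M(\bar f,\mu)=Cone(\bar f,\mu)\cap\mathbb Z^n$; $\Gamma_1$ the $\tau\in\Gamma$ whose convex hull with $\mu$ is a face of $\Delta_\infty(\bar f,\mu)$; $Cone(\tau,\mu)$ the cone over that face. $m(v)=\phi^{(\tau)}(v)/\phi^{(\tau)}(\mu)$ for $v\in Cone(\tau,\mu)$, $\tau\in\Gamma_1$, and $m(v)=0$ for $v\in Cone(\bar f)$. $D$ = lcm of $\{|\phi^{(\tau)}(\mu)|\}_{\tau\in\Gamma_1}$. $\tilde M(\bar F)=\{(r,v)\in(1/D)\mathbb Z_{\ge0}\times\mathbb Z^n: v\in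 Cone(\bar f,\mu), r\ge m(v)\}$; $T=\mathbb F_q[\tilde M(\bar F)]$ (monomials $\Lambda^rx^v$), graded by $W(r,v)=l_\sigma(v)+r(1-l_\sigma(\mu))$; $S=\mathbb F_q[\Lambda^{1/D}]\subset T$, $\mathfrak m=(\Lambda^{1/D})\subset S$. $w(v)$ for $v\in M(\bar f,\mu)$ is the least $b\ge0$ with $v\in b\,\Delta_\infty(\bar f,\mu)$; $R^{(\bar\lambda)}=\mathbb F_q(\bar\lambda)[M(\bar f,\mu)]$ is filtered by $w$ (span of $x^v$ with $w(v)\le i$) and $\bar R^{(\bar\lambda)}$ is its associated graded ring.
   Formalization: Since λ̄^{m(v)} needs a D-th root κ of λ̄ that may lie outside F_q(λ̄) (e.g. q=3, D=2, λ̄=−1), the isomorphism is stated for every such κ with coefficient field F_q(λ̄,κ) in place of F_q(λ̄); the two agree when κ∈F_q(λ̄). *)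

theory Defs
  imports
    "HOL-Algebra.Algebraic_Closure_Type"
    "HOL-Analysis.Analysis"
    "HOL-Library.Poly_Mapping"
    "HOL-Algebra.Algebra"
begin

section \<open>Generic algebra\<close>

definition with_smult :: "('b, 'm) ring_scheme \<Rightarrow> ('k \<Rightarrow> 'b \<Rightarrow> 'b) \<Rightarrow> ('k, 'b) module" where
  "with_smult R sm =
     \<lparr>carrier = carrier R, monoid.mult = monoid.mult R, one = one R, ring.zero = ring.zero R, add = add R, module.smult = sm\<rparr>"

definition monoid_algebra ::
    "'k::comm_ring_1 set \<Rightarrow> 'e::comm_monoid_add set \<Rightarrow> ('k, 'e \<Rightarrow>\<^sub>0 'k) module" where
  "monoid_algebra k E =
     \<lparr>carrier = {P. Poly_Mapping.keys P \<subseteq> E \<and> (\<forall>e. Poly_Mapping.lookup P e \<in> k)},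
      monoid.mult = (*), one = 1, ring.zero = 0, add = (+),
      module.smult = (\<lambda>c P. Poly_Mapping.single 0 c * P)\<rparr>"

definition lin_span :: "('k, 'r) ring_scheme \<Rightarrow> ('k, 'b, 's) module_scheme \<Rightarrow> 'b set \<Rightarrow> 'b set" where
  "lin_span k A B =
     {(\<Oplus>\<^bsub>A\<^esub>x\<in>F. c x \<odot>\<^bsub>A\<^esub> x) | F c. finite F \<and> F \<subseteq> B \<and> c \<in> F \<rightarrow> carrier k}"

definition family_basis ::
    "('k, 'r) ring_scheme \<Rightarrow> ('k, 'b, 's) module_scheme \<Rightarrow> 'i set \<Rightarrow> ('i \<Rightarrow> 'b) \<Rightarrow> bool" where
  "family_basis k A I b \<longleftrightarrow>
     b \<in> I \<rightarrow> carrier A \<and>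
     (\<forall>x\<in>carrier A. \<exists>F c. finite F \<and> F \<subseteq> I \<and> c \<in> F \<rightarrow> carrier k \<and>
        x = (\<Oplus>\<^bsub>A\<^esub>i\<in>F. c i \<odot>\<^bsub>A\<^esub> b i)) \<and>
     (\<forall>F c. finite F \<and> F \<subseteq> I \<and> c \<in> F \<rightarrow> carrier k \<and>
        (\<Oplus>\<^bsub>A\<^esub>i\<in>F. c i \<odot>\<^bsub>A\<^esub> b i) = \<zero>\<^bsub>A\<^esub> \<longrightarrow> (\<forall>i\<in>F. c i = \<zero>\<^bsub>k\<^esub>))"

text \<open>\<open>A\<close> is a commutative \<open>k\<close>-algebra and the internal direct sum of its submodules \<open>G i\<close>,
  with \<open>G i \<cdot> G j \<subseteq> G (i + j)\<close>; the degrees are real numbers.\<close>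

definition graded_algebra ::
    "('k, 'r) ring_scheme \<Rightarrow> ('k, 'b, 's) module_scheme \<Rightarrow> (real \<Rightarrow> 'b set) \<Rightarrow> bool" where
  "graded_algebra k A G \<longleftrightarrow>
     Module.algebra k A \<and>
     (\<forall>i. Module.submodule (G i) k A) \<and>
     (\<forall>x\<in>carrier A. \<exists>!h. (\<forall>i. h i \<in> G i) \<and> finite {i. h i \<noteq> \<zero>\<^bsub>A\<^esub>} \<and>
        x = (\<Oplus>\<^bsub>A\<^esub>i\<in>{i. h i \<noteq> \<zero>\<^bsub>A\<^esub>}. h i)) \<and>
     \<one>\<^bsub>A\<^esub> \<in> G 0 \<and>
     (\<forall>i j. \<forall>x\<in>G i. \<forall>y\<in>G j. x \<otimes>\<^bsub>A\<^esub> y \<in> G (i + j))"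

definition linear_over ::
    "('k, 'r) ring_scheme \<Rightarrow> ('k, 'b, 's) module_scheme \<Rightarrow> ('k, 'c, 't) module_scheme \<Rightarrow>
     ('b \<Rightarrow> 'c) \<Rightarrow> bool" where
  "linear_over k A B h \<longleftrightarrow>
     h \<in> carrier A \<rightarrow> carrier B \<and>
     (\<forall>x\<in>carrier A. \<forall>y\<in>carrier A. h (x \<oplus>\<^bsub>A\<^esub> y) = h x \<oplus>\<^bsub>B\<^esub> h y) \<and>
     (\<forall>c\<in>carrier k. \<forall>x\<in>carrier A. h (c \<odot>\<^bsub>A\<^esub> x) = c \<odot>\<^bsub>B\<^esub> h x)"

definition graded_algebra_iso ::
    "('k, 'r) ring_scheme \<Rightarrow> ('k, 'b, 's) module_scheme \<Rightarrow> (real \<Rightarrow> 'b set) \<Rightarrow>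
     ('k, 'c, 't) module_scheme \<Rightarrow> (real \<Rightarrow> 'c set) \<Rightarrow> ('b \<Rightarrow> 'c) \<Rightarrow> bool" where
  "graded_algebra_iso k A G B H h \<longleftrightarrow>
     h \<in> ring_iso A B \<and> linear_over k A B h \<and> (\<forall>i. h ` G i = H i)"

subsection \<open>Tensor product of commutative algebras\<close>

text \<open>\<open>A \<otimes>\<^sub>k B\<close> is the free abelian group on \<open>A \<times> B\<close>, multiplied by
  \<open>(a,b)(a',b') = (aa',bb')\<close>, modulo the bilinearity relations. The set of relations is stable
  under multiplication by the generators \<open>(a,b)\<close>, so the ideal it generates is the additive subgroup
  it generates.\<close>

definition tensor_free ::
    "('k, 'b, 's) module_scheme \<Rightarrow> ('k, 'c, 't) module_scheme \<Rightarrow> ('b \<times> 'c \<Rightarrow>\<^sub>0 int) ring" where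
  "tensor_free A B =
     \<lparr>carrier = {P. Poly_Mapping.keys P \<subseteq> carrier A \<times> carrier B},
      monoid.mult = (\<lambda>P Q. \<Sum>x\<in>Poly_Mapping.keys P. \<Sum>y\<in>Poly_Mapping.keys Q.
         Poly_Mapping.single (fst x \<otimes>\<^bsub>A\<^esub> fst y, snd x \<otimes>\<^bsub>B\<^esub> snd y)
           (Poly_Mapping.lookup P x * Poly_Mapping.lookup Q y)),
      one = Poly_Mapping.single (\<one>\<^bsub>A\<^esub>, \<one>\<^bsub>B\<^esub>) 1, ring.zero = 0, add = (+)\<rparr>"

definition tensor_relations ::
    "('k, 'r) ring_scheme \<Rightarrow> ('k, 'b, 's) module_scheme \<Rightarrow> ('k, 'c, 't) module_scheme \<Rightarrow>
     ('b \<times> 'c \<Rightarrow>\<^sub>0 int) set" where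
  "tensor_relations k A B =
     (let g = (\<lambda>a b. Poly_Mapping.single (a, b) 1) in
      {g (a \<oplus>\<^bsub>A\<^esub> a') b - g a b - g a' b | a a' b.
         a \<in> carrier A \<and> a' \<in> carrier A \<and> b \<in> carrier B} \<union>
      {g a (b \<oplus>\<^bsub>B\<^esub> b') - g a b - g a b' | a b b'.
         a \<in> carrier A \<and> b \<in> carrier B \<and> b' \<in> carrier B} \<union>
      {g (s \<odot>\<^bsub>A\<^esub> a) b - g a (s \<odot>\<^bsub>B\<^esub> b) | s a b.
         s \<in> carrier k \<and> a \<in> carrier A \<and> b \<in> carrier B})"

definition pure_tensor ::
    "('k, 'r) ring_scheme \<Rightarrow> ('k, 'b, 's) module_scheme \<Rightarrow> ('k, 'c, 't) module_scheme \<Rightarrow>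
     'b \<Rightarrow> 'c \<Rightarrow> ('b \<times> 'c \<Rightarrow>\<^sub>0 int) set" where
  "pure_tensor k A B a b =
     genideal (tensor_free A B) (tensor_relations k A B)
       +>\<^bsub>tensor_free A B\<^esub> Poly_Mapping.single (a, b) 1"

text \<open>\<open>A \<otimes>\<^sub>k B\<close> as a \<open>B\<close>-algebra.\<close>

definition base_change ::
    "('k, 'r) ring_scheme \<Rightarrow> ('k, 'b, 's) module_scheme \<Rightarrow> ('k, 'c, 't) module_scheme \<Rightarrow>
     ('c, ('b \<times> 'c \<Rightarrow>\<^sub>0 int) set) module" where
  "base_change k A B =
     (let Q = tensor_free A B Quot genideal (tensor_free A B) (tensor_relations k A B)
      in with_smult Q (\<lambda>c x. pure_tensor k A B \<one>\<^bsub>A\<^esub> c \<otimes>\<^bsub>Q\<^esub> x))"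

definition base_change_grading ::
    "('k, 'r) ring_scheme \<Rightarrow> ('k, 'b, 's) module_scheme \<Rightarrow> ('k, 'c, 't) module_scheme \<Rightarrow>
     (real \<Rightarrow> 'b set) \<Rightarrow> real \<Rightarrow> ('b \<times> 'c \<Rightarrow>\<^sub>0 int) set set" where
  "base_change_grading k A B G i =
     lin_span B (base_change k A B) ((\<lambda>x. pure_tensor k A B x \<one>\<^bsub>B\<^esub>) ` G i)"

subsection \<open>Associated graded algebra\<close>

definition fil_below :: "(real \<Rightarrow> 'b set) \<Rightarrow> real \<Rightarrow> 'b set" where
  "fil_below Fil i = (\<Union>j\<in>{..<i}. Fil j)"

text \<open>For an increasing filtration \<open>Fil\<close> of the algebra \<open>R\<close>, the external direct sum of the
  quotients \<open>Fil i / fil_below Fil i\<close>. An element is the family of its components \<open>g i\<close>, which are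
  cosets of \<open>fil_below Fil i\<close>; the degree \<open>n\<close> part of a product is the (finite) sum of the products
  of the components in degrees \<open>i\<close> and \<open>n - i\<close>, taken in the quotient group
  \<open>R / fil_below Fil n\<close>.\<close>

definition assoc_graded ::
    "('k, 'b, 's) module_scheme \<Rightarrow> (real \<Rightarrow> 'b set) \<Rightarrow> ('k, real \<Rightarrow> 'b set) module" where
  "assoc_graded R Fil =
     \<lparr>carrier = {g. (\<forall>i. \<exists>x\<in>Fil i. g i = fil_below Fil i +>\<^bsub>R\<^esub> x) \<and>
                    finite {i. g i \<noteq> fil_below Fil i}},
      monoid.mult = (\<lambda>g h n. finprod (R A_Mod fil_below Fil n)
         (\<lambda>i. \<Union>x\<in>g i. \<Union>y\<in>h (n - i). fil_below Fil n +>\<^bsub>R\<^esub> (x \<otimes>\<^bsub>R\<^esub> y))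
         {i. g i \<noteq> fil_below Fil i \<and> h (n - i) \<noteq> fil_below Fil (n - i)}),
      one = (\<lambda>i. if i = 0 then fil_below Fil 0 +>\<^bsub>R\<^esub> \<one>\<^bsub>R\<^esub> else fil_below Fil i),
      ring.zero = fil_below Fil,
      add = (\<lambda>g h i. g i <+>\<^bsub>R\<^esub> h i),
      module.smult = (\<lambda>c g i. \<Union>x\<in>g i. fil_below Fil i +>\<^bsub>R\<^esub> (c \<odot>\<^bsub>R\<^esub> x))\<rparr>"

definition assoc_graded_piece ::
    "('k, 'b, 's) module_scheme \<Rightarrow> (real \<Rightarrow> 'b set) \<Rightarrow> real \<Rightarrow> (real \<Rightarrow> 'b set) set" where
  "assoc_graded_piece R Fil i =
     {g \<in> carrier (assoc_graded R Fil). \<forall>j. j \<noteq> i \<longrightarrow> g j = fil_below Fil j}"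

text \<open>The class of \<open>x \<in> Fil i\<close> in the summand of degree \<open>i\<close>.\<close>

definition gr_class ::
    "('k, 'b, 's) module_scheme \<Rightarrow> (real \<Rightarrow> 'b set) \<Rightarrow> real \<Rightarrow> 'b \<Rightarrow> real \<Rightarrow> 'b set" where
  "gr_class R Fil i x = (\<lambda>j. if j = i then fil_below Fil i +>\<^bsub>R\<^esub> x else fil_below Fil j)"

section \<open>Laurent polynomials and nondegeneracy\<close>

text \<open>A Laurent polynomial in \<open>CARD('n)\<close> variables over \<open>'q\<close> is an element of
  \<open>(int ^ 'n) \<Rightarrow>\<^sub>0 'q\<close>; its support is \<open>Poly_Mapping.keys\<close>.\<close>

definition rvec :: "int ^ 'n \<Rightarrow> real ^ 'n" where
  "rvec v = (\<chi> i. real_of_int (v $ i))"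

definition laurent_deriv ::
    "'n \<Rightarrow> ((int ^ 'n) \<Rightarrow>\<^sub>0 'q::field) \<Rightarrow> ((int ^ 'n) \<Rightarrow>\<^sub>0 'q)" where
  "laurent_deriv i g =
     (\<Sum>u\<in>Poly_Mapping.keys g.
        Poly_Mapping.single (u - axis i 1) (of_int (u $ i) * Poly_Mapping.lookup g u))"

definition laurent_eval ::
    "((int ^ 'n) \<Rightarrow>\<^sub>0 'q::field) \<Rightarrow> 'q alg_closure ^ 'n \<Rightarrow> 'q alg_closure" where
  "laurent_eval g x =
     (\<Sum>u\<in>Poly_Mapping.keys g. to_ac (Poly_Mapping.lookup g u) * (\<Prod>j\<in>UNIV. (x $ j) powi (u $ j)))"

definition face_part ::
    "((int ^ 'n) \<Rightarrow>\<^sub>0 'q::field) \<Rightarrow> (real ^ 'n) set \<Rightarrow> ((int ^ 'n) \<Rightarrow>\<^sub>0 'q)" where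
  "face_part g \<eta> =
     (\<Sum>u\<in>{u \<in> Poly_Mapping.keys g. rvec u \<in> \<eta>}. Poly_Mapping.single u (Poly_Mapping.lookup g u))"

definition Delta :: "((int ^ 'n) \<Rightarrow>\<^sub>0 'q::field) \<Rightarrow> (real ^ 'n) set" where
  "Delta f = convex hull (insert 0 (rvec ` Poly_Mapping.keys f))"

definition nondegenerate :: "((int ^ 'n) \<Rightarrow>\<^sub>0 'q::field) \<Rightarrow> bool" where
  "nondegenerate f \<longleftrightarrow>
     (\<forall>\<eta>. \<eta> face_of Delta f \<and> \<eta> \<noteq> {} \<and> 0 \<notin> \<eta> \<longrightarrow>
        \<not> (\<exists>x :: 'q alg_closure ^ 'n. (\<forall>j. x $ j \<noteq> 0) \<and>
              (\<forall>i. laurent_eval (laurent_deriv i (face_part f \<eta>)) x = 0)))"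

section \<open>Polyhedral data\<close>

text \<open>Names: \<open>Delta f\<close>, \<open>Cone f\<close> and \<open>Delta2 f \<mu>\<close>, \<open>Cone2 f \<mu>\<close> are
  \<open>\<Delta>\<^sub>\<infinity>(f)\<close>, \<open>Cone(f)\<close> and \<open>\<Delta>\<^sub>\<infinity>(f,\<mu>)\<close>, \<open>Cone(f,\<mu>)\<close>;
  \<open>faces_codim2\<close>, \<open>Gamma_one\<close> are \<open>\<Gamma>\<close>, \<open>\<Gamma>\<^sub>1\<close>; \<open>mexp\<close>, \<open>Den\<close>, \<open>wdeg\<close>, \<open>Wdeg\<close>, \<open>Mmon\<close> are
  \<open>m\<close>, \<open>D\<close>, \<open>w\<close>, \<open>W\<close>, \<open>M(f,\<mu>)\<close>; \<open>Tring\<close>, \<open>Sring\<close>, \<open>mm\<close>, \<open>Rring\<close> are \<open>T\<close>, \<open>S\<close>, \<open>\<mm>\<close>,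
  \<open>R\<close>. The linear form \<open>l\<close> is the one with value \<open>1\<close> on the support of \<open>f\<close>.\<close>

definition pairing :: "int ^ 'n \<Rightarrow> int ^ 'n \<Rightarrow> int" where
  "pairing a v = (\<Sum>i\<in>UNIV. a $ i * v $ i)"

definition Cone :: "((int ^ 'n) \<Rightarrow>\<^sub>0 'q::field) \<Rightarrow> (real ^ 'n) set" where
  "Cone f = conic hull (Delta f)"

text \<open>The empty set counts as a face, of dimension \<open>-1\<close>; for \<open>CARD('n) = 1\<close> it is the unique
  element of \<open>faces_codim2\<close>, and the cone over its hull with \<open>\<mu>\<close> is the ray through \<open>\<mu>\<close>.\<close>

definition faces_codim2 :: "((int ^ 'n) \<Rightarrow>\<^sub>0 'q::field) \<Rightarrow> (real ^ 'n) set set" where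
  "faces_codim2 f =
     {\<tau>. \<tau> face_of Delta f \<and> aff_dim \<tau> = int CARD('n) - 2 \<and> 0 \<notin> \<tau>}"

text \<open>The linear forms \<open>\<phi>\<^sup>\<tau>\<close>, each given by its integral coefficient vector.\<close>

definition face_forms ::
    "((int ^ 'n) \<Rightarrow>\<^sub>0 'q::field) \<Rightarrow> ((real ^ 'n) set \<Rightarrow> int ^ 'n) \<Rightarrow> bool" where
  "face_forms f \<phi> \<longleftrightarrow>
     (\<forall>\<tau>\<in>faces_codim2 f. Gcd {\<phi> \<tau> $ i | i. True} = 1 \<and> (\<forall>x\<in>\<tau>. rvec (\<phi> \<tau>) \<bullet> x = 0)) \<and>
     Cone f = {x. \<forall>\<tau>\<in>faces_codim2 f. rvec (\<phi> \<tau>) \<bullet> x \<ge> 0}"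

definition Delta2 :: "((int ^ 'n) \<Rightarrow>\<^sub>0 'q::field) \<Rightarrow> int ^ 'n \<Rightarrow> (real ^ 'n) set" where
  "Delta2 f \<mu> = convex hull (insert (rvec \<mu>) (Delta f))"

definition Cone2 :: "((int ^ 'n) \<Rightarrow>\<^sub>0 'q::field) \<Rightarrow> int ^ 'n \<Rightarrow> (real ^ 'n) set" where
  "Cone2 f \<mu> = conic hull (Delta2 f \<mu>)"

definition Mmon :: "((int ^ 'n) \<Rightarrow>\<^sub>0 'q::field) \<Rightarrow> int ^ 'n \<Rightarrow> (int ^ 'n) set" where
  "Mmon f \<mu> = {v. rvec v \<in> Cone2 f \<mu>}"

definition Gamma_one :: "((int ^ 'n) \<Rightarrow>\<^sub>0 'q::field) \<Rightarrow> int ^ 'n \<Rightarrow> (real ^ 'n) set set" where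
  "Gamma_one f \<mu> = {\<tau> \<in> faces_codim2 f. convex hull (insert (rvec \<mu>) \<tau>) face_of Delta2 f \<mu>}"

definition face_cone :: "(real ^ 'n) set \<Rightarrow> int ^ 'n \<Rightarrow> (real ^ 'n) set" where
  "face_cone \<tau> \<mu> = conic hull (convex hull (insert (rvec \<mu>) \<tau>))"

definition mexp ::
    "((int ^ 'n) \<Rightarrow>\<^sub>0 'q::field) \<Rightarrow> int ^ 'n \<Rightarrow> ((real ^ 'n) set \<Rightarrow> int ^ 'n) \<Rightarrow>
     int ^ 'n \<Rightarrow> real" where
  "mexp f \<mu> \<phi> v =
     (THE c. (rvec v \<in> Cone f \<and> c = 0) \<or>
        (\<exists>\<tau>\<in>Gamma_one f \<mu>. rvec v \<in> face_cone \<tau> \<mu> \<and>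
           c = real_of_int (pairing (\<phi> \<tau>) v) / real_of_int (pairing (\<phi> \<tau>) \<mu>)))"

definition Den ::
    "((int ^ 'n) \<Rightarrow>\<^sub>0 'q::field) \<Rightarrow> int ^ 'n \<Rightarrow> ((real ^ 'n) set \<Rightarrow> int ^ 'n) \<Rightarrow> nat" where
  "Den f \<mu> \<phi> = Lcm ((\<lambda>\<tau>. nat \<bar>pairing (\<phi> \<tau>) \<mu>\<bar>) ` Gamma_one f \<mu>)"

definition wdeg :: "((int ^ 'n) \<Rightarrow>\<^sub>0 'q::field) \<Rightarrow> int ^ 'n \<Rightarrow> int ^ 'n \<Rightarrow> real" where
  "wdeg f \<mu> v = (LEAST b. 0 \<le> b \<and> rvec v \<in> (\<lambda>x. b *\<^sub>R x) ` Delta2 f \<mu>)"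

definition Wdeg :: "(real ^ 'n \<Rightarrow> real) \<Rightarrow> int ^ 'n \<Rightarrow> real \<times> (int ^ 'n) \<Rightarrow> real" where
  "Wdeg l \<mu> = (\<lambda>(r, v). l (rvec v) + r * (1 - l (rvec \<mu>)))"

section \<open>The algebras over the finite field\<close>

abbreviation Fq :: "'q::field ring" where
  "Fq \<equiv> ring_of_type_algebra"

definition exps :: "nat \<Rightarrow> real set" where
  "exps d = {real k / real d | k. True}"

definition Mtilde ::
    "((int ^ 'n) \<Rightarrow>\<^sub>0 'q::field) \<Rightarrow> int ^ 'n \<Rightarrow> ((real ^ 'n) set \<Rightarrow> int ^ 'n) \<Rightarrow>
     (real \<times> (int ^ 'n)) set" where
  "Mtilde f \<mu> \<phi> = {(r, v). r \<in> exps (Den f \<mu> \<phi>) \<and> v \<in> Mmon f \<mu> \<and> r \<ge> mexp f \<mu> \<phi> v}"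

abbreviation tmono :: "real \<Rightarrow> int ^ 'n \<Rightarrow> (real \<times> (int ^ 'n)) \<Rightarrow>\<^sub>0 'q::field" where
  "tmono r v \<equiv> Poly_Mapping.single (r, v) 1"

definition Tring ::
    "((int ^ 'n) \<Rightarrow>\<^sub>0 'q::field) \<Rightarrow> int ^ 'n \<Rightarrow> ((real ^ 'n) set \<Rightarrow> int ^ 'n) \<Rightarrow>
     ('q, (real \<times> (int ^ 'n)) \<Rightarrow>\<^sub>0 'q) module" where
  "Tring f \<mu> \<phi> = monoid_algebra UNIV (Mtilde f \<mu> \<phi>)"

definition Sring ::
    "((int ^ 'n) \<Rightarrow>\<^sub>0 'q::field) \<Rightarrow> int ^ 'n \<Rightarrow> ((real ^ 'n) set \<Rightarrow> int ^ 'n) \<Rightarrow>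
     ('q, (real \<times> (int ^ 'n)) \<Rightarrow>\<^sub>0 'q) module" where
  "Sring f \<mu> \<phi> = monoid_algebra UNIV (exps (Den f \<mu> \<phi>) \<times> {0})"

definition mm ::
    "((int ^ 'n) \<Rightarrow>\<^sub>0 'q::field) \<Rightarrow> int ^ 'n \<Rightarrow> ((real ^ 'n) set \<Rightarrow> int ^ 'n) \<Rightarrow>
     ((real \<times> (int ^ 'n)) \<Rightarrow>\<^sub>0 'q) set" where
  "mm f \<mu> \<phi> = genideal (Sring f \<mu> \<phi>) {tmono (1 / real (Den f \<mu> \<phi>)) 0}"

definition mT ::
    "((int ^ 'n) \<Rightarrow>\<^sub>0 'q::field) \<Rightarrow> int ^ 'n \<Rightarrow> ((real ^ 'n) set \<Rightarrow> int ^ 'n) \<Rightarrow>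
     ((real \<times> (int ^ 'n)) \<Rightarrow>\<^sub>0 'q) set" where
  "mT f \<mu> \<phi> = genideal (Tring f \<mu> \<phi>) (mm f \<mu> \<phi>)"

text \<open>\<open>T / \<mm>T\<close> as an algebra over \<open>S / \<mm>\<close>: \<open>(s + \<mm>) \<cdot> (t + \<mm>T) = st + \<mm>T\<close>.\<close>

definition Tbar_resid ::
    "((int ^ 'n) \<Rightarrow>\<^sub>0 'q::field) \<Rightarrow> int ^ 'n \<Rightarrow> ((real ^ 'n) set \<Rightarrow> int ^ 'n) \<Rightarrow>
     (((real \<times> (int ^ 'n)) \<Rightarrow>\<^sub>0 'q) set, ((real \<times> (int ^ 'n)) \<Rightarrow>\<^sub>0 'q) set) module" where
  "Tbar_resid f \<mu> \<phi> =
     with_smult (Tring f \<mu> \<phi> Quot mT f \<mu> \<phi>)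
       (\<lambda>x y. \<Union>s\<in>x. \<Union>t\<in>y. mT f \<mu> \<phi> +>\<^bsub>Tring f \<mu> \<phi>\<^esub> (s * t))"

definition resid ::
    "((int ^ 'n) \<Rightarrow>\<^sub>0 'q::field) \<Rightarrow> int ^ 'n \<Rightarrow> ((real ^ 'n) set \<Rightarrow> int ^ 'n) \<Rightarrow>
     'q \<Rightarrow> ((real \<times> (int ^ 'n)) \<Rightarrow>\<^sub>0 'q) set" where
  "resid f \<mu> \<phi> c = mm f \<mu> \<phi> +>\<^bsub>Sring f \<mu> \<phi>\<^esub> Poly_Mapping.single 0 c"

text \<open>The same ring as an \<open>Fq\<close>-algebra, through \<open>resid : Fq \<rightarrow> S / \<mm>\<close>.\<close>

definition Tbar ::
    "((int ^ 'n) \<Rightarrow>\<^sub>0 'q::field) \<Rightarrow> int ^ 'n \<Rightarrow> ((real ^ 'n) set \<Rightarrow> int ^ 'n) \<Rightarrow>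
     ('q, ((real \<times> (int ^ 'n)) \<Rightarrow>\<^sub>0 'q) set) module" where
  "Tbar f \<mu> \<phi> =
     with_smult (Tring f \<mu> \<phi> Quot mT f \<mu> \<phi>) (\<lambda>c y. resid f \<mu> \<phi> c \<odot>\<^bsub>Tbar_resid f \<mu> \<phi>\<^esub> y)"

definition cls ::
    "((int ^ 'n) \<Rightarrow>\<^sub>0 'q::field) \<Rightarrow> int ^ 'n \<Rightarrow> ((real ^ 'n) set \<Rightarrow> int ^ 'n) \<Rightarrow>
     int ^ 'n \<Rightarrow> ((real \<times> (int ^ 'n)) \<Rightarrow>\<^sub>0 'q) set" where
  "cls f \<mu> \<phi> v = mT f \<mu> \<phi> +>\<^bsub>Tring f \<mu> \<phi>\<^esub> tmono (mexp f \<mu> \<phi> v) v"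

definition Tbar_grading ::
    "((int ^ 'n) \<Rightarrow>\<^sub>0 'q::field) \<Rightarrow> int ^ 'n \<Rightarrow> ((real ^ 'n) set \<Rightarrow> int ^ 'n) \<Rightarrow>
     (real ^ 'n \<Rightarrow> real) \<Rightarrow> real \<Rightarrow> ((real \<times> (int ^ 'n)) \<Rightarrow>\<^sub>0 'q) set set" where
  "Tbar_grading f \<mu> \<phi> l i =
     lin_span Fq (Tbar f \<mu> \<phi>) {cls f \<mu> \<phi> v | v. v \<in> Mmon f \<mu> \<and> Wdeg l \<mu> (mexp f \<mu> \<phi> v, v) = i}"

section \<open>The fibre at a point of the algebraic closure\<close>

text \<open>The powers \<open>\<lambda>\<^sup>m\<^sup>(\<^sup>v\<^sup>)\<close> have exponents in \<open>(1/D)\<int>\<close>, so they depend on the choice of a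
  \<open>D\<close>-th root \<open>\<kappa>\<close> of \<open>\<lambda>\<close>, and they need not lie in \<open>Fq(\<lambda>)\<close>. The field of coefficients is the
  extension of \<open>Fq(\<lambda>)\<close> generated by \<open>\<kappa>\<close>; it equals \<open>Fq(\<lambda>)\<close> exactly when
  \<open>\<kappa> \<in> Fq(\<lambda>)\<close>.\<close>

definition Kset :: "'q::field alg_closure \<Rightarrow> 'q alg_closure \<Rightarrow> 'q alg_closure set" where
  "Kset lam \<kappa> = generate_field ring_of_type_algebra (insert lam (insert \<kappa> (to_ac ` UNIV)))"

definition KF :: "'q::field alg_closure \<Rightarrow> 'q alg_closure \<Rightarrow> ('q, 'q alg_closure) module" where
  "KF lam \<kappa> =
     with_smult (ring_of_type_algebra\<lparr>carrier := Kset lam \<kappa>\<rparr>) (\<lambda>s c. to_ac s * c)"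

text \<open>\<open>\<lambda>\<^sup>r\<close> for \<open>r \<in> (1/d)\<int>\<close>, \<open>r \<ge> 0\<close>, where \<open>\<kappa>\<^sup>d = \<lambda>\<close>.\<close>

definition frac_pow :: "'a::field \<Rightarrow> nat \<Rightarrow> real \<Rightarrow> 'a" where
  "frac_pow \<kappa> d r = \<kappa> ^ nat \<lfloor>real d * r\<rfloor>"

definition Rring ::
    "((int ^ 'n) \<Rightarrow>\<^sub>0 'q::field) \<Rightarrow> int ^ 'n \<Rightarrow> 'q alg_closure \<Rightarrow> 'q alg_closure \<Rightarrow>
     ('q alg_closure, (int ^ 'n) \<Rightarrow>\<^sub>0 'q alg_closure) module" where
  "Rring f \<mu> lam \<kappa> = monoid_algebra (Kset lam \<kappa>) (Mmon f \<mu>)"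

definition RFil ::
    "((int ^ 'n) \<Rightarrow>\<^sub>0 'q::field) \<Rightarrow> int ^ 'n \<Rightarrow> 'q alg_closure \<Rightarrow> 'q alg_closure \<Rightarrow>
     real \<Rightarrow> ((int ^ 'n) \<Rightarrow>\<^sub>0 'q alg_closure) set" where
  "RFil f \<mu> lam \<kappa> i =
     lin_span (KF lam \<kappa>) (Rring f \<mu> lam \<kappa>) {Poly_Mapping.single v 1 | v. v \<in> Mmon f \<mu> \<and> wdeg f \<mu> v \<le> i}"

definition Rbar ::
    "((int ^ 'n) \<Rightarrow>\<^sub>0 'q::field) \<Rightarrow> int ^ 'n \<Rightarrow> 'q alg_closure \<Rightarrow> 'q alg_closure \<Rightarrow>
     ('q alg_closure, real \<Rightarrow> ((int ^ 'n) \<Rightarrow>\<^sub>0 'q alg_closure) set) module" where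
  "Rbar f \<mu> lam \<kappa> = assoc_graded (Rring f \<mu> lam \<kappa>) (RFil f \<mu> lam \<kappa>)"

definition Rbar_grading ::
    "((int ^ 'n) \<Rightarrow>\<^sub>0 'q::field) \<Rightarrow> int ^ 'n \<Rightarrow> 'q alg_closure \<Rightarrow> 'q alg_closure \<Rightarrow>
     real \<Rightarrow> (real \<Rightarrow> ((int ^ 'n) \<Rightarrow>\<^sub>0 'q alg_closure) set) set" where
  "Rbar_grading f \<mu> lam \<kappa> = assoc_graded_piece (Rring f \<mu> lam \<kappa>) (RFil f \<mu> lam \<kappa>)"

text \<open>The class of the monomial \<open>x\<^sup>v\<close> in \<open>Rbar\<close>, homogeneous of degree \<open>w(v)\<close>.\<close>

definition xbar ::
    "((int ^ 'n) \<Rightarrow>\<^sub>0 'q::field) \<Rightarrow> int ^ 'n \<Rightarrow> 'q alg_closure \<Rightarrow> 'q alg_closure \<Rightarrow>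
     int ^ 'n \<Rightarrow> real \<Rightarrow> ((int ^ 'n) \<Rightarrow>\<^sub>0 'q alg_closure) set" where
  "xbar f \<mu> lam \<kappa> v =
     gr_class (Rring f \<mu> lam \<kappa>) (RFil f \<mu> lam \<kappa>) (wdeg f \<mu> v) (Poly_Mapping.single v 1)"

definition is_pr ::
    "((int ^ 'n) \<Rightarrow>\<^sub>0 'q::field) \<Rightarrow> int ^ 'n \<Rightarrow> ((real ^ 'n) set \<Rightarrow> int ^ 'n) \<Rightarrow>
     'q alg_closure \<Rightarrow> 'q alg_closure \<Rightarrow>
     ((((real \<times> (int ^ 'n)) \<Rightarrow>\<^sub>0 'q) \<times> 'q alg_closure \<Rightarrow>\<^sub>0 int) set \<Rightarrow>
       real \<Rightarrow> ((int ^ 'n) \<Rightarrow>\<^sub>0 'q alg_closure) set) \<Rightarrow> bool" where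
  "is_pr f \<mu> \<phi> lam \<kappa> pr \<longleftrightarrow>
     linear_over (KF lam \<kappa>) (base_change Fq (Tring f \<mu> \<phi>) (KF lam \<kappa>)) (Rbar f \<mu> lam \<kappa>) pr \<and>
     (\<forall>(r, v)\<in>Mtilde f \<mu> \<phi>.
        pr (pure_tensor Fq (Tring f \<mu> \<phi>) (KF lam \<kappa>) (tmono r v) 1) =
          (if r = mexp f \<mu> \<phi> v
           then frac_pow \<kappa> (Den f \<mu> \<phi>) (mexp f \<mu> \<phi> v) \<odot>\<^bsub>Rbar f \<mu> lam \<kappa>\<^esub> xbar f \<mu> lam \<kappa> v
           else \<zero>\<^bsub>Rbar f \<mu> lam \<kappa>\<^esub>))"

end

theory Submission
  imports Defs
begin

text \<open>For \<open>v\<close> in the cone, \<open>m(v)\<close> is the least \<open>r \<ge> 0\<close> with \<open>v - r\<mu>\<close> in \<open>Cone(f)\<close>. This needs that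
  \<open>\<Gamma>\<^sub>1\<close> consists of the \<open>\<tau>\<close> with \<open>\<phi>\<^sup>\<tau>(\<mu>) < 0\<close>, which follows from \<open>\<phi>\<^sup>\<tau>(\<mu>) \<noteq> 0\<close> on \<open>\<Gamma>\<^sub>1\<close>. Hence \<open>m\<close> is
  subadditive with values in \<open>(1/D)\<int>\<close>, and \<open>w(v) = l(v) + m(v)(1 - l(\<mu>)) = W(m(v), v)\<close>. In particular
  \<open>w(u + v) = w(u) + w(v)\<close> exactly when \<open>m(u + v) = m(u) + m(v)\<close>. Therefore both the special fibre of
  \<open>T\<close> and the associated graded ring are the algebra with basis \<open>x\<^sup>v\<close> in which \<open>x\<^sup>u x\<^sup>v\<close> is \<open>x\<^sup>u\<^sup>+\<^sup>v\<close>
  when \<open>m\<close> is additive on the pair and \<open>0\<close> otherwise; the factor \<open>\<lambda>\<^sup>m\<^sup>(\<^sup>v\<^sup>)\<close> in \<open>pr\<close> is an automorphism of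
  this algebra, since it is multiplicative on the pairs with nonzero product.\<close>

section \<open>Linear spans and transport of gradings\<close>

text \<open>Products, gradings and bases are checked on an explicit model, the finitely supported
  functions on the monoid with the degenerate product, where every identity is biadditive and
  reduces to monomials. The two rings of the theorem are given by cosets, the graded ring even by
  families of cosets multiplied through a finite product in a quotient group. They are therefore
  compared with the model by explicit maps: one reads off the coefficients of \<Lambda>^m(v) x^v,
  the other sends an element to the classes of its homogeneous parts. The geometry enters through
  one formula: for b \<ge> 0, a point x lies in the b-fold dilate of \<open>Delta2 f \<mu>\<close>
  iff x - s \<mu> lies in \<open>Cone f\<close> for some s \<ge> 0 with l(x) + s (1 - l(\<mu>))
  \<le> b. Since l(\<mu>) < 1, the smallest admissible s gives the weight, and this s is m(x).
  \<open>is_pr\<close> prescribes pr only on monomials, but additivity and linearity over the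
  coefficient field determine it on all pure tensors; so one explicit choice settles the claim for
  every pr.\<close>

lemma with_smult_simps [simp]:
  "carrier (with_smult R sm) = carrier R" "monoid.mult (with_smult R sm) = monoid.mult R"
  "one (with_smult R sm) = one R" "ring.zero (with_smult R sm) = ring.zero R"
  "add (with_smult R sm) = add R" "module.smult (with_smult R sm) = sm"
  by (simp_all add: with_smult_def)

lemma finsum_eq_sum:
  fixes G :: "('a::comm_monoid_add, 'm) ring_scheme"
  assumes "abelian_monoid G" "add G = (+)" "ring.zero G = 0" "f \<in> A \<rightarrow> carrier G"
  shows "finsum G f A = sum f A"
proof -
  interpret abelian_monoid G by fact
  show ?thesis
    using assms(4)
  proof (induction A rule: infinite_finite_induct)
    \<comment> \<open>On an infinite index set both sums are 0 by convention.\<close>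
    case (infinite A)
    then show ?case using assms(3) by (simp add: finsum_infinite)
  next
    case empty
    then show ?case using assms(3) by simp
  next
    case (insert x F)
    then show ?case using assms(2) by (simp add: Pi_iff)
  qed
qed

context Module.module
begin

text \<open>Negatives are multiples by \<open>\<ominus> \<one>\<close>, so only zero, sums and
  scalar multiples have to be checked.\<close>

lemma submoduleI_smult:
  assumes "H \<subseteq> carrier M" "\<zero>\<^bsub>M\<^esub> \<in> H"
    and "\<And>a b. a \<in> H \<Longrightarrow> b \<in> H \<Longrightarrow> a \<oplus>\<^bsub>M\<^esub> b \<in> H"
    and sm: "\<And>a x. a \<in> carrier R \<Longrightarrow> x \<in> H \<Longrightarrow> a \<odot>\<^bsub>M\<^esub> x \<in> H"
  shows "submodule H R M"
proof (rule submoduleI)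
  fix a assume a: "a \<in> H"
  then have "(\<ominus> \<one>) \<odot>\<^bsub>M\<^esub> a = \<ominus>\<^bsub>M\<^esub> a"
    using assms(1) by (subst smult_l_minus) auto
  with sm[OF _ a, of "\<ominus> \<one>"] show "\<ominus>\<^bsub>M\<^esub> a \<in> H" by simp
qed (use assms in auto)

lemma submodule_zero: "submodule N R M \<Longrightarrow> \<zero>\<^bsub>M\<^esub> \<in> N"
  by (metis submoduleE(2,4) R.zero_closed smult_l_null submoduleE(1) ex_in_conv subsetD)

lemma submodule_finsum:
  assumes N: "submodule N R M" and "f \<in> A \<rightarrow> N"
  shows "(\<Oplus>\<^bsub>M\<^esub>x\<in>A. f x) \<in> N"
  using assms(2)
proof (induction A rule: infinite_finite_induct)
  case (insert x F)
  then have "f \<in> F \<rightarrow> carrier M" "f x \<in> carrier M" using submoduleE(1)[OF N] by auto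
  then show ?case using insert submoduleE(5)[OF N] by simp
qed (use submodule_zero[OF N] in \<open>auto simp: M.finsum_infinite\<close>)

lemma lin_span_least:
  assumes "submodule N R M" "B \<subseteq> N"
  shows "lin_span R M B \<subseteq> N"
proof
  fix y assume "y \<in> lin_span R M B"
  then obtain F c where F: "finite F" "F \<subseteq> B" "c \<in> F \<rightarrow> carrier R" "y = (\<Oplus>\<^bsub>M\<^esub>x\<in>F. c x \<odot>\<^bsub>M\<^esub> x)"
    unfolding lin_span_def by auto
  show "y \<in> N" unfolding F(4)
    by (rule submodule_finsum[OF assms(1)]) (use F assms submoduleE(4)[OF assms(1)] in blast)
qed

lemma lin_span_incl:
  assumes "B \<subseteq> carrier M"
  shows "B \<subseteq> lin_span R M B"
proof
  fix x assume x: "x \<in> B"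
  have "x = (\<Oplus>\<^bsub>M\<^esub>x\<in>{x}. \<one> \<odot>\<^bsub>M\<^esub> x)" using x assms by auto
  then show "x \<in> lin_span R M B" unfolding lin_span_def
    using x by (intro CollectI exI[of _ "{x}"] exI[of _ "\<lambda>_. \<one>"]) auto
qed

lemma lin_span_submodule:
  assumes "B \<subseteq> carrier M"
  shows "submodule (lin_span R M B) R M"
proof (rule submoduleI_smult)
  show "lin_span R M B \<subseteq> carrier M"
    by (rule lin_span_least[OF carrier_is_submodule assms])
  show "\<zero>\<^bsub>M\<^esub> \<in> lin_span R M B" unfolding lin_span_def
    by (intro CollectI exI[of _ "{}"] exI) auto
next
  fix a b assume "a \<in> lin_span R M B" "b \<in> lin_span R M B"
  then obtain F c F' c' where F: "finite F" "F \<subseteq> B" "c \<in> F \<rightarrow> carrier R" "a = (\<Oplus>\<^bsub>M\<^esub>x\<in>F. c x \<odot>\<^bsub>M\<^esub> x)"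
    and F': "finite F'" "F' \<subseteq> B" "c' \<in> F' \<rightarrow> carrier R" "b = (\<Oplus>\<^bsub>M\<^esub>x\<in>F'. c' x \<odot>\<^bsub>M\<^esub> x)"
    unfolding lin_span_def by auto
  \<comment> \<open>Both coefficient families are extended by zero to \<open>F \<union> F'\<close>,
    so that the two sums can be added term by term.\<close>
  define d where "d x = (if x \<in> F then c x else \<zero>)" for x
  define d' where "d' x = (if x \<in> F' then c' x else \<zero>)" for x
  have d: "d x \<in> carrier R" "d' x \<in> carrier R" for x
    using F(3) F'(3) by (auto simp: d_def d'_def)
  have cR: "x \<in> F \<Longrightarrow> c x \<in> carrier R" "x \<in> F' \<Longrightarrow> c' x \<in> carrier R" for x
    using F(3) F'(3) by auto
  have BM: "x \<in> carrier M" if "x \<in> F \<union> F'" for x using that F F' assms by auto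
  have "a = (\<Oplus>\<^bsub>M\<^esub>x\<in>F \<union> F'. d x \<odot>\<^bsub>M\<^esub> x)" unfolding F(4)
    by (rule M.add.finprod_mono_neutral_cong_left) (use F(1) F'(1) BM cR in \<open>auto simp: d_def\<close>)
  moreover have "b = (\<Oplus>\<^bsub>M\<^esub>x\<in>F \<union> F'. d' x \<odot>\<^bsub>M\<^esub> x)" unfolding F'(4)
    by (rule M.add.finprod_mono_neutral_cong_left) (use F(1) F'(1) BM cR in \<open>auto simp: d'_def\<close>)
  ultimately have "a \<oplus>\<^bsub>M\<^esub> b = (\<Oplus>\<^bsub>M\<^esub>x\<in>F \<union> F'. d x \<odot>\<^bsub>M\<^esub> x \<oplus>\<^bsub>M\<^esub> d' x \<odot>\<^bsub>M\<^esub> x)"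
    using BM d by (simp add: M.finsum_addf Pi_iff)
  also have "\<dots> = (\<Oplus>\<^bsub>M\<^esub>x\<in>F \<union> F'. (d x \<oplus> d' x) \<odot>\<^bsub>M\<^esub> x)"
    by (rule M.finsum_cong') (use BM d in \<open>auto simp: smult_l_distr\<close>)
  finally show "a \<oplus>\<^bsub>M\<^esub> b \<in> lin_span R M B" unfolding lin_span_def
    using F F' d by (intro CollectI exI[of _ "F \<union> F'"] exI[of _ "\<lambda>x. d x \<oplus> d' x"]) auto
next
  fix a x assume a: "a \<in> carrier R" and "x \<in> lin_span R M B"
  then obtain F c where F: "finite F" "F \<subseteq> B" "c \<in> F \<rightarrow> carrier R" "x = (\<Oplus>\<^bsub>M\<^esub>x\<in>F. c x \<odot>\<^bsub>M\<^esub> x)"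
    unfolding lin_span_def by auto
  have c: "c x \<in> carrier R" "x \<in> carrier M" if "x \<in> F" for x using F assms that by auto
  have "a \<odot>\<^bsub>M\<^esub> x = (\<Oplus>\<^bsub>M\<^esub>x\<in>F. a \<odot>\<^bsub>M\<^esub> (c x \<odot>\<^bsub>M\<^esub> x))"
    unfolding F(4) by (rule finsum_smult_ldistr) (use F a c in auto)
  also have "\<dots> = (\<Oplus>\<^bsub>M\<^esub>x\<in>F. (a \<otimes> c x) \<odot>\<^bsub>M\<^esub> x)"
    by (rule M.finsum_cong') (use a c in \<open>auto simp: smult_assoc1\<close>)
  finally show "a \<odot>\<^bsub>M\<^esub> x \<in> lin_span R M B" unfolding lin_span_def
    using F a c by (intro CollectI exI[of _ "F"] exI[of _ "\<lambda>x. a \<otimes> c x"]) auto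
qed

end

lemma linear_overD:
  assumes "linear_over k A B h"
  shows "x \<in> carrier A \<Longrightarrow> h x \<in> carrier B"
    and "x \<in> carrier A \<Longrightarrow> y \<in> carrier A \<Longrightarrow> h (x \<oplus>\<^bsub>A\<^esub> y) = h x \<oplus>\<^bsub>B\<^esub> h y"
    and "c \<in> carrier k \<Longrightarrow> x \<in> carrier A \<Longrightarrow> h (c \<odot>\<^bsub>A\<^esub> x) = c \<odot>\<^bsub>B\<^esub> h x"
  using assms unfolding linear_over_def by auto

text \<open>\<open>linear_over\<close> does not mention zero; it is reached through the scalar zero
  of \<open>k\<close>.\<close>

lemma linear_over_zero:
  assumes "Module.module k A" "Module.module k B" "linear_over k A B h"
  shows "h \<zero>\<^bsub>A\<^esub> = \<zero>\<^bsub>B\<^esub>"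
proof -
  interpret A: Module.module k A by fact
  interpret B: Module.module k B by fact
  have "h \<zero>\<^bsub>A\<^esub> = h (\<zero>\<^bsub>k\<^esub> \<odot>\<^bsub>A\<^esub> \<zero>\<^bsub>A\<^esub>)" by simp
  also have "\<dots> = \<zero>\<^bsub>B\<^esub>" using linear_overD(1)[OF assms(3)] by (subst linear_overD(3)[OF assms(3)]) simp_all
  finally show ?thesis .
qed

lemma linear_over_finsum:
  assumes "Module.module k A" "Module.module k B" "linear_over k A B h" "f \<in> I \<rightarrow> carrier A"
  shows "h (finsum A f I) = finsum B (\<lambda>i. h (f i)) I"
proof -
  interpret A: Module.module k A by fact
  interpret B: Module.module k B by fact
  show ?thesis using assms(4)
  proof (induction I rule: infinite_finite_induct)
    case (insert x F)
    then have "f \<in> F \<rightarrow> carrier A" "f x \<in> carrier A" "(\<lambda>i. h (f i)) \<in> F \<rightarrow> carrier B" "h (f x) \<in> carrier B"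
      using linear_overD(1)[OF assms(3)] by auto
    then show ?case using insert linear_overD(2)[OF assms(3)] by simp
  qed (simp_all add: linear_over_zero[OF assms(1-3)])
qed

text \<open>Both inclusions are instances of the minimality of a span: preimages and images of
  submodules are submodules.\<close>

lemma lin_span_image:
  assumes "Module.module k A" "Module.module k B" "linear_over k A B h" "U \<subseteq> carrier A"
  shows "h ` lin_span k A U = lin_span k B (h ` U)"
proof
  interpret A: Module.module k A by fact
  interpret B: Module.module k B by fact
  note h = linear_overD[OF assms(3)] and h0 = linear_over_zero[OF assms(1-3)]
  have hX: "h ` U \<subseteq> carrier B" using assms(4) h(1) by auto
  note sA = A.lin_span_submodule[OF assms(4)] and sB = B.lin_span_submodule[OF hX]
  have "submodule {x \<in> carrier A. h x \<in> lin_span k B (h ` U)} k A"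
    by (rule A.submoduleI_smult) (use h h0 B.submodule_zero[OF sB] B.submoduleE(4,5)[OF sB] in auto)
  moreover have "U \<subseteq> {x \<in> carrier A. h x \<in> lin_span k B (h ` U)}"
    using assms(4) B.lin_span_incl[OF hX] by auto
  ultimately show "h ` lin_span k A U \<subseteq> lin_span k B (h ` U)"
    using A.lin_span_least by blast
  have "submodule (h ` lin_span k A U) k B"
  proof (rule B.submoduleI_smult)
    note c = A.submoduleE(1)[OF sA]
    show "h ` lin_span k A U \<subseteq> carrier B" using h(1) c by auto
    show "\<zero>\<^bsub>B\<^esub> \<in> h ` lin_span k A U" using h0 A.submodule_zero[OF sA] by (metis imageI)
    show "a \<oplus>\<^bsub>B\<^esub> b \<in> h ` lin_span k A U" if "a \<in> h ` lin_span k A U" "b \<in> h ` lin_span k A U" for a b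
    proof -
      from that obtain x y where xy: "x \<in> lin_span k A U" "y \<in> lin_span k A U" "a = h x" "b = h y" by auto
      have "a \<oplus>\<^bsub>B\<^esub> b = h (x \<oplus>\<^bsub>A\<^esub> y)"
        using h(2)[OF subsetD[OF c xy(1)] subsetD[OF c xy(2)]] xy(3,4) by simp
      then show ?thesis using A.submoduleE(5)[OF sA xy(1,2)] by blast
    qed
    show "a \<odot>\<^bsub>B\<^esub> b \<in> h ` lin_span k A U" if "a \<in> carrier k" "b \<in> h ` lin_span k A U" for a b
    proof -
      from that obtain y where y: "y \<in> lin_span k A U" "b = h y" by auto
      have "a \<odot>\<^bsub>B\<^esub> b = h (a \<odot>\<^bsub>A\<^esub> y)"
        using h(3)[OF that(1) subsetD[OF c y(1)]] y(2) by simp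
      then show ?thesis using A.submoduleE(4)[OF sA that(1) y(1)] by blast
    qed
  qed
  then show "lin_span k B (h ` U) \<subseteq> h ` lin_span k A U"
    by (rule B.lin_span_least) (use A.lin_span_incl[OF assms(4)] in auto)
qed

text \<open>\<open>B\<close> is not assumed to be a ring, which is what makes this usable for the
  associated graded ring. \<open>ring_iso\<close> constrains sums, products and one, but not the
  \<open>zero\<close> field of the record \<open>B\<close>, hence the separate hypothesis on
  it.\<close>

lemma algebra_transport:
  assumes "Module.algebra k A" "h \<in> ring_iso A B" "linear_over k A B h" "h \<zero>\<^bsub>A\<^esub> = \<zero>\<^bsub>B\<^esub>"
  shows "Module.algebra k B"
proof -
  interpret A: Module.algebra k A by fact
  have "cring (B\<lparr>ring.zero := h \<zero>\<^bsub>A\<^esub>\<rparr>)" by (rule A.ring_iso_imp_img_cring[OF assms(2)])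
  moreover have "B\<lparr>ring.zero := h \<zero>\<^bsub>A\<^esub>\<rparr> = B" using assms(4) by simp
  ultimately have B: "cring B" by simp
  note h = linear_overD[OF assms(3)] and hm = ring_iso_memE(2)[OF assms(2)]
  have sur: "\<exists>x\<in>carrier A. y = h x" if "y \<in> carrier B" for y
    using that assms(2) unfolding ring_iso_def bij_betw_def by auto
  show ?thesis
  proof (rule algebraI[OF A.R_cring B])
    show "a \<odot>\<^bsub>B\<^esub> x \<in> carrier B" if "a \<in> carrier k" "x \<in> carrier B" for a x
      using that sur h(1,3) A.smult_closed by metis
    show "(a \<oplus>\<^bsub>k\<^esub> b) \<odot>\<^bsub>B\<^esub> x = a \<odot>\<^bsub>B\<^esub> x \<oplus>\<^bsub>B\<^esub> b \<odot>\<^bsub>B\<^esub> x" if "a \<in> carrier k" "b \<in> carrier k" "x \<in> carrier B" for a b x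
      using that sur[OF that(3)] by (auto simp flip: h(2,3) simp: A.smult_l_distr)
    show "a \<odot>\<^bsub>B\<^esub> (x \<oplus>\<^bsub>B\<^esub> y) = a \<odot>\<^bsub>B\<^esub> x \<oplus>\<^bsub>B\<^esub> a \<odot>\<^bsub>B\<^esub> y" if "a \<in> carrier k" "x \<in> carrier B" "y \<in> carrier B" for a x y
      using that sur[OF that(2)] sur[OF that(3)] by (auto simp flip: h(2,3) simp: A.smult_r_distr)
    show "(a \<otimes>\<^bsub>k\<^esub> b) \<odot>\<^bsub>B\<^esub> x = a \<odot>\<^bsub>B\<^esub> (b \<odot>\<^bsub>B\<^esub> x)" if "a \<in> carrier k" "b \<in> carrier k" "x \<in> carrier B" for a b x
      using that sur[OF that(3)] by (auto simp flip: h(2,3) simp: A.smult_assoc1)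
    show "\<one>\<^bsub>k\<^esub> \<odot>\<^bsub>B\<^esub> x = x" if "x \<in> carrier B" for x
      using sur[OF that] by (auto simp flip: h(2,3))
    show "a \<odot>\<^bsub>B\<^esub> x \<otimes>\<^bsub>B\<^esub> y = a \<odot>\<^bsub>B\<^esub> (x \<otimes>\<^bsub>B\<^esub> y)" if "a \<in> carrier k" "x \<in> carrier B" "y \<in> carrier B" for a x y
      using that sur[OF that(2)] sur[OF that(3)] by (auto simp flip: h(3) hm simp: A.smult_assoc2)
  qed
qed

text \<open>Existence of a decomposition is carried over by \<open>h\<close>. For uniqueness, the
  components of a decomposition in \<open>B\<close> are lifted to the pieces of \<open>A\<close>,
  and injectivity of \<open>h\<close> makes the lifted family a decomposition of the original
  element.\<close>

lemma graded_algebra_transport: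
  assumes gA: "graded_algebra k A G" and iso: "h \<in> ring_iso A B" and lin: "linear_over k A B h"
    and h0: "h \<zero>\<^bsub>A\<^esub> = \<zero>\<^bsub>B\<^esub>" and H: "\<And>i. H i = h ` G i"
  shows "graded_algebra k B H"
proof -
  have aA: "Module.algebra k A" using gA unfolding graded_algebra_def by auto
  have aB: "Module.algebra k B" by (rule algebra_transport[OF aA iso lin h0])
  interpret A: Module.algebra k A by fact
  interpret B: Module.algebra k B by fact
  have sub: "submodule (G i) k A" for i using gA unfolding graded_algebra_def by auto
  note G = A.submoduleE(1)[OF sub]
  have dec: "\<exists>!g. (\<forall>i. g i \<in> G i) \<and> finite {i. g i \<noteq> \<zero>\<^bsub>A\<^esub>} \<and> x = (\<Oplus>\<^bsub>A\<^esub>i\<in>{i. g i \<noteq> \<zero>\<^bsub>A\<^esub>}. g i)"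
    if "x \<in> carrier A" for x
    using gA that unfolding graded_algebra_def by auto
  note h = linear_overD[OF lin] and hm = ring_iso_memE(2)[OF iso] and h1 = ring_iso_memE(4)[OF iso]
  have inj: "inj_on h (carrier A)" and sur: "h ` carrier A = carrier B"
    using iso unfolding ring_iso_def bij_betw_def by auto
  have hz: "h x = \<zero>\<^bsub>B\<^esub> \<longleftrightarrow> x = \<zero>\<^bsub>A\<^esub>" if "x \<in> carrier A" for x
    using inj_onD[OF inj, of x "\<zero>\<^bsub>A\<^esub>"] that h0 by auto
  show ?thesis unfolding graded_algebra_def
  proof (intro conjI allI ballI)
    show "Module.algebra k B" by fact
    show "submodule (H i) k B" for i
    proof (rule B.submoduleI_smult)
      show "H i \<subseteq> carrier B" unfolding H using G h(1) by blast
      show "\<zero>\<^bsub>B\<^esub> \<in> H i" using A.submodule_zero[OF sub] h0 H by (metis imageI)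
      show "a \<oplus>\<^bsub>B\<^esub> b \<in> H i" if "a \<in> H i" "b \<in> H i" for a b
      proof -
        from that obtain x y where xy: "x \<in> G i" "y \<in> G i" "a = h x" "b = h y" unfolding H by auto
        have "a \<oplus>\<^bsub>B\<^esub> b = h (x \<oplus>\<^bsub>A\<^esub> y)"
          using h(2)[OF subsetD[OF G xy(1)] subsetD[OF G xy(2)]] xy(3,4) by simp
        then show ?thesis using A.submoduleE(5)[OF sub xy(1,2)] H by blast
      qed
      show "a \<odot>\<^bsub>B\<^esub> b \<in> H i" if "a \<in> carrier k" "b \<in> H i" for a b
      proof -
        from that obtain y where y: "y \<in> G i" "b = h y" unfolding H by auto
        have "a \<odot>\<^bsub>B\<^esub> b = h (a \<odot>\<^bsub>A\<^esub> y)"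
          using h(3)[OF that(1) subsetD[OF G y(1)]] y(2) by simp
        then show ?thesis using A.submoduleE(4)[OF sub that(1) y(1)] H by blast
      qed
    qed
    show "\<one>\<^bsub>B\<^esub> \<in> H 0" using gA h1 H unfolding graded_algebra_def by (metis imageI)
    show "x \<otimes>\<^bsub>B\<^esub> y \<in> H (i + j)" if "x \<in> H i" "y \<in> H j" for i j x y
    proof -
      from that obtain x' y' where xy: "x' \<in> G i" "y' \<in> G j" "x = h x'" "y = h y'" unfolding H by auto
      have "x \<otimes>\<^bsub>B\<^esub> y = h (x' \<otimes>\<^bsub>A\<^esub> y')"
        using hm[OF subsetD[OF G xy(1)] subsetD[OF G xy(2)]] xy(3,4) by simp
      moreover have "x' \<otimes>\<^bsub>A\<^esub> y' \<in> G (i + j)" using gA xy unfolding graded_algebra_def by auto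
      ultimately show ?thesis using H by blast
    qed
  next
    fix y assume "y \<in> carrier B"
    then obtain x where x: "x \<in> carrier A" "y = h x" using sur by auto
    obtain g where g: "\<And>i. g i \<in> G i" "finite {i. g i \<noteq> \<zero>\<^bsub>A\<^esub>}" "x = (\<Oplus>\<^bsub>A\<^esub>i\<in>{i. g i \<noteq> \<zero>\<^bsub>A\<^esub>}. g i)"
      using dec[OF x(1)] by auto
    have gc: "g i \<in> carrier A" for i using g(1) G by auto
    show "\<exists>!g. (\<forall>i. g i \<in> H i) \<and> finite {i. g i \<noteq> \<zero>\<^bsub>B\<^esub>} \<and> y = (\<Oplus>\<^bsub>B\<^esub>i\<in>{i. g i \<noteq> \<zero>\<^bsub>B\<^esub>}. g i)"
    proof (rule ex1I[of _ "\<lambda>i. h (g i)"])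
      have "y = (\<Oplus>\<^bsub>B\<^esub>i\<in>{i. g i \<noteq> \<zero>\<^bsub>A\<^esub>}. h (g i))"
        unfolding x(2) by (subst g(3), rule linear_over_finsum[OF A.module B.module lin]) (use gc in auto)
      then show "(\<forall>i. h (g i) \<in> H i) \<and> finite {i. h (g i) \<noteq> \<zero>\<^bsub>B\<^esub>} \<and> y = (\<Oplus>\<^bsub>B\<^esub>i\<in>{i. h (g i) \<noteq> \<zero>\<^bsub>B\<^esub>}. h (g i))"
        using g gc H hz by auto
    next
      fix g' assume g': "(\<forall>i. g' i \<in> H i) \<and> finite {i. g' i \<noteq> \<zero>\<^bsub>B\<^esub>} \<and> y = (\<Oplus>\<^bsub>B\<^esub>i\<in>{i. g' i \<noteq> \<zero>\<^bsub>B\<^esub>}. g' i)"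
      have "\<forall>i. \<exists>z. z \<in> G i \<and> g' i = h z" using g' H by blast
      then obtain e where e: "\<And>i. e i \<in> G i" "\<And>i. g' i = h (e i)" by metis
      have ec: "e i \<in> carrier A" for i using e(1) G by auto
      have supp: "{i. g' i \<noteq> \<zero>\<^bsub>B\<^esub>} = {i. e i \<noteq> \<zero>\<^bsub>A\<^esub>}" using e(2) hz ec by auto
      have fe: "g' = (\<lambda>i. h (e i))" using e(2) by (rule ext)
      have "y = finsum B g' {i. e i \<noteq> \<zero>\<^bsub>A\<^esub>}" using g' unfolding supp by blast
      also have "\<dots> = h (\<Oplus>\<^bsub>A\<^esub>i\<in>{i. e i \<noteq> \<zero>\<^bsub>A\<^esub>}. e i)"
        unfolding fe by (rule linear_over_finsum[OF A.module B.module lin, symmetric]) (use ec in auto)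
      finally have "h x = h (\<Oplus>\<^bsub>A\<^esub>i\<in>{i. e i \<noteq> \<zero>\<^bsub>A\<^esub>}. e i)" using x(2) by simp
      then have "x = (\<Oplus>\<^bsub>A\<^esub>i\<in>{i. e i \<noteq> \<zero>\<^bsub>A\<^esub>}. e i)"
        by (rule inj_onD[OF inj]) (use x(1) ec in auto)
      moreover have "finite {i. e i \<noteq> \<zero>\<^bsub>A\<^esub>}" using g' unfolding supp by blast
      ultimately have e': "(\<forall>i. e i \<in> G i) \<and> finite {i. e i \<noteq> \<zero>\<^bsub>A\<^esub>} \<and> x = (\<Oplus>\<^bsub>A\<^esub>i\<in>{i. e i \<noteq> \<zero>\<^bsub>A\<^esub>}. e i)"
        using e(1) by (intro conjI allI)
      have g'': "(\<forall>i. g i \<in> G i) \<and> finite {i. g i \<noteq> \<zero>\<^bsub>A\<^esub>} \<and> x = (\<Oplus>\<^bsub>A\<^esub>i\<in>{i. g i \<noteq> \<zero>\<^bsub>A\<^esub>}. g i)"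
        using g by (intro conjI allI)
      let ?P = "\<lambda>g. (\<forall>i. g i \<in> G i) \<and> finite {i. g i \<noteq> \<zero>\<^bsub>A\<^esub>} \<and> x = (\<Oplus>\<^bsub>A\<^esub>i\<in>{i. g i \<noteq> \<zero>\<^bsub>A\<^esub>}. g i)"
      have "e = g"
        by (rule trans[OF the1_equality[where P = ?P, OF dec[OF x(1)] e', symmetric]
              the1_equality[where P = ?P, OF dec[OF x(1)] g'']])
      then show "g' = (\<lambda>i. h (g i))" using e(2) by auto
    qed
  qed
qed

section \<open>Monoid algebras and their degenerations\<close>

abbreviation keys where "keys \<equiv> Poly_Mapping.keys"
abbreviation lookup where "lookup \<equiv> Poly_Mapping.lookup"
abbreviation single where "single \<equiv> Poly_Mapping.single"

text \<open>Subrings of a type-class ring, kept as records because the coefficient field is a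
  subfield of the algebraic closure. Arithmetic is done with the operations of the type, and only
  membership in the carrier remains to be tracked.\<close>

definition native_cring :: "('a::comm_ring_1, 'r) ring_scheme \<Rightarrow> bool" where
  "native_cring R \<longleftrightarrow> cring R \<and> monoid.mult R = (*) \<and> one R = 1 \<and> ring.zero R = 0 \<and> add R = (+)"

lemma native_cringD:
  assumes "native_cring R"
  shows "cring R" "x \<otimes>\<^bsub>R\<^esub> y = x * y" "\<one>\<^bsub>R\<^esub> = 1" "\<zero>\<^bsub>R\<^esub> = 0" "x \<oplus>\<^bsub>R\<^esub> y = x + y"
    "add R = (+)"
  using assms unfolding native_cring_def by auto

lemma native_cring_closed:
  assumes "native_cring R"
  shows "0 \<in> carrier R" "1 \<in> carrier R"
    "x \<in> carrier R \<Longrightarrow> y \<in> carrier R \<Longrightarrow> x + y \<in> carrier R"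
    "x \<in> carrier R \<Longrightarrow> y \<in> carrier R \<Longrightarrow> x * y \<in> carrier R"
    "x \<in> carrier R \<Longrightarrow> - x \<in> carrier R"
    "x \<in> carrier R \<Longrightarrow> y \<in> carrier R \<Longrightarrow> x - y \<in> carrier R"
proof -
  interpret cring R using assms by (rule native_cringD)
  note [simp] = native_cringD(2-5)[OF assms]
  show z: "0 \<in> carrier R" "1 \<in> carrier R" using zero_closed one_closed by simp_all
  show a: "x \<in> carrier R \<Longrightarrow> y \<in> carrier R \<Longrightarrow> x + y \<in> carrier R"
    "x \<in> carrier R \<Longrightarrow> y \<in> carrier R \<Longrightarrow> x * y \<in> carrier R" for x y
    using a_closed m_closed by simp_all
  show m: "- x \<in> carrier R" if x: "x \<in> carrier R" for x
  proof -
    have "x + \<ominus>\<^bsub>R\<^esub> x = 0" using r_neg[OF x] by simp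
    then have "- x = \<ominus>\<^bsub>R\<^esub> x" by (metis add_eq_0_iff)
    then show ?thesis using a_inv_closed[OF x] by simp
  qed
  show "x \<in> carrier R \<Longrightarrow> y \<in> carrier R \<Longrightarrow> x - y \<in> carrier R"
    using a(1)[of x "- y"] m[of y] by simp
qed

lemma native_a_minus:
  assumes "native_cring R" "x \<in> carrier R"
  shows "\<ominus>\<^bsub>R\<^esub> x = - x"
proof -
  interpret cring R using assms(1) by (rule native_cringD)
  have "x + \<ominus>\<^bsub>R\<^esub> x = 0" using r_neg[OF assms(2)] native_cringD[OF assms(1)] by simp
  then show ?thesis by (metis add_eq_0_iff)
qed

lemma native_cringI:
  assumes "0 \<in> carrier R" "1 \<in> carrier R"
    "\<And>x y. x \<in> carrier R \<Longrightarrow> y \<in> carrier R \<Longrightarrow> x + y \<in> carrier R"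
    "\<And>x y. x \<in> carrier R \<Longrightarrow> y \<in> carrier R \<Longrightarrow> x * y \<in> carrier R"
    "\<And>x. x \<in> carrier R \<Longrightarrow> - x \<in> carrier R"
    and ops: "monoid.mult R = (*)" "one R = 1" "ring.zero R = 0" "add R = (+)"
  shows "native_cring R"
  unfolding native_cring_def
proof (intro conjI ops cringI abelian_groupI comm_monoidI)
  show "\<exists>y\<in>carrier R. y \<oplus>\<^bsub>R\<^esub> x = \<zero>\<^bsub>R\<^esub>" if "x \<in> carrier R" for x
    using assms(5)[OF that] by (intro bexI[of _ "- x"]) (simp_all add: ops)
qed (use assms in \<open>auto simp: algebra_simps\<close>)

lemma poly_mapping_sum_single: "P = (\<Sum>u\<in>keys P. single u (lookup P u))"
proof (rule poly_mapping_eqI)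
  fix v
  have "(\<Sum>u\<in>keys P. lookup (single u (lookup P u)) v) = (\<Sum>u\<in>keys P. if u = v then lookup P u else 0)"
    by (rule sum.cong) (auto simp: lookup_single when_def)
  then show "lookup P v = lookup (\<Sum>u\<in>keys P. single u (lookup P u)) v"
    by (simp add: lookup_sum in_keys_iff)
qed

lemma monoid_algebra_simps [simp]:
  "P \<in> carrier (monoid_algebra k E) \<longleftrightarrow> keys P \<subseteq> E \<and> (\<forall>e. lookup P e \<in> k)"
  "monoid.mult (monoid_algebra k E) = (*)" "one (monoid_algebra k E) = 1"
  "ring.zero (monoid_algebra k E) = 0" "add (monoid_algebra k E) = (+)"
  "module.smult (monoid_algebra k E) = (\<lambda>c P. single 0 c * P)"
  by (simp_all add: monoid_algebra_def)

lemma single_in_monoid_algebra: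
  "e \<in> E \<Longrightarrow> a \<in> k \<Longrightarrow> 0 \<in> k \<Longrightarrow> single e a \<in> carrier (monoid_algebra k E)"
  by (auto simp: lookup_single when_def)

text \<open>Biadditive identities need only be checked on monomials. Since \<open>k\<close> is the
  carrier of a ring, partial sums of monomials stay inside the algebra, so the case
  \<open>add\<close> may assume both summands in the carrier.\<close>

lemma monoid_algebra_induct [consumes 3, case_names zero single add]:
  assumes P: "P \<in> carrier (monoid_algebra k E)" and k: "native_cring R" "k = carrier R"
    and zero: "Q 0" and single: "\<And>e a. e \<in> E \<Longrightarrow> a \<in> k \<Longrightarrow> Q (single e a)"
    and add: "\<And>P P'. P \<in> carrier (monoid_algebra k E) \<Longrightarrow> P' \<in> carrier (monoid_algebra k E) \<Longrightarrow>
       Q P \<Longrightarrow> Q P' \<Longrightarrow> Q (P + P')"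
  shows "Q P"
proof -
  note cl = native_cring_closed[OF k(1), folded k(2)]
  have "(\<Sum>u\<in>F. single u (lookup P u)) \<in> carrier (monoid_algebra k E) \<and> Q (\<Sum>u\<in>F. single u (lookup P u))"
    if "finite F" "F \<subseteq> E" for F
    using that
  proof (induction F)
    case empty
    then show ?case using zero cl by simp
  next
    case (insert u F)
    have s: "single u (lookup P u) \<in> carrier (monoid_algebra k E)"
      using insert P cl by (intro single_in_monoid_algebra) auto
    with insert have "single u (lookup P u) + (\<Sum>u\<in>F. single u (lookup P u)) \<in> carrier (monoid_algebra k E)"
      using cl(3) keys_add[of "single u (lookup P u)" "\<Sum>u\<in>F. single u (lookup P u)"]
      by (auto simp: lookup_add simp del: keys_single)
    moreover have "Q (single u (lookup P u) + (\<Sum>u\<in>F. single u (lookup P u)))"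
      using add[OF s] insert single P by simp
    ultimately show ?case using insert by simp
  qed
  from this[of "keys P"] show ?thesis
    using P poly_mapping_sum_single[of P] by simp
qed

lemma single_zero_mult: "single 0 (a * b) = single 0 a * (single 0 b :: 'e::comm_monoid_add \<Rightarrow>\<^sub>0 'k::comm_ring_1)"
  by (simp add: mult_single)

lemma monoid_algebra_algebra:
  assumes R: "native_cring R" and E: "0 \<in> E" "\<And>u v. u \<in> E \<Longrightarrow> v \<in> E \<Longrightarrow> u + v \<in> E"
  shows "Module.algebra R (monoid_algebra (carrier R) E)" (is "Module.algebra R ?A")
    and "native_cring (monoid_algebra (carrier R) E)"
proof -
  note cl = native_cring_closed[OF R]
  have add: "P + Q \<in> carrier ?A" if "P \<in> carrier ?A" "Q \<in> carrier ?A" for P Q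
    using that cl keys_add[of P Q] by (auto simp: lookup_add)
  have mult: "P * Q \<in> carrier ?A" if "P \<in> carrier ?A" "Q \<in> carrier ?A" for P Q
    using that(1) R refl
  proof (induction P rule: monoid_algebra_induct)
    case (single e a)
    show ?case using that(2) R refl
    proof (induction Q rule: monoid_algebra_induct)
      case (single e' a')
      then show ?case using \<open>e \<in> E\<close> \<open>a \<in> carrier R\<close> E cl
        by (subst mult_single, intro single_in_monoid_algebra) auto
    qed (use add cl in \<open>auto simp: distrib_left\<close>)
  qed (use add cl in \<open>auto simp: distrib_right\<close>)
  have sg: "single 0 c \<in> carrier ?A" if "c \<in> carrier R" for c
    using that cl E by (intro single_in_monoid_algebra) auto
  show N: "native_cring ?A"
  proof (rule native_cringI)
    show "1 \<in> carrier ?A" using sg[OF cl(2)] by (simp only: single_one)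
  qed (use add mult cl in auto)
  show "Module.algebra R ?A"
    by (rule algebraI)
      (use native_cringD(1)[OF R] native_cringD(1)[OF N] mult sg in
        \<open>auto simp: native_cringD[OF R] single_add algebra_simps single_zero_mult\<close>)
qed

text \<open>Gradings and filtrations are given as spans of monomials; this turns them into
  conditions on supports.\<close>

lemma lin_span_monoid_algebra:
  fixes R :: "('k::comm_ring_1, 'r) ring_scheme" and E :: "'e::comm_monoid_add set"
  assumes R: "native_cring R" and E: "0 \<in> E" "\<And>u v. u \<in> E \<Longrightarrow> v \<in> E \<Longrightarrow> u + v \<in> E" and V: "V \<subseteq> E"
  shows "lin_span R (monoid_algebra (carrier R) E) {single v 1 | v. v \<in> V} =
    {P \<in> carrier (monoid_algebra (carrier R) E). keys P \<subseteq> V}" (is "lin_span R ?A ?B = ?N")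
proof
  interpret Module.algebra R ?A by (rule monoid_algebra_algebra[OF R E])
  note cl = native_cring_closed[OF R]
  have B: "?B \<subseteq> carrier ?A" using V cl by (auto simp: lookup_single when_def)
  note sB = lin_span_submodule[OF B]
  have add: "keys (a + b) \<subseteq> V" if "keys a \<subseteq> V" "keys b \<subseteq> V" for a b :: "'e \<Rightarrow>\<^sub>0 'k"
    using keys_add[of a b] that by auto
  have sm: "keys (single 0 c * a) \<subseteq> V" if "keys a \<subseteq> V" for c and a :: "'e \<Rightarrow>\<^sub>0 'k"
    using keys_mult[of "single 0 c" a] that by (auto split: if_splits)
  have "submodule ?N R ?A"
  proof (rule submoduleI_smult)
    show "a \<oplus>\<^bsub>?A\<^esub> b \<in> ?N" if "a \<in> ?N" "b \<in> ?N" for a b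
      using that M.a_closed[of a b] add by simp
    show "a \<odot>\<^bsub>?A\<^esub> x \<in> ?N" if "a \<in> carrier R" "x \<in> ?N" for a x
      using that smult_closed[of a x] sm by simp
  qed (use cl in auto)
  then show "lin_span R ?A ?B \<subseteq> ?N"
    by (rule lin_span_least) (use V cl in \<open>auto simp: lookup_single when_def\<close>)
  show "?N \<subseteq> lin_span R ?A ?B"
  proof
    fix P assume P: "P \<in> ?N"
    then have "P \<in> carrier (monoid_algebra (carrier R) V)" by simp
    then show "P \<in> lin_span R ?A ?B"
      using R refl
    proof (induction P rule: monoid_algebra_induct)
      case zero
      then show ?case using submodule_zero[OF sB] by simp
    next
      case (single e a)
      then have "single e 1 \<in> lin_span R ?A ?B" using lin_span_incl[OF B] by auto
      from submoduleE(4)[OF sB _ this, of a] single show ?case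
        by (simp add: mult_single)
    next
      case (add P P')
      then show ?case using submoduleE(5)[OF sB, of P P'] by simp
    qed
  qed
qed

text \<open>The span ignores the ring multiplication, so the monoid algebra and its degeneration
  have the same spans.\<close>

lemma lin_span_cong_additive:
  fixes A B :: "('k, 'b, 'm) module_scheme"
  assumes "carrier A = carrier B" "add A = add B" "ring.zero A = ring.zero B" "module.smult A = module.smult B"
  shows "lin_span k A = lin_span k B"
  unfolding lin_span_def finsum_def using assms by simp

text \<open>Cancellation may make the support of \<open>P + Q\<close> smaller than the union of the
  supports; the missing exponents carry coefficient 0, and \<open>f u 0 = 0\<close>.\<close>

lemma additive_sum_keys:
  fixes f :: "'e \<Rightarrow> 'k::ab_group_add \<Rightarrow> 'c::comm_monoid_add"
  assumes "\<And>u. f u 0 = 0" "\<And>u a b. f u (a + b) = f u a + f u b"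
  shows "(\<Sum>u\<in>keys (P + Q). f u (lookup (P + Q) u)) =
    (\<Sum>u\<in>keys P. f u (lookup P u)) + (\<Sum>u\<in>keys Q. f u (lookup Q u))"
  by (rule setsum_keys_plus_distrib) (use assms in auto)

lemma lookup_mapp_zero:
  assumes "\<And>u. f u 0 = 0"
  shows "lookup (Poly_Mapping.mapp f P) u = f u (lookup P u)"
  using assms by (simp add: lookup_mapp in_keys_iff when_def)

lemma mapp_add:
  assumes "\<And>u. f u 0 = 0" "\<And>u a b. f u (a + b) = f u a + f u b"
  shows "Poly_Mapping.mapp f (P + Q) = Poly_Mapping.mapp f P + Poly_Mapping.mapp f Q"
  by (rule poly_mapping_eqI) (simp add: lookup_mapp_zero assms lookup_add)

lemma mapp_single:
  assumes "\<And>u. f u 0 = 0"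
  shows "Poly_Mapping.mapp f (single u a) = single u (f u a)"
  by (rule poly_mapping_eqI) (auto simp: lookup_mapp_zero assms lookup_single when_def)

section \<open>The degenerate monoid algebra\<close>

text \<open>The special fibre degenerates along \<open>m\<close>, the associated graded ring along
  \<open>w\<close>. \<open>w_add_iff\<close> is the only link between the two functions, and it
  makes them discard the same products.\<close>

locale degenerate_monoid_algebra =
  fixes M :: "'e::comm_monoid_add set" and m w :: "'e \<Rightarrow> real"
  assumes zero_mem: "0 \<in> M" and add_mem: "u \<in> M \<Longrightarrow> v \<in> M \<Longrightarrow> u + v \<in> M"
    and m_zero: "m 0 = 0" and m_add: "u \<in> M \<Longrightarrow> v \<in> M \<Longrightarrow> m (u + v) \<le> m u + m v"
    and w_zero: "w 0 = 0" and w_add: "u \<in> M \<Longrightarrow> v \<in> M \<Longrightarrow> w (u + v) \<le> w u + w v"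
    and w_add_iff: "u \<in> M \<Longrightarrow> v \<in> M \<Longrightarrow> w (u + v) = w u + w v \<longleftrightarrow> m (u + v) = m u + m v"
begin

definition tterm :: "'e \<Rightarrow> 'e \<Rightarrow> 'k \<Rightarrow> ('e \<Rightarrow>\<^sub>0 'k::comm_ring_1)" where
  "tterm u v a = (if m (u + v) = m u + m v then single (u + v) a else 0)"

definition tmul :: "('e \<Rightarrow>\<^sub>0 'k::comm_ring_1) \<Rightarrow> ('e \<Rightarrow>\<^sub>0 'k) \<Rightarrow> ('e \<Rightarrow>\<^sub>0 'k)" where
  "tmul P Q = (\<Sum>u\<in>keys P. \<Sum>v\<in>keys Q. tterm u v (lookup P u * lookup Q v))"

lemma tterm_zero [simp]: "tterm u v 0 = 0"
  by (simp add: tterm_def)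

lemma tterm_add: "tterm u v (a + b) = tterm u v a + tterm u v b"
  by (simp add: tterm_def single_add)

lemma tterm_commute: "tterm u v a = tterm v u a"
  by (simp add: tterm_def add.commute)

lemma tmul_commute: "tmul P Q = tmul Q P"
  unfolding tmul_def by (subst sum.swap) (simp add: tterm_commute mult.commute)

lemma tmul_add_left: "tmul (P + P') Q = tmul P Q + tmul P' Q"
  unfolding tmul_def
  by (rule additive_sum_keys[of "\<lambda>u a. \<Sum>v\<in>keys Q. tterm u v (a * lookup Q v)"])
    (simp_all add: distrib_right tterm_add sum.distrib)

lemma tmul_add_right: "tmul Q (P + P') = tmul Q P + tmul Q P'"
  by (simp add: tmul_commute[of Q] tmul_add_left)

lemma tmul_zero [simp]: "tmul 0 Q = 0" "tmul Q 0 = 0"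
  by (simp_all add: tmul_def)

lemma tmul_single: "tmul (single u a) (single v b) = tterm u v (a * b)"
  by (simp add: tmul_def)

text \<open>Scalars sit in exponent 0, and \<open>m 0 = 0\<close> makes every pair containing 0
  additive. Scalar multiplication can thus be handled by the laws for \<open>tmul\<close>.\<close>

lemma single_mult_eq_tmul: "single 0 c * Q = tmul (single 0 c) Q"
proof -
  have "single 0 c * Q = (\<Sum>v\<in>keys Q. single 0 c * single v (lookup Q v))"
    by (subst poly_mapping_sum_single[of Q]) (simp add: sum_distrib_left)
  also have "\<dots> = tmul (single 0 c) Q"
    by (simp add: tmul_def tterm_def m_zero mult_single)
  finally show ?thesis .
qed

definition degenerate_algebra :: "('k::comm_ring_1, 'r) ring_scheme \<Rightarrow> ('k, 'e \<Rightarrow>\<^sub>0 'k) module" where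
  "degenerate_algebra R = (monoid_algebra (carrier R) M)\<lparr>monoid.mult := tmul\<rparr>"

lemma degenerate_algebra_simps [simp]:
  "carrier (degenerate_algebra R) = carrier (monoid_algebra (carrier R) M)"
  "monoid.mult (degenerate_algebra R) = tmul" "one (degenerate_algebra R) = 1"
  "ring.zero (degenerate_algebra R) = 0" "add (degenerate_algebra R) = (+)"
  "module.smult (degenerate_algebra R) = (\<lambda>c P. single 0 c * P)"
  by (simp_all add: degenerate_algebra_def)

lemma tmul_closed:
  assumes R: "native_cring R" and PQ: "P \<in> carrier (monoid_algebra (carrier R) M)" "Q \<in> carrier (monoid_algebra (carrier R) M)"
  shows "tmul P Q \<in> carrier (monoid_algebra (carrier R) M)"
proof -
  interpret A: Module.algebra R "monoid_algebra (carrier R) M"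
    by (rule monoid_algebra_algebra[OF R zero_mem add_mem])
  note cl = native_cring_closed[OF R]
  show ?thesis
    using PQ(1) R refl
  proof (induction P rule: monoid_algebra_induct)
    case zero
    then show ?case using cl by simp
  next
    case (single u a)
    show ?case using PQ(2) R refl
    proof (induction Q rule: monoid_algebra_induct)
      case zero
      then show ?case using cl by simp
    next
      case (single v b)
      then show ?case using \<open>u \<in> M\<close> \<open>a \<in> carrier R\<close> cl add_mem
        by (auto simp: tmul_single tterm_def lookup_single when_def)
    next
      case (add P P')
      then show ?case using A.M.a_closed[OF add.IH(1,2)] by (simp add: tmul_add_right)
    qed
  next
    case (add P P')
    then show ?case using A.M.a_closed[OF add.IH(1,2)] by (simp add: tmul_add_left)
  qed
qed

text \<open>Either bracketing survives exactly when \<open>m (u + v + x) = m u + m v + m x\<close>: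
  subadditivity bounds \<open>m\<close> at each of the two stages, so equality overall forces
  equality at both.\<close>

lemma tterm_assoc_iff:
  assumes "u \<in> M" "v \<in> M" "x \<in> M"
  shows "m (u + v) = m u + m v \<and> m (u + v + x) = m (u + v) + m x \<longleftrightarrow>
    m (v + x) = m v + m x \<and> m (u + (v + x)) = m u + m (v + x)"
  using m_add[OF assms(1,2)] m_add[OF assms(2,3)] m_add[OF add_mem[OF assms(1,2)] assms(3)]
    m_add[OF assms(1) add_mem[OF assms(2,3)]] by (auto simp: add.assoc)

lemma tmul_assoc:
  assumes R: "native_cring R" and P: "P \<in> carrier (monoid_algebra (carrier R) M)"
    and Q: "Q \<in> carrier (monoid_algebra (carrier R) M)" and S: "S \<in> carrier (monoid_algebra (carrier R) M)"
  shows "tmul (tmul P Q) S = tmul P (tmul Q S)"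
  using P R refl
proof (induction P rule: monoid_algebra_induct)
  case (single u a)
  show ?case using Q R refl
  proof (induction Q rule: monoid_algebra_induct)
    case (single v b)
    show ?case using S R refl
    proof (induction S rule: monoid_algebra_induct)
      case (single x c)
      then show ?case
        using tterm_assoc_iff[of u v x] \<open>u \<in> M\<close> \<open>v \<in> M\<close>
        by (auto simp: tmul_single tterm_def mult.assoc add.assoc)
    qed (simp_all add: tmul_add_right)
  qed (simp_all add: tmul_add_left tmul_add_right)
qed (simp_all add: tmul_add_left)

lemma degenerate_algebra_algebra:
  fixes R :: "('k::comm_ring_1, 'r) ring_scheme"
  assumes R: "native_cring R"
  shows "Module.algebra R (degenerate_algebra R)"
proof -
  let ?D = "degenerate_algebra R"
  interpret A: Module.algebra R "monoid_algebra (carrier R) M"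
    by (rule monoid_algebra_algebra[OF R zero_mem add_mem])
  note cl = native_cring_closed[OF R]
  have one: "tmul 1 P = P" "tmul P 1 = P" for P :: "'e \<Rightarrow>\<^sub>0 'k"
    using single_mult_eq_tmul[of 1 P] by (simp_all add: tmul_commute[of P])
  have c: "cring ?D"
  proof (rule cringI)
    show "abelian_group ?D"
    proof (rule abelian_groupI)
      show "\<exists>y\<in>carrier ?D. y \<oplus>\<^bsub>?D\<^esub> x = \<zero>\<^bsub>?D\<^esub>"
        if "x \<in> carrier ?D" for x
        using that A.M.add.l_inv_ex[of x] by simp
      show "x \<oplus>\<^bsub>?D\<^esub> y \<in> carrier ?D"
        if "x \<in> carrier ?D" "y \<in> carrier ?D" for x y
        using that A.M.a_closed[of x y] by simp
    qed (use cl in \<open>auto simp: algebra_simps\<close>)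
    show "comm_monoid ?D"
    proof (rule comm_monoidI)
      show "\<one>\<^bsub>?D\<^esub> \<in> carrier ?D"
        using A.one_closed by simp
      show "x \<otimes>\<^bsub>?D\<^esub> y \<in> carrier ?D"
        if "x \<in> carrier ?D" "y \<in> carrier ?D" for x y
        using that tmul_closed[OF R, of x y] by simp
      show "x \<otimes>\<^bsub>?D\<^esub> y \<otimes>\<^bsub>?D\<^esub> z =
          x \<otimes>\<^bsub>?D\<^esub> (y \<otimes>\<^bsub>?D\<^esub> z)"
        if "x \<in> carrier ?D" "y \<in> carrier ?D" "z \<in> carrier ?D" for x y z
        using that tmul_assoc[OF R, of x y z] by simp
    qed (simp_all add: one tmul_commute)
  qed (simp_all add: tmul_add_left)
  show ?thesis
  proof (rule algebraI[OF native_cringD(1)[OF R] c])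
    show "a \<odot>\<^bsub>?D\<^esub> x \<in> carrier ?D"
      if "a \<in> carrier R" "x \<in> carrier ?D" for a x
      using that A.smult_closed[of a x] by simp
    show "a \<odot>\<^bsub>?D\<^esub> x \<otimes>\<^bsub>?D\<^esub> y = a \<odot>\<^bsub>?D\<^esub> (x \<otimes>\<^bsub>?D\<^esub> y)"
      if "a \<in> carrier R" "x \<in> carrier ?D" "y \<in> carrier ?D" for a x y
      using that tmul_assoc[OF R single_in_monoid_algebra[OF zero_mem that(1) cl(1)], of x y]
      by (simp add: single_mult_eq_tmul)
    show "(a \<otimes>\<^bsub>R\<^esub> b) \<odot>\<^bsub>?D\<^esub> x = a \<odot>\<^bsub>?D\<^esub> (b \<odot>\<^bsub>?D\<^esub> x)"
      if "a \<in> carrier R" "b \<in> carrier R" "x \<in> carrier ?D" for a b x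
      using that A.smult_assoc1[of a b x] by simp
  qed (simp_all add: native_cringD[OF R] single_add distrib_left distrib_right)
qed

section \<open>The grading of the degenerate algebra by \<open>w\<close>\<close>

definition degree_part :: "real \<Rightarrow> ('e \<Rightarrow>\<^sub>0 'k::comm_ring_1) \<Rightarrow> ('e \<Rightarrow>\<^sub>0 'k)" where
  "degree_part i P = Poly_Mapping.mapp (\<lambda>v a. if w v = i then a else 0) P"

lemma lookup_degree_part: "lookup (degree_part i P) v = (if w v = i then lookup P v else 0)"
  unfolding degree_part_def by (subst lookup_mapp_zero) auto

lemma degree_part_add: "degree_part i (P + Q) = degree_part i P + degree_part i Q"
  unfolding degree_part_def by (subst mapp_add) auto

lemma keys_degree_part: "keys (degree_part i P) = {v \<in> keys P. w v = i}"
  by (auto simp: in_keys_iff lookup_degree_part split: if_splits)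

definition homogeneous_part :: "('k::comm_ring_1, 'r) ring_scheme \<Rightarrow> real \<Rightarrow> ('e \<Rightarrow>\<^sub>0 'k) set" where
  "homogeneous_part R i = {P \<in> carrier (degenerate_algebra R). \<forall>v\<in>keys P. w v = i}"

lemma homogeneous_part_eq_lin_span:
  assumes R: "native_cring R"
  shows "homogeneous_part R i = lin_span R (degenerate_algebra R) {single v 1 | v. v \<in> M \<and> w v = i}"
proof -
  have "lin_span R (degenerate_algebra R) = lin_span R (monoid_algebra (carrier R) M)"
    by (rule lin_span_cong_additive) simp_all
  moreover have "lin_span R (monoid_algebra (carrier R) M) {single v 1 | v. v \<in> {v\<in>M. w v = i}} = homogeneous_part R i"
    by (subst lin_span_monoid_algebra[OF R zero_mem add_mem]) (auto simp: homogeneous_part_def)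
  ultimately show ?thesis by simp
qed

lemma degree_part_in:
  assumes "native_cring R" "P \<in> carrier (degenerate_algebra R)"
  shows "degree_part i P \<in> homogeneous_part R i"
  using assms(2) native_cring_closed(1)[OF assms(1)]
  by (auto simp: homogeneous_part_def keys_degree_part lookup_degree_part)

lemma sum_degree_part:
  assumes "finite I" "w ` keys P \<subseteq> I"
  shows "(\<Sum>i\<in>I. degree_part i P) = P"
proof (rule poly_mapping_eqI)
  fix v
  have "(\<Sum>i\<in>I. lookup (degree_part i P) v) = (if w v \<in> I then lookup P v else 0)"
    using assms(1) by (simp add: lookup_degree_part)
  also have "\<dots> = lookup P v" using assms(2) by (auto simp: image_subset_iff in_keys_iff)
  finally show "lookup (\<Sum>i\<in>I. degree_part i P) v = lookup P v" by (simp add: lookup_sum)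
qed

lemma degenerate_algebra_graded:
  fixes R :: "('k::comm_ring_1, 'r) ring_scheme"
  assumes R: "native_cring R"
  shows "graded_algebra R (degenerate_algebra R) (homogeneous_part R)"
proof -
  let ?D = "degenerate_algebra R"
  interpret A: Module.algebra R "?D"
    by (rule degenerate_algebra_algebra[OF R])
  note cl = native_cring_closed[OF R]
  have B: "{single v 1 | v. v \<in> M \<and> w v = i} \<subseteq> carrier ?D" for i
    using cl by (auto simp: lookup_single when_def)
  show ?thesis
    unfolding graded_algebra_def
  proof (intro conjI allI ballI)
    show "Module.algebra R ?D" ..
    show "submodule (homogeneous_part R i) R ?D" for i
      unfolding homogeneous_part_eq_lin_span[OF R] by (rule A.lin_span_submodule[OF B])
    have "(1 :: 'e \<Rightarrow>\<^sub>0 'k) = single 0 1" by simp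
    then show "\<one>\<^bsub>?D\<^esub> \<in> homogeneous_part R 0"
      using A.one_closed by (auto simp: homogeneous_part_def w_zero)
  next
    fix P assume P: "P \<in> carrier ?D"
    have fs: "finsum ?D h I = sum h I" if "\<And>i. h i \<in> homogeneous_part R i" for h I
      by (rule finsum_eq_sum) (use that in \<open>auto simp: A.abelian_monoid_axioms homogeneous_part_def\<close>)
    show "\<exists>!h. (\<forall>i. h i \<in> homogeneous_part R i) \<and> finite {i. h i \<noteq> \<zero>\<^bsub>?D\<^esub>} \<and>
        P = (\<Oplus>\<^bsub>?D\<^esub>i\<in>{i. h i \<noteq> \<zero>\<^bsub>?D\<^esub>}. h i)"
    proof (rule ex1I[of _ "\<lambda>i. degree_part i P"])
      have sub: "{i. degree_part i P \<noteq> 0} \<subseteq> w ` keys P"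
        using keys_degree_part[of _ P] by (force simp flip: keys_eq_empty)
      then have fin: "finite {i. degree_part i P \<noteq> 0}" by (rule finite_subset) simp
      have "P = (\<Sum>i\<in>w ` keys P. degree_part i P)" by (rule sum_degree_part[symmetric]) auto
      also have "\<dots> = (\<Sum>i\<in>{i. degree_part i P \<noteq> 0}. degree_part i P)"
        by (rule sum.mono_neutral_right) (use sub in auto)
      finally show "(\<forall>i. degree_part i P \<in> homogeneous_part R i) \<and> finite {i. degree_part i P \<noteq> \<zero>\<^bsub>?D\<^esub>} \<and>
        P = (\<Oplus>\<^bsub>?D\<^esub>i\<in>{i. degree_part i P \<noteq> \<zero>\<^bsub>?D\<^esub>}. degree_part i P)"
        using degree_part_in[OF R P] fin by (simp add: fs)
    next
      \<comment> \<open>Uniqueness: the coefficient of \<open>P\<close> at v can only come from the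
        component of degree \<open>w v\<close>, so each \<open>h i\<close> is forced to be the
        degree part.\<close>
      fix h assume h: "(\<forall>i. h i \<in> homogeneous_part R i) \<and> finite {i. h i \<noteq> \<zero>\<^bsub>?D\<^esub>} \<and>
        P = (\<Oplus>\<^bsub>?D\<^esub>i\<in>{i. h i \<noteq> \<zero>\<^bsub>?D\<^esub>}. h i)"
      have fin: "finite {i. h i \<noteq> 0}" and hom: "h i \<in> homogeneous_part R i" for i using h by auto
      have P_eq: "P = sum h {i. h i \<noteq> 0}" using h by (simp add: fs)
      have z: "lookup (h i) v = 0" if "w v \<noteq> i" for i v
        using hom[of i] that by (auto simp: homogeneous_part_def in_keys_iff)
      have "lookup P v = lookup (h (w v)) v" for v
      proof -
        have "lookup P v = (\<Sum>i\<in>{i. h i \<noteq> 0}. lookup (h i) v)" unfolding P_eq by (simp add: lookup_sum)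
        also have "\<dots> = (\<Sum>i\<in>{i. h i \<noteq> 0}. if i = w v then lookup (h i) v else 0)"
          by (rule sum.cong) (use z in auto)
        also have "\<dots> = lookup (h (w v)) v" using fin by auto
        finally show ?thesis .
      qed
      then have "h i = degree_part i P" for i
        by (intro poly_mapping_eqI) (use z in \<open>auto simp: lookup_degree_part\<close>)
      then show "h = (\<lambda>i. degree_part i P)" by auto
    qed
  next
    fix i j P Q assume PQ: "P \<in> homogeneous_part R i" "Q \<in> homogeneous_part R j"
    \<comment> \<open>A pair that survives in \<open>tmul\<close> is additive for \<open>m\<close>,
      hence for \<open>w\<close> by \<open>w_add_iff\<close>; a discarded pair contributes
      nothing.\<close>
    have sub: "keys (tterm u v a) \<subseteq> {x. w x = i + j}" if "u \<in> keys P" "v \<in> keys Q" for u v a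
    proof -
      have "u \<in> M" "v \<in> M" "w u = i" "w v = j" using that PQ by (auto simp: homogeneous_part_def)
      then show ?thesis using w_add_iff[of u v] by (auto simp: tterm_def)
    qed
    have "keys (tmul P Q) \<subseteq> {x. w x = i + j}"
      unfolding tmul_def by (intro order_trans[OF keys_sum] UN_least sub)
    then show "P \<otimes>\<^bsub>?D\<^esub> Q \<in> homogeneous_part R (i + j)"
      using PQ tmul_closed[OF R, of P Q] by (auto simp: homogeneous_part_def)
  qed
qed

end

section \<open>Base change\<close>

text \<open>Here \<open>B\<close> is already known to be an algebra and only its grading is missing;
  the grading is carried along the inverse of \<open>h\<close>. This serves the special fibre and
  its base change, where the natural map goes towards the model.\<close>

lemma graded_algebra_transport_inv:
  assumes gA: "graded_algebra k A G" and aB: "Module.algebra k B" and iso: "h \<in> ring_iso B A" and lin: "linear_over k B A h"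
    and H: "\<And>i. H i \<subseteq> carrier B" "\<And>i. h ` H i = G i"
  shows "graded_algebra k B H"
proof -
  interpret B: Module.algebra k B by fact
  interpret A: Module.algebra k A using gA unfolding graded_algebra_def by auto
  have bij: "inj_on h (carrier B)" "h ` carrier B = carrier A"
    using iso unfolding ring_iso_def bij_betw_def by auto
  define h' where "h' = inv_into (carrier B) h"
  have h': "h' (h x) = x" if "x \<in> carrier B" for x
    using that bij by (simp add: h'_def)
  have sur: "\<exists>x\<in>carrier B. y = h x" if "y \<in> carrier A" for y using that bij by auto
  note h = linear_overD[OF lin]
  show ?thesis
  proof (rule graded_algebra_transport[OF gA])
    show "h' \<in> ring_iso A B" unfolding h'_def
      by (rule ring_iso_set_sym[OF B.ring_axioms iso])
    show "linear_over k A B h'"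
      unfolding linear_over_def
    proof (intro conjI ballI Pi_I)
      show "h' x \<in> carrier B" if "x \<in> carrier A" for x using sur[OF that] h' by auto
      show "h' (x \<oplus>\<^bsub>A\<^esub> y) = h' x \<oplus>\<^bsub>B\<^esub> h' y" if "x \<in> carrier A" "y \<in> carrier A" for x y
        using sur[OF that(1)] sur[OF that(2)] h' by (auto simp flip: h(2))
      show "h' (c \<odot>\<^bsub>A\<^esub> x) = c \<odot>\<^bsub>B\<^esub> h' x" if "c \<in> carrier k" "x \<in> carrier A" for c x
        using that(1) sur[OF that(2)] h' by (auto simp flip: h(3))
    qed
    have "h \<zero>\<^bsub>B\<^esub> = \<zero>\<^bsub>A\<^esub>" by (rule linear_over_zero[OF B.module A.module lin])
    then show "h' \<zero>\<^bsub>A\<^esub> = \<zero>\<^bsub>B\<^esub>" using h'[OF B.M.zero_closed] by simp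
    show "H i = h' ` G i" for i
    proof -
      have "h' ` h ` H i = (\<lambda>x. x) ` H i"
        unfolding image_image by (rule image_cong[OF refl]) (use H(1)[of i] h' in blast)
      then show ?thesis using H(2) by simp
    qed
  qed
qed

lemma with_smult_cring:
  assumes "cring R"
  shows "cring (with_smult R sm)"
proof -
  interpret cring R by fact
  have inv: "\<exists>y\<in>carrier R. y \<oplus>\<^bsub>R\<^esub> x = \<zero>\<^bsub>R\<^esub>" if "x \<in> carrier R" for x
    using that l_neg[of x] a_inv_closed[of x] by blast
  show ?thesis
    by (rule cringI[OF abelian_groupI comm_monoidI])
      (auto simp: a_ac m_ac l_distr r_distr inv)
qed

lemma additive_sum_keys_diff:
  fixes f :: "'x \<Rightarrow> 'k::ab_group_add \<Rightarrow> 'c::ab_group_add"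
  assumes "\<And>u. f u 0 = 0" "\<And>u a b. f u (a + b) = f u a + f u b"
  shows "(\<Sum>u\<in>keys (P - Q). f u (lookup (P - Q) u)) =
    (\<Sum>u\<in>keys P. f u (lookup P u)) - (\<Sum>u\<in>keys Q. f u (lookup Q u))"
  using additive_sum_keys[of f "P - Q" Q] assms by simp

section \<open>The tensor product of two algebras\<close>

locale tensor_algebras =
  A: Module.algebra k A + B: Module.algebra k B
  for k :: "('k, 'r) ring_scheme" and A :: "('k, 'b, 's) module_scheme" and B :: "('k, 'c, 't) module_scheme"
begin

abbreviation "TF \<equiv> tensor_free A B"

text \<open>The product of the monoid ring over the integers of the multiplicative monoid
  \<open>A \<times> B\<close>.\<close>

definition tfm :: "('b \<times> 'c \<Rightarrow>\<^sub>0 int) \<Rightarrow> ('b \<times> 'c \<Rightarrow>\<^sub>0 int) \<Rightarrow> ('b \<times> 'c \<Rightarrow>\<^sub>0 int)" where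
  "tfm P Q = (\<Sum>x\<in>keys P. \<Sum>y\<in>keys Q.
     single (fst x \<otimes>\<^bsub>A\<^esub> fst y, snd x \<otimes>\<^bsub>B\<^esub> snd y) (lookup P x * lookup Q y))"

lemma TF_simps [simp]:
  "P \<in> carrier TF \<longleftrightarrow> keys P \<subseteq> carrier A \<times> carrier B" "monoid.mult TF = tfm"
  "one TF = single (\<one>\<^bsub>A\<^esub>, \<one>\<^bsub>B\<^esub>) 1" "ring.zero TF = 0" "add TF = (+)"
  by (simp_all add: tensor_free_def tfm_def[abs_def])

lemma tfm_single: "tfm (single (a, b) 1) (single (a', b') 1) = single (a \<otimes>\<^bsub>A\<^esub> a', b \<otimes>\<^bsub>B\<^esub> b') 1"
  by (simp add: tfm_def)

lemma tfm_diff_left: "tfm (P - P') Q = tfm P Q - tfm P' Q"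
  unfolding tfm_def
  by (rule additive_sum_keys_diff[of "\<lambda>x a. \<Sum>y\<in>keys Q. single (fst x \<otimes>\<^bsub>A\<^esub> fst y, snd x \<otimes>\<^bsub>B\<^esub> snd y) (a * lookup Q y)"])
    (simp_all add: distrib_right single_add sum.distrib)

lemma tfm_diff_right: "tfm Q (P - P') = tfm Q P - tfm Q P'"
proof -
  have sw: "tfm P Q = (\<Sum>y\<in>keys Q. \<Sum>x\<in>keys P.
     single (fst x \<otimes>\<^bsub>A\<^esub> fst y, snd x \<otimes>\<^bsub>B\<^esub> snd y) (lookup P x * lookup Q y))" for P Q
    unfolding tfm_def by (rule sum.swap)
  show ?thesis
    unfolding sw
    by (rule additive_sum_keys_diff[of "\<lambda>y a. \<Sum>x\<in>keys Q. single (fst x \<otimes>\<^bsub>A\<^esub> fst y, snd x \<otimes>\<^bsub>B\<^esub> snd y) (lookup Q x * a)"])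
      (simp_all add: distrib_left single_add sum.distrib)
qed

lemma tfm_zero [simp]: "tfm 0 Q = 0" "tfm Q 0 = 0"
  by (simp_all add: tfm_def)

lemma tfm_uminus: "tfm (- P) Q = - tfm P Q" "tfm Q (- P) = - tfm Q P"
  using tfm_diff_left[of 0 P Q] tfm_diff_right[of Q 0 P] by simp_all

lemma tfm_add: "tfm (P + P') Q = tfm P Q + tfm P' Q" "tfm Q (P + P') = tfm Q P + tfm Q P'"
  using tfm_diff_left[of P "- P'" Q] tfm_diff_right[of Q P "- P'"] by (simp_all add: tfm_uminus)

text \<open>\<open>tfm\<close> is biadditive, so each law reduces to generators, where it is the
  corresponding law of \<open>A\<close> and of \<open>B\<close> in the two components. The reduction
  uses that supports lie in the carriers, since \<open>A\<close> and \<open>B\<close> are rings only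
  there.\<close>

lemma TF_cring: "cring TF"
proof (rule cringI)
  show "abelian_group TF"
  proof (rule abelian_groupI)
    show "\<exists>y\<in>carrier TF. y \<oplus>\<^bsub>TF\<^esub> x = \<zero>\<^bsub>TF\<^esub>" if "x \<in> carrier TF" for x
      using that by (intro bexI[of _ "- x"]) simp_all
    show "x \<oplus>\<^bsub>TF\<^esub> y \<in> carrier TF" if "x \<in> carrier TF" "y \<in> carrier TF" for x y
      using that keys_add[of x y] by auto
  qed (auto simp: algebra_simps)
  have comm: "tfm P Q = tfm Q P" if "P \<in> carrier TF" "Q \<in> carrier TF" for P Q
    using that(1)[unfolded TF_simps]
  proof (induction P rule: frag_induction)
    case (one x)
    show ?case using that(2)[unfolded TF_simps]
    proof (induction Q rule: frag_induction)
      case (one y)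
      then show ?case using \<open>x \<in> _\<close>
        by (cases x; cases y) (simp add: tfm_single A.m_comm B.m_comm)
    qed (simp_all add: tfm_diff_left tfm_diff_right)
  qed (simp_all add: tfm_diff_left tfm_diff_right)
  have assoc: "tfm (tfm P Q) S = tfm P (tfm Q S)" if "P \<in> carrier TF" "Q \<in> carrier TF" "S \<in> carrier TF" for P Q S
    using that(1)[unfolded TF_simps]
  proof (induction P rule: frag_induction)
    case (one x)
    show ?case using that(2)[unfolded TF_simps]
    proof (induction Q rule: frag_induction)
      case (one y)
      show ?case using that(3)[unfolded TF_simps]
      proof (induction S rule: frag_induction)
        case (one z)
        then show ?case using \<open>x \<in> _\<close> \<open>y \<in> _\<close>
          by (cases x; cases y; cases z) (simp add: tfm_single A.m_assoc B.m_assoc)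
      qed (simp_all add: tfm_diff_left tfm_diff_right)
    qed (simp_all add: tfm_diff_left tfm_diff_right)
  qed (simp_all add: tfm_diff_left tfm_diff_right)
  have one: "tfm (single (\<one>\<^bsub>A\<^esub>, \<one>\<^bsub>B\<^esub>) 1) P = P" if "P \<in> carrier TF" for P
    using that[unfolded TF_simps]
  proof (induction P rule: frag_induction)
    case (one x)
    then show ?case by (cases x) (simp add: tfm_single)
  qed (simp_all add: tfm_diff_right)
  have closed: "tfm P Q \<in> carrier TF" if "P \<in> carrier TF" "Q \<in> carrier TF" for P Q
  proof -
    have "fst x \<in> carrier A \<and> snd x \<in> carrier B" if "x \<in> keys P \<or> x \<in> keys Q" for x
      using that \<open>P \<in> carrier TF\<close> \<open>Q \<in> carrier TF\<close> by auto
    then have "keys (tfm P Q) \<subseteq> carrier A \<times> carrier B"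
      unfolding tfm_def by (intro order_trans[OF keys_sum] UN_least) auto
    then show ?thesis by simp
  qed
  show "comm_monoid TF"
    by (rule comm_monoidI) (use comm assoc one closed in auto)
qed (simp add: tfm_add)

abbreviation "rels \<equiv> tensor_relations k A B"
abbreviation "I \<equiv> genideal TF rels"
abbreviation "Q \<equiv> base_change k A B"
abbreviation "pure \<equiv> pure_tensor k A B"

lemma rels_sub: "rels \<subseteq> carrier TF"
proof
  fix x assume "x \<in> rels"
  then show "x \<in> carrier TF"
    unfolding tensor_relations_def Let_def
    by (auto dest!: subsetD[OF keys_diff] split: if_splits)
qed

sublocale TF: cring TF by (rule TF_cring)

lemma ideal_I: "ideal I TF"
  by (rule TF.genideal_ideal[OF rels_sub])

sublocale I: ideal I TF by (rule ideal_I)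

lemma TF_minus:
  assumes "P \<in> carrier TF" "P' \<in> carrier TF"
  shows "P \<ominus>\<^bsub>TF\<^esub> P' = P - P'"
proof -
  have "P' + \<ominus>\<^bsub>TF\<^esub> P' = 0" using TF.r_neg[OF assms(2)] by simp
  then have "\<ominus>\<^bsub>TF\<^esub> P' = - P'" by (metis add_eq_0_iff)
  then show ?thesis unfolding a_minus_def by simp
qed

lemma coset_eq_iff:
  assumes "P \<in> carrier TF" "P' \<in> carrier TF"
  shows "I +>\<^bsub>TF\<^esub> P = I +>\<^bsub>TF\<^esub> P' \<longleftrightarrow> P - P' \<in> I"
  using TF.quotient_eq_iff_same_a_r_cos[OF ideal_I assms] TF_minus[OF assms] by simp

lemma base_change_simps:
  "carrier Q = a_rcosets\<^bsub>TF\<^esub> I" "\<one>\<^bsub>Q\<^esub> = pure \<one>\<^bsub>A\<^esub> \<one>\<^bsub>B\<^esub>" "\<zero>\<^bsub>Q\<^esub> = I"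
  "c \<odot>\<^bsub>Q\<^esub> x = pure \<one>\<^bsub>A\<^esub> c \<otimes>\<^bsub>Q\<^esub> x"
  "add Q = add (TF Quot I)" "monoid.mult Q = monoid.mult (TF Quot I)"
  by (simp_all add: base_change_def Let_def FactRing_def pure_tensor_def)

lemma base_change_cring: "cring Q"
  unfolding base_change_def Let_def by (rule with_smult_cring[OF I.quotient_is_cring[OF TF_cring]])

sublocale Q: cring Q by (rule base_change_cring)

lemma coset_in: "P \<in> carrier TF \<Longrightarrow> I +>\<^bsub>TF\<^esub> P \<in> carrier Q"
  unfolding base_change_simps by (simp add: A_RCOSETS_def' a_r_coset_def' del: TF_simps) blast

lemma in_carrier_iff: "x \<in> carrier Q \<longleftrightarrow> (\<exists>P\<in>carrier TF. x = I +>\<^bsub>TF\<^esub> P)"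
  unfolding base_change_simps by (simp add: A_RCOSETS_def' a_r_coset_def' del: TF_simps)

lemma coset_add:
  assumes "P \<in> carrier TF" "P' \<in> carrier TF"
  shows "(I +>\<^bsub>TF\<^esub> P) \<oplus>\<^bsub>Q\<^esub> (I +>\<^bsub>TF\<^esub> P') = I +>\<^bsub>TF\<^esub> (P + P')"
  using I.a_rcos_sum[OF assms] by (simp add: base_change_simps FactRing_def)

lemma coset_mult:
  assumes "P \<in> carrier TF" "P' \<in> carrier TF"
  shows "(I +>\<^bsub>TF\<^esub> P) \<otimes>\<^bsub>Q\<^esub> (I +>\<^bsub>TF\<^esub> P') = I +>\<^bsub>TF\<^esub> (tfm P P')"
  using I.rcoset_mult_add[OF assms] by (simp add: base_change_simps FactRing_def)

lemma single_in_TF: "a \<in> carrier A \<Longrightarrow> b \<in> carrier B \<Longrightarrow> single (a, b) n \<in> carrier TF"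
  by auto

lemma pure_closed [simp]: "a \<in> carrier A \<Longrightarrow> b \<in> carrier B \<Longrightarrow> pure a b \<in> carrier Q"
  unfolding pure_tensor_def by (intro coset_in single_in_TF)

lemma pure_mult:
  assumes "a \<in> carrier A" "b \<in> carrier B" "a' \<in> carrier A" "b' \<in> carrier B"
  shows "pure a b \<otimes>\<^bsub>Q\<^esub> pure a' b' = pure (a \<otimes>\<^bsub>A\<^esub> a') (b \<otimes>\<^bsub>B\<^esub> b')"
  using assms unfolding pure_tensor_def
  by (subst coset_mult) (simp_all add: tfm_single)

lemma rels_I: "x \<in> rels \<Longrightarrow> x \<in> I"
  using TF.genideal_self[OF rels_sub] by blast

lemma pure_add_left:
  assumes "a \<in> carrier A" "a' \<in> carrier A" "b \<in> carrier B"
  shows "pure (a \<oplus>\<^bsub>A\<^esub> a') b = pure a b \<oplus>\<^bsub>Q\<^esub> pure a' b"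
proof -
  have "single (a \<oplus>\<^bsub>A\<^esub> a', b) 1 - single (a, b) 1 - single (a', b) 1 \<in> rels"
    unfolding tensor_relations_def Let_def using assms by blast
  from rels_I[OF this] have r: "single (a \<oplus>\<^bsub>A\<^esub> a', b) 1 - (single (a, b) 1 + single (a', b) 1) \<in> I"
    by (simp add: algebra_simps)
  have c: "single (a, b) 1 + single (a', b) 1 \<in> carrier TF"
    using TF.a_closed[of "single (a, b) 1" "single (a', b) 1"] assms by simp
  have "pure a b \<oplus>\<^bsub>Q\<^esub> pure a' b = I +>\<^bsub>TF\<^esub> (single (a, b) 1 + single (a', b) 1)"
    unfolding pure_tensor_def using assms by (intro coset_add single_in_TF)
  moreover have "pure (a \<oplus>\<^bsub>A\<^esub> a') b = I +>\<^bsub>TF\<^esub> (single (a, b) 1 + single (a', b) 1)"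
    unfolding pure_tensor_def
    using coset_eq_iff[OF single_in_TF[OF A.M.a_closed[OF assms(1,2)] assms(3)] c] r by simp
  ultimately show ?thesis by simp
qed

lemma pure_add_right:
  assumes "a \<in> carrier A" "b \<in> carrier B" "b' \<in> carrier B"
  shows "pure a (b \<oplus>\<^bsub>B\<^esub> b') = pure a b \<oplus>\<^bsub>Q\<^esub> pure a b'"
proof -
  have "single (a, b \<oplus>\<^bsub>B\<^esub> b') 1 - single (a, b) 1 - single (a, b') 1 \<in> rels"
    unfolding tensor_relations_def Let_def using assms by blast
  from rels_I[OF this] have r: "single (a, b \<oplus>\<^bsub>B\<^esub> b') 1 - (single (a, b) 1 + single (a, b') 1) \<in> I"
    by (simp add: algebra_simps)
  have c: "single (a, b) 1 + single (a, b') 1 \<in> carrier TF"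
    using TF.a_closed[of "single (a, b) 1" "single (a, b') 1"] assms by simp
  have "pure a b \<oplus>\<^bsub>Q\<^esub> pure a b' = I +>\<^bsub>TF\<^esub> (single (a, b) 1 + single (a, b') 1)"
    unfolding pure_tensor_def using assms by (intro coset_add single_in_TF)
  moreover have "pure a (b \<oplus>\<^bsub>B\<^esub> b') = I +>\<^bsub>TF\<^esub> (single (a, b) 1 + single (a, b') 1)"
    unfolding pure_tensor_def
    using coset_eq_iff[OF single_in_TF[OF assms(1) B.M.a_closed[OF assms(2,3)]] c] r by simp
  ultimately show ?thesis by simp
qed

lemma pure_smult:
  assumes "s \<in> carrier k" "a \<in> carrier A" "b \<in> carrier B"
  shows "pure (s \<odot>\<^bsub>A\<^esub> a) b = pure a (s \<odot>\<^bsub>B\<^esub> b)"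
proof -
  have "single (s \<odot>\<^bsub>A\<^esub> a, b) 1 - single (a, s \<odot>\<^bsub>B\<^esub> b) 1 \<in> rels"
    unfolding tensor_relations_def Let_def using assms by blast
  from rels_I[OF this] show ?thesis
    unfolding pure_tensor_def using assms
    by (subst coset_eq_iff[OF single_in_TF single_in_TF]) auto
qed

lemma smult_pure:
  assumes "c \<in> carrier B" "a \<in> carrier A" "b \<in> carrier B"
  shows "c \<odot>\<^bsub>Q\<^esub> pure a b = pure a (c \<otimes>\<^bsub>B\<^esub> b)"
  using assms by (simp add: base_change_simps(4) pure_mult)

lemma base_change_algebra: "Module.algebra B Q"
proof (rule algebraI[OF B.M_cring base_change_cring])
  show "\<one>\<^bsub>B\<^esub> \<odot>\<^bsub>Q\<^esub> x = x" if "x \<in> carrier Q" for x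
    using Q.l_one[OF that] by (simp add: base_change_simps(2,4))
next
  fix a b x y assume a: "a \<in> carrier B" and x: "x \<in> carrier Q"
  then show "a \<odot>\<^bsub>Q\<^esub> x \<in> carrier Q" by (simp add: base_change_simps(4))
  show "(a \<oplus>\<^bsub>B\<^esub> b) \<odot>\<^bsub>Q\<^esub> x = a \<odot>\<^bsub>Q\<^esub> x \<oplus>\<^bsub>Q\<^esub> b \<odot>\<^bsub>Q\<^esub> x" if "b \<in> carrier B"
    using a x that by (simp add: base_change_simps(4) pure_add_right Q.l_distr)
  show "(a \<otimes>\<^bsub>B\<^esub> b) \<odot>\<^bsub>Q\<^esub> x = a \<odot>\<^bsub>Q\<^esub> (b \<odot>\<^bsub>Q\<^esub> x)" if "b \<in> carrier B"
    using a x that pure_mult[of "\<one>\<^bsub>A\<^esub>" a "\<one>\<^bsub>A\<^esub>" b] by (simp add: base_change_simps(4) flip: Q.m_assoc)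
  show "a \<odot>\<^bsub>Q\<^esub> (x \<oplus>\<^bsub>Q\<^esub> y) = a \<odot>\<^bsub>Q\<^esub> x \<oplus>\<^bsub>Q\<^esub> a \<odot>\<^bsub>Q\<^esub> y" if "y \<in> carrier Q"
    using a x that by (simp add: base_change_simps(4) Q.r_distr)
  show "a \<odot>\<^bsub>Q\<^esub> x \<otimes>\<^bsub>Q\<^esub> y = a \<odot>\<^bsub>Q\<^esub> (x \<otimes>\<^bsub>Q\<^esub> y)" if "y \<in> carrier Q"
    using a x that by (simp add: base_change_simps(4) Q.m_assoc)
qed

text \<open>Elements come from integer combinations of pairs. Signs are absorbed by the identity -(a
  \<otimes> b) = (-a) \<otimes> b, so sums of pure tensors suffice.\<close>

lemma base_change_induct [consumes 1, case_names pure add]: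
  assumes "x \<in> carrier Q" and pure: "\<And>a b. a \<in> carrier A \<Longrightarrow> b \<in> carrier B \<Longrightarrow> R (pure a b)"
    and add: "\<And>x y. x \<in> carrier Q \<Longrightarrow> y \<in> carrier Q \<Longrightarrow> R x \<Longrightarrow> R y \<Longrightarrow> R (x \<oplus>\<^bsub>Q\<^esub> y)"
  shows "R x"
proof -
  obtain P where P: "P \<in> carrier TF" "x = I +>\<^bsub>TF\<^esub> P" using assms(1) in_carrier_iff by blast
  \<comment> \<open>The rule has no case for zero, so zero has to be exhibited as a pure
    tensor.\<close>
  have p0: "pure \<zero>\<^bsub>A\<^esub> b = I +>\<^bsub>TF\<^esub> 0" if "b \<in> carrier B" for b
  proof -
    have "pure \<zero>\<^bsub>A\<^esub> b \<oplus>\<^bsub>Q\<^esub> pure \<zero>\<^bsub>A\<^esub> b = pure \<zero>\<^bsub>A\<^esub> b"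
      using pure_add_left[of "\<zero>\<^bsub>A\<^esub>" "\<zero>\<^bsub>A\<^esub>" b] that by simp
    then have "pure \<zero>\<^bsub>A\<^esub> b = \<zero>\<^bsub>Q\<^esub>" using that by (simp add: Q.add.l_cancel_one)
    then show ?thesis using TF.a_coset_add_zero[OF I.a_subset] by (simp add: base_change_simps(3))
  qed
  have "keys P \<subseteq> carrier A \<times> carrier B" using P by simp
  \<comment> \<open>\<open>frag_induction\<close> builds \<open>P\<close> from differences, so the
    claim is proved for \<open>P\<close> and \<open>- P\<close> together.\<close>
  then have "P \<in> carrier TF \<and> R (I +>\<^bsub>TF\<^esub> P) \<and> R (I +>\<^bsub>TF\<^esub> (- P))"
  proof (induction P rule: frag_induction)
    case zero
    have "R (pure \<zero>\<^bsub>A\<^esub> \<zero>\<^bsub>B\<^esub>)" by (rule pure) simp_all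
    then show ?case by (simp add: p0)
  next
    case (one z)
    obtain a b where z: "z = (a, b)" "a \<in> carrier A" "b \<in> carrier B" using one by (cases z) auto
    have "R (pure (\<ominus>\<^bsub>A\<^esub> a) b)" using z by (intro pure) simp_all
    moreover have "pure (\<ominus>\<^bsub>A\<^esub> a) b = I +>\<^bsub>TF\<^esub> (- single (a, b) 1)"
    proof -
      have "pure (\<ominus>\<^bsub>A\<^esub> a) b \<oplus>\<^bsub>Q\<^esub> pure a b = \<zero>\<^bsub>Q\<^esub>"
        using z pure_add_left[of "\<ominus>\<^bsub>A\<^esub> a" a b] TF.a_coset_add_zero[OF I.a_subset]
        by (simp add: A.M.l_neg p0 base_change_simps(3))
      moreover have "(I +>\<^bsub>TF\<^esub> (- single (a, b) 1)) \<oplus>\<^bsub>Q\<^esub> pure a b = \<zero>\<^bsub>Q\<^esub>"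
        unfolding pure_tensor_def using z TF.a_coset_add_zero[OF I.a_subset]
        by (subst coset_add) (auto simp: base_change_simps(3))
      ultimately have "pure (\<ominus>\<^bsub>A\<^esub> a) b \<oplus>\<^bsub>Q\<^esub> pure a b = (I +>\<^bsub>TF\<^esub> (- single (a, b) 1)) \<oplus>\<^bsub>Q\<^esub> pure a b"
        by simp
      then show ?thesis
        by (rule Q.add.r_cancel) (use z coset_in[of "- single (a, b) 1"] in simp_all)
    qed
    ultimately show ?case using pure[OF z(2,3)] z unfolding pure_tensor_def by simp
  next
    case (diff a b)
    have n: "- a \<in> carrier TF" "- b \<in> carrier TF" using diff by simp_all
    have "R (I +>\<^bsub>TF\<^esub> (a + - b))"
      using diff n add[OF coset_in[of a] coset_in[of "- b"]] coset_add[of a "- b"] by simp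
    moreover have "R (I +>\<^bsub>TF\<^esub> (- a + b))"
      using diff n add[OF coset_in[of "- a"] coset_in[of b]] coset_add[of "- a" b] by simp
    moreover have "a - b \<in> carrier TF" using TF.a_closed[of a "- b"] diff n by simp
    ultimately show ?case by simp
  qed
  then show ?thesis using P by simp
qed

text \<open>The universal property, for targets whose addition is that of the type but whose product
  need not be: \<open>C\<close> will be the degenerate algebra, hence the biadditivity assumptions
  \<open>Cm\<close>. The linear extension to the free group descends because its kernel is an ideal
  containing the relations.\<close>

lemma tensor_lift:
  fixes C :: "('c2::comm_ring_1, 'm) ring_scheme" and g :: "'b \<Rightarrow> 'c \<Rightarrow> 'c2"
  assumes C: "cring C" and Cadd: "add C = (+)" "\<zero>\<^bsub>C\<^esub> = 0"
    and Cm: "\<And>x y z. (x - y) \<otimes>\<^bsub>C\<^esub> z = x \<otimes>\<^bsub>C\<^esub> z - y \<otimes>\<^bsub>C\<^esub> z" "\<And>x y z. z \<otimes>\<^bsub>C\<^esub> (x - y) = z \<otimes>\<^bsub>C\<^esub> x - z \<otimes>\<^bsub>C\<^esub> y"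
    and g: "\<And>a b. a \<in> carrier A \<Longrightarrow> b \<in> carrier B \<Longrightarrow> g a b \<in> carrier C"
    and g_add1: "\<And>a a' b. a \<in> carrier A \<Longrightarrow> a' \<in> carrier A \<Longrightarrow> b \<in> carrier B \<Longrightarrow> g (a \<oplus>\<^bsub>A\<^esub> a') b = g a b + g a' b"
    and g_add2: "\<And>a b b'. a \<in> carrier A \<Longrightarrow> b \<in> carrier B \<Longrightarrow> b' \<in> carrier B \<Longrightarrow> g a (b \<oplus>\<^bsub>B\<^esub> b') = g a b + g a b'"
    and g_smult: "\<And>s a b. s \<in> carrier k \<Longrightarrow> a \<in> carrier A \<Longrightarrow> b \<in> carrier B \<Longrightarrow> g (s \<odot>\<^bsub>A\<^esub> a) b = g a (s \<odot>\<^bsub>B\<^esub> b)"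
    and g_mult: "\<And>a a' b b'. a \<in> carrier A \<Longrightarrow> a' \<in> carrier A \<Longrightarrow> b \<in> carrier B \<Longrightarrow> b' \<in> carrier B \<Longrightarrow>
      g (a \<otimes>\<^bsub>A\<^esub> a') (b \<otimes>\<^bsub>B\<^esub> b') = g a b \<otimes>\<^bsub>C\<^esub> g a' b'"
    and g_one: "g \<one>\<^bsub>A\<^esub> \<one>\<^bsub>B\<^esub> = \<one>\<^bsub>C\<^esub>"
  shows "\<exists>\<gamma>. \<gamma> \<in> ring_hom Q C \<and> (\<forall>a\<in>carrier A. \<forall>b\<in>carrier B. \<gamma> (pure a b) = g a b)"
proof -
  interpret C: cring C by fact
  define \<gamma>0 where "\<gamma>0 P = (\<Sum>x\<in>keys P. of_int (lookup P x) * g (fst x) (snd x))" for P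
  have \<gamma>0_diff: "\<gamma>0 (P - P') = \<gamma>0 P - \<gamma>0 P'" for P P'
    unfolding \<gamma>0_def
    by (rule additive_sum_keys_diff[of "\<lambda>x n. of_int n * g (fst x) (snd x)"]) (simp_all add: distrib_right)
  have \<gamma>0_zero: "\<gamma>0 0 = 0" by (simp add: \<gamma>0_def)
  have \<gamma>0_add: "\<gamma>0 (P + P') = \<gamma>0 P + \<gamma>0 P'" for P P'
    using \<gamma>0_diff[of P "- P'"] \<gamma>0_diff[of 0 P'] \<gamma>0_zero by simp
  have \<gamma>0_single: "\<gamma>0 (single (a, b) 1) = g a b" for a b by (simp add: \<gamma>0_def)
  have Cminus: "x - y \<in> carrier C" if "x \<in> carrier C" "y \<in> carrier C" for x y
  proof -
    have "y + \<ominus>\<^bsub>C\<^esub> y = 0" using C.r_neg[OF that(2)] Cadd by simp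
    then have "\<ominus>\<^bsub>C\<^esub> y = - y" by (metis add_eq_0_iff)
    then show ?thesis using C.a_closed[OF that(1) C.a_inv_closed[OF that(2)]] Cadd by simp
  qed
  have Cm0: "0 \<otimes>\<^bsub>C\<^esub> z = 0" "z \<otimes>\<^bsub>C\<^esub> 0 = 0" for z using Cm(1)[of 0 0 z] Cm(2)[of z 0 0] by simp_all
  have hom: "\<gamma>0 \<in> ring_hom TF C"
  proof (rule ring_hom_memI)
    show "\<gamma>0 P \<in> carrier C" if "P \<in> carrier TF" for P
      using that[unfolded TF_simps]
    proof (induction P rule: frag_induction)
      case (one x) then show ?case using g by (cases x) (auto simp: \<gamma>0_single)
    qed (use C.zero_closed Cminus in \<open>simp_all add: \<gamma>0_zero \<gamma>0_diff Cadd\<close>)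
    show "\<gamma>0 (P \<otimes>\<^bsub>TF\<^esub> P') = \<gamma>0 P \<otimes>\<^bsub>C\<^esub> \<gamma>0 P'" if "P \<in> carrier TF" "P' \<in> carrier TF" for P P'
      using that(1)[unfolded TF_simps]
    proof (induction P rule: frag_induction)
      case (one x)
      show ?case using that(2)[unfolded TF_simps]
      proof (induction P' rule: frag_induction)
        case (one y)
        then show ?case using \<open>x \<in> _\<close>
          by (cases x; cases y) (simp add: tfm_single \<gamma>0_single g_mult)
      qed (simp_all add: tfm_diff_right \<gamma>0_diff Cm \<gamma>0_zero Cm0)
    qed (simp_all add: tfm_diff_left \<gamma>0_diff Cm \<gamma>0_zero Cm0)
    show "\<gamma>0 \<one>\<^bsub>TF\<^esub> = \<one>\<^bsub>C\<^esub>" by (simp add: \<gamma>0_single g_one)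
  qed (simp add: \<gamma>0_add Cadd)
  interpret h: ring_hom_ring TF C \<gamma>0
    by (rule ring_hom_ringI2[OF TF.ring_axioms C.ring_axioms hom])
  have "rels \<subseteq> a_kernel TF C \<gamma>0"
  proof
    fix x assume "x \<in> rels"
    moreover from this have "x \<in> carrier TF" using rels_sub by blast
    ultimately show "x \<in> a_kernel TF C \<gamma>0"
      unfolding a_kernel_def' tensor_relations_def Let_def
      by (auto simp: \<gamma>0_diff \<gamma>0_single g_add1 g_add2 g_smult Cadd)
  qed
  then have "I \<subseteq> a_kernel TF C \<gamma>0"
    by (rule TF.genideal_minimal[OF h.kernel_is_ideal])
  then have I0: "\<gamma>0 x = 0" if "x \<in> I" for x using that Cadd unfolding a_kernel_def' by auto
  \<comment> \<open>Constancy on cosets makes the image of each coset a singleton, from which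
    \<open>the_elem\<close> extracts the value.\<close>
  define \<gamma> where "\<gamma> x = the_elem (\<gamma>0 ` x)" for x
  have \<gamma>: "\<gamma> (I +>\<^bsub>TF\<^esub> P) = \<gamma>0 P" if "P \<in> carrier TF" for P
  proof -
    have "\<gamma>0 ` (I +>\<^bsub>TF\<^esub> P) = {\<gamma>0 P}"
    proof
      show "\<gamma>0 ` (I +>\<^bsub>TF\<^esub> P) \<subseteq> {\<gamma>0 P}"
        by (auto simp: a_r_coset_def' \<gamma>0_add I0)
      show "{\<gamma>0 P} \<subseteq> \<gamma>0 ` (I +>\<^bsub>TF\<^esub> P)" using I.a_rcos_self[OF that] by auto
    qed
    then show ?thesis by (simp add: \<gamma>_def)
  qed
  have "\<gamma> \<in> ring_hom Q C"
  proof (rule ring_hom_memI)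
    fix x assume "x \<in> carrier Q"
    then obtain P where P: "P \<in> carrier TF" "x = I +>\<^bsub>TF\<^esub> P" using in_carrier_iff by blast
    then show "\<gamma> x \<in> carrier C" using \<gamma> h.hom_closed by metis
    fix y assume "y \<in> carrier Q"
    then obtain P' where P': "P' \<in> carrier TF" "y = I +>\<^bsub>TF\<^esub> P'" using in_carrier_iff by blast
    have c: "P + P' \<in> carrier TF" "tfm P P' \<in> carrier TF"
      using TF.a_closed[OF P(1) P'(1)] TF.m_closed[OF P(1) P'(1)] by simp_all
    show "\<gamma> (x \<otimes>\<^bsub>Q\<^esub> y) = \<gamma> x \<otimes>\<^bsub>C\<^esub> \<gamma> y"
      unfolding P(2) P'(2) coset_mult[OF P(1) P'(1)] \<gamma>[OF c(2)] \<gamma>[OF P(1)] \<gamma>[OF P'(1)]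
      using h.hom_mult[OF P(1) P'(1)] by simp
    show "\<gamma> (x \<oplus>\<^bsub>Q\<^esub> y) = \<gamma> x \<oplus>\<^bsub>C\<^esub> \<gamma> y"
      unfolding P(2) P'(2) coset_add[OF P(1) P'(1)] \<gamma>[OF c(1)] \<gamma>[OF P(1)] \<gamma>[OF P'(1)]
      by (simp add: \<gamma>0_add Cadd)
  next
    show "\<gamma> \<one>\<^bsub>Q\<^esub> = \<one>\<^bsub>C\<^esub>"
      using \<gamma>[OF single_in_TF[of "\<one>\<^bsub>A\<^esub>" "\<one>\<^bsub>B\<^esub>" 1]] by (simp add: base_change_simps(2) pure_tensor_def \<gamma>0_single g_one)
  qed
  moreover have "\<gamma> (pure a b) = g a b" if "a \<in> carrier A" "b \<in> carrier B" for a b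
    unfolding pure_tensor_def using \<gamma>[OF single_in_TF[OF that]] by (simp add: \<gamma>0_single)
  ultimately show ?thesis by blast
qed

end

section \<open>Base change of a degenerate algebra\<close>

context degenerate_monoid_algebra
begin

lemma tmul_diff: "tmul (P - P') Q = tmul P Q - tmul P' Q" "tmul Q (P - P') = tmul Q P - tmul Q P'"
  for P P' Q :: "'e \<Rightarrow>\<^sub>0 'k::comm_ring_1"
  using tmul_add_left[of "P - P'" P' Q] tmul_add_right[of Q "P - P'" P'] by simp_all

text \<open>Only a homomorphism \<open>h\<close> is required: besides the special fibre, the lemma
  serves the deformation ring itself, whose map \<open>coord\<close> to the model has a kernel. The
  letter \<open>\<iota>\<close> stands for the embedding of the base field into the extended
  coefficients.\<close>

lemma base_change_to_degenerate:
  fixes k :: "('q::comm_ring_1, 'r) ring_scheme" and A :: "('q, 'b, 's) module_scheme"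
    and K :: "('q, 'a::comm_ring_1, 't) module_scheme" and \<iota> :: "'q \<Rightarrow> 'a"
  assumes k: "native_cring k" and K: "native_cring K" and kA: "Module.algebra k A" and kK: "Module.algebra k K"
    and \<iota>_add: "\<And>x y. \<iota> (x + y) = \<iota> x + \<iota> y" and \<iota>_mult: "\<And>x y. \<iota> (x * y) = \<iota> x * \<iota> y"
    and \<iota>_one: "\<iota> 1 = 1" and \<iota>_in: "\<And>x. x \<in> carrier k \<Longrightarrow> \<iota> x \<in> carrier K"
    and sm: "\<And>s c. s \<in> carrier k \<Longrightarrow> c \<in> carrier K \<Longrightarrow> s \<odot>\<^bsub>K\<^esub> c = \<iota> s * c"
    and h: "h \<in> ring_hom A (degenerate_algebra k)" and hlin: "linear_over k A (degenerate_algebra k) h"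
  obtains \<gamma> where "\<gamma> \<in> ring_hom (base_change k A K) (degenerate_algebra K)"
    "linear_over K (base_change k A K) (degenerate_algebra K) \<gamma>"
    "\<And>a b. a \<in> carrier A \<Longrightarrow> b \<in> carrier K \<Longrightarrow>
       \<gamma> (pure_tensor k A K a b) = single 0 b * Poly_Mapping.mapp (\<lambda>_. \<iota>) (h a)"
proof -
  interpret tensor_algebras k A K by (intro tensor_algebras.intro kA kK)
  interpret D: Module.algebra K "degenerate_algebra K" by (rule degenerate_algebra_algebra[OF K])
  have \<iota>0: "\<iota> 0 = 0" using \<iota>_add[of 0 0] by simp
  define cm where "cm = (Poly_Mapping.mapp (\<lambda>_. \<iota>) :: ('e \<Rightarrow>\<^sub>0 'q) \<Rightarrow> ('e \<Rightarrow>\<^sub>0 'a))"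
  have cm_add: "cm (P + P') = cm P + cm P'" for P P'
    unfolding cm_def by (rule mapp_add) (simp_all add: \<iota>0 \<iota>_add)
  have cm_zero: "cm 0 = 0" using cm_add[of 0 0] by simp
  have cm_single: "cm (single u a) = single u (\<iota> a)" for u a
    unfolding cm_def by (rule mapp_single) (simp add: \<iota>0)
  have cm_in: "cm P \<in> carrier (degenerate_algebra K)" if "P \<in> carrier (degenerate_algebra k)" for P
    using that \<iota>_in keys_mapp_subset[of "\<lambda>_. \<iota>" P]
    by (auto simp: cm_def lookup_mapp_zero[of "\<lambda>_. \<iota>"] \<iota>0)
  have cm_tmul: "cm (tmul P Q) = tmul (cm P) (cm Q)"
    if P: "P \<in> carrier (degenerate_algebra k)" and Q: "Q \<in> carrier (degenerate_algebra k)" for P Q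
    using P[unfolded degenerate_algebra_simps] k refl
  proof (induction P rule: monoid_algebra_induct)
    case (single u a)
    show ?case using Q[unfolded degenerate_algebra_simps] k refl
    proof (induction Q rule: monoid_algebra_induct)
      case (single v b)
      then show ?case by (simp add: tmul_single cm_single tterm_def \<iota>_mult cm_zero)
    qed (simp_all add: cm_zero cm_add tmul_add_right)
  qed (simp_all add: cm_zero cm_add tmul_add_left)
  have sg: "single 0 b \<in> carrier (degenerate_algebra K)" if "b \<in> carrier K" for b
    using single_in_monoid_algebra[OF zero_mem that native_cring_closed(1)[OF K]] by simp
  \<comment> \<open>With a first factor in exponent 0, \<open>tmul\<close> is scalar multiplication;
    written this way, the ring laws of the target apply to it.\<close>
  define g where "g a b = tmul (single 0 b) (cm (h a))" for a b
  note hl = linear_overD[OF hlin] and hr = ring_hom_memE[OF h]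
  have "\<exists>\<gamma>. \<gamma> \<in> ring_hom Q (degenerate_algebra K) \<and> (\<forall>a\<in>carrier A. \<forall>b\<in>carrier K. \<gamma> (pure a b) = g a b)"
  proof (rule tensor_lift)
    show "cring (degenerate_algebra K)" by (rule D.M_cring)
    show "g a b \<in> carrier (degenerate_algebra K)" if "a \<in> carrier A" "b \<in> carrier K" for a b
      using D.m_closed[OF sg[OF that(2)] cm_in[OF hl(1)[OF that(1)]]] by (simp add: g_def)
    show "g (s \<odot>\<^bsub>A\<^esub> a) b = g a (s \<odot>\<^bsub>K\<^esub> b)" if "s \<in> carrier k" "a \<in> carrier A" "b \<in> carrier K" for s a b
    proof -
      have c: "single 0 s \<in> carrier (degenerate_algebra k)"
        using single_in_monoid_algebra[OF zero_mem that(1) native_cring_closed(1)[OF k]] by simp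
      have "cm (h (s \<odot>\<^bsub>A\<^esub> a)) = tmul (single 0 (\<iota> s)) (cm (h a))"
        using that by (simp add: hl(3) single_mult_eq_tmul cm_tmul[OF c hl(1)] cm_single)
      then have "g (s \<odot>\<^bsub>A\<^esub> a) b = tmul (tmul (single 0 b) (single 0 (\<iota> s))) (cm (h a))"
        using that tmul_assoc[OF K, of "single 0 b" "single 0 (\<iota> s)" "cm (h a)"] sg \<iota>_in cm_in[OF hl(1)[OF that(2)]]
        unfolding g_def degenerate_algebra_simps by presburger
      also have "tmul (single 0 b) (single 0 (\<iota> s)) = single 0 (s \<odot>\<^bsub>K\<^esub> b)"
        using that by (simp add: tmul_single tterm_def m_zero sm mult.commute)
      finally show ?thesis by (simp add: g_def)
    qed
    show "g (a \<otimes>\<^bsub>A\<^esub> a') (b \<otimes>\<^bsub>K\<^esub> b') = g a b \<otimes>\<^bsub>degenerate_algebra K\<^esub> g a' b'"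
      if "a \<in> carrier A" "a' \<in> carrier A" "b \<in> carrier K" "b' \<in> carrier K" for a a' b b'
    proof -
      have "g (a \<otimes>\<^bsub>A\<^esub> a') (b \<otimes>\<^bsub>K\<^esub> b') = tmul (tmul (single 0 b) (single 0 b')) (tmul (cm (h a)) (cm (h a')))"
        using that hr(2)[of a a'] cm_tmul[OF hl(1) hl(1), of a a']
        by (simp add: g_def tmul_single tterm_def m_zero native_cringD[OF K])
      also have "\<dots> = tmul (g a b) (g a' b')"
        using D.m_ac[OF sg[OF that(3)] sg[OF that(4)]]
          D.m_assoc[OF sg[OF that(3)] sg[OF that(4)] D.m_closed[OF cm_in[OF hl(1)[OF that(1)]] cm_in[OF hl(1)[OF that(2)]]]]
          D.m_lcomm[OF sg[OF that(4)] cm_in[OF hl(1)[OF that(1)]] cm_in[OF hl(1)[OF that(2)]]]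
          D.m_assoc[OF sg[OF that(3)] cm_in[OF hl(1)[OF that(1)]] D.m_closed[OF sg[OF that(4)] cm_in[OF hl(1)[OF that(2)]]]]
        by (simp add: g_def)
      finally show ?thesis by simp
    qed
    show "g \<one>\<^bsub>A\<^esub> \<one>\<^bsub>K\<^esub> = \<one>\<^bsub>degenerate_algebra K\<^esub>"
      using hr(4) cm_single[of 0 1] single_mult_eq_tmul[of 1 "1 :: 'e \<Rightarrow>\<^sub>0 'a"]
      by (simp add: g_def native_cringD[OF K] \<iota>_one)
  qed (simp_all add: tmul_diff g_def hl(2) cm_add tmul_add_right single_add tmul_add_left native_cringD[OF K])
  then obtain \<gamma> where \<gamma>: "\<gamma> \<in> ring_hom Q (degenerate_algebra K)"
    "\<And>a b. a \<in> carrier A \<Longrightarrow> b \<in> carrier K \<Longrightarrow> \<gamma> (pure a b) = g a b" by blast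
  have "linear_over K Q (degenerate_algebra K) \<gamma>"
    unfolding linear_over_def
  proof (intro conjI ballI Pi_I)
    \<comment> \<open>The scalar c acts as the product with the pure tensor of one and c, so
      linearity follows from multiplicativity.\<close>
    show "\<gamma> (c \<odot>\<^bsub>Q\<^esub> x) = c \<odot>\<^bsub>degenerate_algebra K\<^esub> \<gamma> x" if "c \<in> carrier K" "x \<in> carrier Q" for c x
    proof -
      have "\<gamma> (c \<odot>\<^bsub>Q\<^esub> x) = tmul (g \<one>\<^bsub>A\<^esub> c) (\<gamma> x)"
        using ring_hom_memE(2)[OF \<gamma>(1), of "pure \<one>\<^bsub>A\<^esub> c" x] that by (simp add: base_change_simps(4) \<gamma>(2))
      also have "g \<one>\<^bsub>A\<^esub> c = single 0 c"
        using hr(4) cm_single[of 0 1] single_mult_eq_tmul[of c "1 :: 'e \<Rightarrow>\<^sub>0 'a"] by (simp add: g_def \<iota>_one)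
      finally show ?thesis by (simp add: single_mult_eq_tmul)
    qed
  qed (use ring_hom_memE[OF \<gamma>(1)] in auto)
  then show thesis
    by (rule that[OF \<gamma>(1)]) (simp add: \<gamma>(2) g_def single_mult_eq_tmul cm_def)
qed

text \<open>The map is injective because the elements \<open>h\<inverse>(x\<^sup>v) \<otimes> 1\<close> span \<open>A \<otimes> K\<close> and go to distinct monomials,
  which are linearly independent.\<close>

lemma base_change_degenerate_iso:
  fixes k :: "('q::comm_ring_1, 'r) ring_scheme" and A :: "('q, 'b, 's) module_scheme"
    and K :: "('q, 'a::comm_ring_1, 't) module_scheme" and \<iota> :: "'q \<Rightarrow> 'a"
  assumes k: "native_cring k" and K: "native_cring K" and kA: "Module.algebra k A" and kK: "Module.algebra k K"
    and \<iota>_add: "\<And>x y. \<iota> (x + y) = \<iota> x + \<iota> y" and \<iota>_mult: "\<And>x y. \<iota> (x * y) = \<iota> x * \<iota> y"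
    and \<iota>_one: "\<iota> 1 = 1" and \<iota>_in: "\<And>x. x \<in> carrier k \<Longrightarrow> \<iota> x \<in> carrier K"
    and sm: "\<And>s c. s \<in> carrier k \<Longrightarrow> c \<in> carrier K \<Longrightarrow> s \<odot>\<^bsub>K\<^esub> c = \<iota> s * c"
    and h: "h \<in> ring_iso A (degenerate_algebra k)" and hlin: "linear_over k A (degenerate_algebra k) h"
    and G: "\<And>i. G i \<subseteq> carrier A" "\<And>i. h ` G i = homogeneous_part k i"
  obtains \<gamma> where "\<gamma> \<in> ring_iso (base_change k A K) (degenerate_algebra K)"
    "linear_over K (base_change k A K) (degenerate_algebra K) \<gamma>"
    "\<And>a b. a \<in> carrier A \<Longrightarrow> b \<in> carrier K \<Longrightarrow>
       \<gamma> (pure_tensor k A K a b) = single 0 b * Poly_Mapping.mapp (\<lambda>_. \<iota>) (h a)"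
    "\<And>i. base_change_grading k A K G i \<subseteq> carrier (base_change k A K)"
    "\<And>i. \<gamma> ` base_change_grading k A K G i = homogeneous_part K i"
proof -
  interpret tensor_algebras k A K by (intro tensor_algebras.intro kA kK)
  interpret D: Module.algebra K "degenerate_algebra K" by (rule degenerate_algebra_algebra[OF K])
  interpret QK: Module.algebra K Q by (rule base_change_algebra)
  have hh: "h \<in> ring_hom A (degenerate_algebra k)" and bij: "bij_betw h (carrier A) (carrier (degenerate_algebra k))"
    using h unfolding ring_iso_def by auto
  note hl = linear_overD[OF hlin] and clK = native_cring_closed[OF K] and clk = native_cring_closed[OF k]
  obtain \<gamma> where \<gamma>: "\<gamma> \<in> ring_hom Q (degenerate_algebra K)" "linear_over K Q (degenerate_algebra K) \<gamma>"
    "\<And>a b. a \<in> carrier A \<Longrightarrow> b \<in> carrier K \<Longrightarrow> \<gamma> (pure a b) = single 0 b * Poly_Mapping.mapp (\<lambda>_. \<iota>) (h a)"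
    by (rule base_change_to_degenerate[OF k K kA kK \<iota>_add \<iota>_mult \<iota>_one \<iota>_in sm hh hlin]) auto
  have \<iota>0: "\<iota> 0 = 0" using \<iota>_add[of 0 0] by simp
  define e where "e v = inv_into (carrier A) h (single v 1)" for v
  have sv: "single v 1 \<in> carrier (degenerate_algebra k)" if "v \<in> M" for v
    using single_in_monoid_algebra[OF that clk(2,1)] by simp
  have e: "e v \<in> carrier A" "h (e v) = single v 1" if "v \<in> M" for v
    using bij sv[OF that] unfolding e_def bij_betw_def by (metis inv_into_into, metis f_inv_into_f)
  have one_K: "1 \<in> carrier K" by (rule clK)
  have \<gamma>e: "\<gamma> (pure (e v) b) = single v b" if "v \<in> M" "b \<in> carrier K" for v b
    using that by (simp add: \<gamma>(3) e mapp_single[of "\<lambda>_. \<iota>"] \<iota>0 \<iota>_one mult_single)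
  define E where "E = (\<lambda>v. pure (e v) 1) ` M"
  have EQ: "E \<subseteq> carrier Q" using e one_K by (auto simp: E_def)
  note sE = QK.lin_span_submodule[OF EQ]
  have span: "x \<in> lin_span K Q E" if "x \<in> carrier Q" for x
    using that
  proof (induction x rule: base_change_induct)
    case (pure a b)
    \<comment> \<open>The induction runs over the coordinates \<open>P = h a\<close> rather than
      over \<open>a\<close>, because it is the model that has monomials.\<close>
    have "pure (inv_into (carrier A) h P) b \<in> lin_span K Q E" if "P \<in> carrier (monoid_algebra (carrier k) M)" for P
      using that k refl
    proof (induction P rule: monoid_algebra_induct)
      case zero
      have "h \<zero>\<^bsub>A\<^esub> = 0" using linear_over_zero[OF A.module degenerate_algebra_algebra[OF k, THEN algebra.module] hlin] by simp
      then have "inv_into (carrier A) h 0 = \<zero>\<^bsub>A\<^esub>" using inv_into_f_f[of h "carrier A" "\<zero>\<^bsub>A\<^esub>"] bij unfolding bij_betw_def by auto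
      moreover have "pure \<zero>\<^bsub>A\<^esub> b = \<zero>\<^bsub>Q\<^esub>"
        using pure_smult[of "\<zero>\<^bsub>k\<^esub>" "\<zero>\<^bsub>A\<^esub>" b] smult_pure[of "\<zero>\<^bsub>K\<^esub>" "\<zero>\<^bsub>A\<^esub>" b] pure by simp
      ultimately show ?case using QK.submodule_zero[OF sE] by simp
    next
      case (single v c)
      have "h (c \<odot>\<^bsub>A\<^esub> e v) = single v c" using hl(3)[OF single(2) e(1)[OF single(1)]] e[OF single(1)] by (simp add: mult_single)
      then have "inv_into (carrier A) h (single v c) = c \<odot>\<^bsub>A\<^esub> e v"
        using inv_into_f_f[of h "carrier A" "c \<odot>\<^bsub>A\<^esub> e v"] bij e single unfolding bij_betw_def by auto
      moreover have "pure (c \<odot>\<^bsub>A\<^esub> e v) b = (\<iota> c * b) \<odot>\<^bsub>Q\<^esub> pure (e v) 1"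
        using single pure e \<iota>_in one_K clK by (simp add: pure_smult smult_pure sm native_cringD[OF K])
      moreover have "pure (e v) 1 \<in> lin_span K Q E" using QK.lin_span_incl[OF EQ] single by (auto simp: E_def)
      ultimately show ?case using QK.submoduleE(4)[OF sE] single pure \<iota>_in clK by simp
    next
      case (add P P')
      have i: "inv_into (carrier A) h P \<in> carrier A" "h (inv_into (carrier A) h P) = P" if "P \<in> carrier (monoid_algebra (carrier k) M)" for P
        using that bij unfolding bij_betw_def by (metis inv_into_into degenerate_algebra_simps(1), metis f_inv_into_f degenerate_algebra_simps(1))
      have "h (inv_into (carrier A) h P \<oplus>\<^bsub>A\<^esub> inv_into (carrier A) h P') = P + P'"
        using i[OF add(1)] i[OF add(2)] hl(2) by simp
      then have "inv_into (carrier A) h (P + P') = inv_into (carrier A) h P \<oplus>\<^bsub>A\<^esub> inv_into (carrier A) h P'"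
        using inv_into_f_f[of h "carrier A" "inv_into (carrier A) h P \<oplus>\<^bsub>A\<^esub> inv_into (carrier A) h P'"] bij
          i[OF add(1)] i[OF add(2)] unfolding bij_betw_def by auto
      then show ?case using QK.submoduleE(5)[OF sE add.IH(1,2)] i[OF add(1)] i[OF add(2)] pure by (simp add: pure_add_left)
    qed
    from this[of "h a"] show ?case
      using pure hl(1)[of a] bij unfolding bij_betw_def by simp
  next
    case (add x y)
    then show ?case using QK.submoduleE(5)[OF sE] by simp
  qed
  have \<gamma>0: "\<gamma> \<zero>\<^bsub>Q\<^esub> = 0" using linear_over_zero[OF QK.module D.module \<gamma>(2)] by simp
  have ker: "x = \<zero>\<^bsub>Q\<^esub>" if x: "x \<in> carrier Q" "\<gamma> x = 0" for x
  proof -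
    from span[OF x(1)] obtain F c where F: "finite F" "F \<subseteq> E" "c \<in> F \<rightarrow> carrier K" "x = (\<Oplus>\<^bsub>Q\<^esub>y\<in>F. c y \<odot>\<^bsub>Q\<^esub> y)"
      unfolding lin_span_def by auto
    have "\<forall>y\<in>F. \<exists>v\<in>M. y = pure (e v) 1" using F(2) by (auto simp: E_def)
    \<comment> \<open>Each y in \<open>F\<close> is recovered from its exponent \<open>d y\<close>.
      Hence \<open>d\<close> is injective on \<open>F\<close>, and the monomials in the image sum
      are distinct.\<close>
    then obtain d where d: "\<And>y. y \<in> F \<Longrightarrow> d y \<in> M" "\<And>y. y \<in> F \<Longrightarrow> y = pure (e (d y)) 1" by metis
    have tm: "\<gamma> (c y \<odot>\<^bsub>Q\<^esub> y) = single (d y) (c y)" if "y \<in> F" for y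
    proof -
      have "\<gamma> y = single (d y) 1" using \<gamma>e[OF d(1)[OF that] one_K] d(2)[OF that] by simp
      then show ?thesis using linear_overD(3)[OF \<gamma>(2), of "c y" y] F that EQ by (auto simp: mult_single)
    qed
    have cl: "(\<lambda>y. c y \<odot>\<^bsub>Q\<^esub> y) \<in> F \<rightarrow> carrier Q" using F EQ by auto
    have "0 = \<gamma> x" using x by simp
    also have "\<dots> = finsum (degenerate_algebra K) (\<lambda>y. \<gamma> (c y \<odot>\<^bsub>Q\<^esub> y)) F"
      unfolding F(4) by (rule linear_over_finsum[OF QK.module D.module \<gamma>(2) cl])
    also have "\<dots> = (\<Sum>y\<in>F. \<gamma> (c y \<odot>\<^bsub>Q\<^esub> y))"
    proof (rule finsum_eq_sum)
      show "(\<lambda>y. \<gamma> (c y \<odot>\<^bsub>Q\<^esub> y)) \<in> F \<rightarrow> carrier (degenerate_algebra K)"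
        by (rule Pi_I, rule linear_overD(1)[OF \<gamma>(2)]) (use cl in auto)
    qed (use D.abelian_monoid_axioms in simp_all)
    also have "\<dots> = (\<Sum>y\<in>F. single (d y) (c y))" by (rule sum.cong) (simp_all add: tm)
    finally have s0: "(\<Sum>y\<in>F. single (d y) (c y)) = 0" by simp
    have "c y = 0" if "y \<in> F" for y
    proof -
      have "0 = lookup (\<Sum>y'\<in>F. single (d y') (c y')) (d y)" unfolding s0 by simp
      also have "\<dots> = (\<Sum>y'\<in>F. if y' = y then c y' else 0)"
        unfolding lookup_sum
      proof (rule sum.cong[OF refl])
        fix y' assume "y' \<in> F"
        then have "d y' = d y \<longleftrightarrow> y' = y" using d(2) that by metis
        then show "lookup (single (d y') (c y')) (d y) = (if y' = y then c y' else 0)"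
          by (simp add: lookup_single when_def)
      qed
      also have "\<dots> = c y" using F(1) that by simp
      finally show ?thesis by simp
    qed
    then have "x = (\<Oplus>\<^bsub>Q\<^esub>y\<in>F. \<zero>\<^bsub>Q\<^esub>)"
      unfolding F(4) by (intro Q.finsum_cong') (use F(2) EQ QK.smult_l_null in \<open>auto simp: native_cringD[OF K]\<close>)
    then show ?thesis by simp
  qed
  have inj: "inj_on \<gamma> (carrier Q)"
  proof (rule inj_onI)
    fix x y assume xy: "x \<in> carrier Q" "y \<in> carrier Q" "\<gamma> x = \<gamma> y"
    have "\<gamma> (x \<ominus>\<^bsub>Q\<^esub> y) + \<gamma> y = \<gamma> x"
      using linear_overD(2)[OF \<gamma>(2), of "x \<ominus>\<^bsub>Q\<^esub> y" y] xy by (simp add: a_minus_def Q.a_assoc Q.l_neg)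
    then have "\<gamma> (x \<ominus>\<^bsub>Q\<^esub> y) = 0" using xy(3) by simp
    from ker[OF _ this] show "x = y" using xy by simp
  qed
  have sur: "P \<in> \<gamma> ` carrier Q" if "P \<in> carrier (monoid_algebra (carrier K) M)" for P
    using that K refl
  proof (induction P rule: monoid_algebra_induct)
    case zero
    then show ?case using \<gamma>0 by (metis Q.zero_closed imageI)
  next
    case (single v a)
    then show ?case using \<gamma>e[OF single] e by (metis imageI pure_closed)
  next
    case (add P P')
    then obtain x y where "x \<in> carrier Q" "y \<in> carrier Q" "P = \<gamma> x" "P' = \<gamma> y" by blast
    then show ?case using linear_overD(2)[OF \<gamma>(2), of x y] by (auto intro!: image_eqI[of _ _ "x \<oplus>\<^bsub>Q\<^esub> y"])
  qed
  have iso: "\<gamma> \<in> ring_iso Q (degenerate_algebra K)"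
    unfolding ring_iso_def bij_betw_def using \<gamma>(1) inj sur linear_overD(1)[OF \<gamma>(2)] by auto
  have GQ: "(\<lambda>x. pure x \<one>\<^bsub>K\<^esub>) ` G i \<subseteq> carrier Q" for i using G(1)[of i] by auto
  have "base_change_grading k A K G i \<subseteq> carrier Q" for i
    unfolding base_change_grading_def by (rule QK.submoduleE(1)[OF QK.lin_span_submodule[OF GQ]])
  moreover have "\<gamma> ` base_change_grading k A K G i = homogeneous_part K i" for i
  proof -
    \<comment> \<open>Extending coefficients gives a set that need not be closed under scalars from
      \<open>K\<close>, but it contains the monomials of degree i, and these span.\<close>
    let ?H = "Poly_Mapping.mapp (\<lambda>_. \<iota>) ` homogeneous_part k i"
    have "\<gamma> ` base_change_grading k A K G i = lin_span K (degenerate_algebra K) (\<gamma> ` (\<lambda>x. pure x \<one>\<^bsub>K\<^esub>) ` G i)"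
      unfolding base_change_grading_def by (rule lin_span_image[OF QK.module D.module \<gamma>(2) GQ])
    also have "\<gamma> ` (\<lambda>x. pure x \<one>\<^bsub>K\<^esub>) ` G i = ?H"
      unfolding G(2)[symmetric] image_image
      by (rule image_cong) (use G(1)[of i] one_K \<gamma>(3) in \<open>auto simp: native_cringD[OF K] subset_iff\<close>)
    also have "lin_span K (degenerate_algebra K) ?H = homogeneous_part K i"
    proof
      have sH: "submodule (homogeneous_part K i) K (degenerate_algebra K)"
        using degenerate_algebra_graded[OF K] unfolding graded_algebra_def by auto
      have sub: "?H \<subseteq> homogeneous_part K i"
        using keys_mapp_subset[of "\<lambda>_. \<iota>"] \<iota>_in unfolding homogeneous_part_def
        by (auto simp: lookup_mapp_zero[of "\<lambda>_. \<iota>"] \<iota>0 dest!: subsetD[OF keys_mapp_subset])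
      show "lin_span K (degenerate_algebra K) ?H \<subseteq> homogeneous_part K i"
        by (rule D.lin_span_least[OF sH sub])
      have Hc: "?H \<subseteq> carrier (degenerate_algebra K)" using sub D.submoduleE(1)[OF sH] by blast
      have "{single v 1 | v. v \<in> M \<and> w v = i} \<subseteq> ?H"
      proof
        fix P :: "'e \<Rightarrow>\<^sub>0 'a" assume "P \<in> {single v 1 | v. v \<in> M \<and> w v = i}"
        then obtain v where v: "v \<in> M" "w v = i" "P = single v 1" by blast
        have "P = Poly_Mapping.mapp (\<lambda>_. \<iota>) (single v 1)" using v by (simp add: mapp_single[of "\<lambda>_. \<iota>"] \<iota>0 \<iota>_one)
        moreover have "single v 1 \<in> homogeneous_part k i" using sv[OF v(1)] v by (auto simp: homogeneous_part_def)
        ultimately show "P \<in> ?H" by blast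
      qed
      then show "homogeneous_part K i \<subseteq> lin_span K (degenerate_algebra K) ?H"
        unfolding homogeneous_part_eq_lin_span[OF K]
        by (intro D.lin_span_least[OF D.lin_span_submodule[OF Hc]]) (use D.lin_span_incl[OF Hc] in blast)
    qed
    finally show ?thesis .
  qed
  ultimately show thesis using that[OF iso \<gamma>(2,3)] by blast
qed

end

section \<open>Rescaling of monomials\<close>

context degenerate_monoid_algebra
begin

text \<open>Applied with g(v) = \<kappa>^(D m(v)). Multiplicativity is demanded only on pairs that
  survive in \<open>tmul\<close>, because \<open>m\<close> is merely subadditive. The values
  \<open>g' v\<close> are inverses within \<open>carrier R\<close>, so the inverse map keeps the
  coefficients in the ring.\<close>

lemma twist_iso:
  fixes R :: "('k::comm_ring_1, 'r) ring_scheme" and g g' :: "'e \<Rightarrow> 'k"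
  defines "t \<equiv> Poly_Mapping.mapp (\<lambda>v a. g v * a)"
  assumes R: "native_cring R" and g: "\<And>v. v \<in> M \<Longrightarrow> g v \<in> carrier R" "\<And>v. v \<in> M \<Longrightarrow> g' v \<in> carrier R"
    "\<And>v. v \<in> M \<Longrightarrow> g v * g' v = 1" "g 0 = 1"
    "\<And>u v. u \<in> M \<Longrightarrow> v \<in> M \<Longrightarrow> m (u + v) = m u + m v \<Longrightarrow> g (u + v) = g u * g v"
  shows "t \<in> ring_iso (degenerate_algebra R) (degenerate_algebra R)"
    "linear_over R (degenerate_algebra R) (degenerate_algebra R) t"
    "t ` homogeneous_part R i = homogeneous_part R i"
proof -
  interpret D: Module.algebra R "degenerate_algebra R" by (rule degenerate_algebra_algebra[OF R])
  note cl = native_cring_closed[OF R]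
  define t' where "t' = Poly_Mapping.mapp (\<lambda>v a. g' v * a)"
  have lt: "lookup (t P) v = g v * lookup P v" "lookup (t' P) v = g' v * lookup P v" for P v
    unfolding t_def t'_def by (subst lookup_mapp_zero; simp)+
  have kt: "keys (t P) \<subseteq> keys P" "keys (t' P) \<subseteq> keys P" for P
    unfolding t_def t'_def by (rule keys_mapp_subset)+
  \<comment> \<open>Outside \<open>M\<close> nothing is known about the factors, but there the
    coefficients vanish.\<close>
  have cl0: "a * lookup P v \<in> carrier R" if "P \<in> carrier (degenerate_algebra R)" "v \<in> M \<Longrightarrow> a \<in> carrier R" for a P v
  proof (cases "v \<in> M")
    case False
    then have "lookup P v = 0" using that(1) by (auto simp: in_keys_iff)
    then show ?thesis using cl by simp
  qed (use that cl in auto)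
  have tc: "t P \<in> carrier (degenerate_algebra R)" "t' P \<in> carrier (degenerate_algebra R)"
    if "P \<in> carrier (degenerate_algebra R)" for P
    using that kt[of P] cl0[OF that] g(1,2) by (auto simp: lt)
  have tt: "t (t' P) = P" "t' (t P) = P" if "P \<in> carrier (degenerate_algebra R)" for P
  proof -
    have "g v * (g' v * lookup P v) = lookup P v \<and> g' v * (g v * lookup P v) = lookup P v" for v
    proof (cases "v \<in> M")
      case True
      then show ?thesis using g(3)[OF True] by (metis mult.assoc mult.commute mult_1)
    next
      case False
      then have "lookup P v = 0" using that by (auto simp: in_keys_iff)
      then show ?thesis by simp
    qed
    then show "t (t' P) = P" "t' (t P) = P" by (auto intro!: poly_mapping_eqI simp: lt)
  qed
  have t_add: "t (P + Q) = t P + t Q" for P Q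
    by (rule poly_mapping_eqI) (simp add: lt lookup_add distrib_left)
  have t_zero: "t 0 = 0" by (rule poly_mapping_eqI) (simp add: lt)
  have t_single: "t (single v a) = single v (g v * a)" for v a
    unfolding t_def by (subst mapp_single) simp_all
  have t_mult: "t (tmul P Q) = tmul (t P) (t Q)"
    if P: "P \<in> carrier (degenerate_algebra R)" and Q: "Q \<in> carrier (degenerate_algebra R)" for P Q
    using P[unfolded degenerate_algebra_simps] R refl
  proof (induction P rule: monoid_algebra_induct)
    case (single u a)
    show ?case using Q[unfolded degenerate_algebra_simps] R refl
    proof (induction Q rule: monoid_algebra_induct)
      case (single v b)
      then show ?case using \<open>u \<in> M\<close> g(5)[of u v]
        by (simp add: tmul_single t_single tterm_def t_zero mult_ac)
    qed (simp_all add: t_zero t_add tmul_add_right)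
  qed (simp_all add: t_zero t_add tmul_add_left)
  have "bij_betw t (carrier (degenerate_algebra R)) (carrier (degenerate_algebra R))"
    by (rule bij_betw_byWitness[where f' = t']) (use tt tc in blast)+
  moreover have "t \<one>\<^bsub>degenerate_algebra R\<^esub> = \<one>\<^bsub>degenerate_algebra R\<^esub>"
    using t_single[of 0 1] g(4) by simp
  ultimately show "t \<in> ring_iso (degenerate_algebra R) (degenerate_algebra R)"
    unfolding ring_iso_def using tc t_mult t_add by (auto intro!: ring_hom_memI simp del: degenerate_algebra_simps(1))
  show "linear_over R (degenerate_algebra R) (degenerate_algebra R) t"
    unfolding linear_over_def
  proof (intro conjI ballI Pi_I)
    show "t (c \<odot>\<^bsub>degenerate_algebra R\<^esub> P) = c \<odot>\<^bsub>degenerate_algebra R\<^esub> t P"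
      if "c \<in> carrier R" "P \<in> carrier (degenerate_algebra R)" for c P
      using t_mult[of "single 0 c" P] that single_in_monoid_algebra[OF zero_mem that(1) cl(1)] g(4)
      by (simp add: single_mult_eq_tmul t_single)
  qed (use tc t_add in auto)
  show "t ` homogeneous_part R i = homogeneous_part R i"
  proof
    have hp: "t P \<in> homogeneous_part R i \<and> t' P \<in> homogeneous_part R i" if "P \<in> homogeneous_part R i" for P
      using that tc[of P] kt[of P] unfolding homogeneous_part_def by blast
    show "t ` homogeneous_part R i \<subseteq> homogeneous_part R i" using hp by blast
    show "homogeneous_part R i \<subseteq> t ` homogeneous_part R i"
    proof
      fix P assume P: "P \<in> homogeneous_part R i"
      then have "P = t (t' P)" using tt(1)[of P] unfolding homogeneous_part_def by simp
      then show "P \<in> t ` homogeneous_part R i" using hp[OF P] by (rule image_eqI[OF _ conjunct2])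
    qed
  qed
qed

section \<open>The associated graded algebra of the weight filtration\<close>

definition weight_fil :: "('k::comm_ring_1, 'r) ring_scheme \<Rightarrow> real \<Rightarrow> ('e \<Rightarrow>\<^sub>0 'k) set" where
  "weight_fil R i = lin_span R (monoid_algebra (carrier R) M) {single v 1 | v. v \<in> M \<and> w v \<le> i}"

text \<open>\<open>P\<close> itself need not lie in \<open>weight_fil R i\<close>, so the component
  in degree i is the class of its degree-i part. The filtration comes from a weight on a basis, and
  this splitting identifies the module with its associated graded module.\<close>

definition graded_class :: "('k::comm_ring_1, 'r) ring_scheme \<Rightarrow> ('e \<Rightarrow>\<^sub>0 'k) \<Rightarrow> real \<Rightarrow> ('e \<Rightarrow>\<^sub>0 'k) set" where
  "graded_class R P = (\<lambda>i. fil_below (weight_fil R) i +>\<^bsub>monoid_algebra (carrier R) M\<^esub> degree_part i P)"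

lemma weight_fil_eq:
  assumes R: "native_cring R"
  shows "weight_fil R i = {P \<in> carrier (monoid_algebra (carrier R) M). \<forall>v\<in>keys P. w v \<le> i}"
  using lin_span_monoid_algebra[OF R zero_mem add_mem, of "{v \<in> M. w v \<le> i}"]
  by (auto simp: weight_fil_def)

lemma fil_below_eq:
  assumes R: "native_cring R"
  shows "fil_below (weight_fil R) i = {P \<in> carrier (monoid_algebra (carrier R) M). \<forall>v\<in>keys P. w v < i}"
proof
  show "fil_below (weight_fil R) i \<subseteq> {P \<in> carrier (monoid_algebra (carrier R) M). \<forall>v\<in>keys P. w v < i}"
    by (force simp: fil_below_def weight_fil_eq[OF R])
  show "{P \<in> carrier (monoid_algebra (carrier R) M). \<forall>v\<in>keys P. w v < i} \<subseteq> fil_below (weight_fil R) i"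
  proof
    fix P assume P: "P \<in> {P \<in> carrier (monoid_algebra (carrier R) M). \<forall>v\<in>keys P. w v < i}"
    \<comment> \<open>The value \<open>i - 1\<close> keeps the set nonempty when
      \<open>P = 0\<close>. All weights that occur are below i, so their maximum is an admissible
      index of the union.\<close>
    define j where "j = Max (insert (i - 1) (w ` keys P))"
    have "w v \<le> j" if "v \<in> keys P" for v unfolding j_def using that by (intro Max_ge) auto
    moreover have "j \<in> insert (i - 1) (w ` keys P)" unfolding j_def by (rule Max_in) auto
    then have "j < i" using P by auto
    ultimately show "P \<in> fil_below (weight_fil R) i"
      using P by (auto simp: fil_below_def weight_fil_eq[OF R])
  qed
qed

lemma fil_below_submodule:
  assumes R: "native_cring R"
  shows "submodule (fil_below (weight_fil R) i) R (monoid_algebra (carrier R) M)"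
proof -
  interpret A: Module.algebra R "monoid_algebra (carrier R) M"
    by (rule monoid_algebra_algebra[OF R zero_mem add_mem])
  have "fil_below (weight_fil R) i = lin_span R (monoid_algebra (carrier R) M) {single v 1 | v. v \<in> {v \<in> M. w v < i}}"
    unfolding fil_below_eq[OF R] by (subst lin_span_monoid_algebra[OF R zero_mem add_mem]) auto
  then show ?thesis
    using native_cring_closed[OF R]
    by (simp only:, intro A.lin_span_submodule) (auto simp: lookup_single when_def)
qed

end

section \<open>Calculus with cosets of the filtration\<close>

locale weight_filtration = degenerate_monoid_algebra M m w
  for M :: "'e::comm_monoid_add set" and m w :: "'e \<Rightarrow> real" +
  fixes R :: "('k::comm_ring_1, 'r) ring_scheme"
  assumes R: "native_cring R"
begin

abbreviation "A \<equiv> monoid_algebra (carrier R) M"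
abbreviation "D \<equiv> degenerate_algebra R"
abbreviation "F \<equiv> weight_fil R"
abbreviation "Fb \<equiv> fil_below (weight_fil R)"

sublocale A: Module.algebra R A by (rule monoid_algebra_algebra[OF R zero_mem add_mem])
sublocale D: Module.algebra R D by (rule degenerate_algebra_algebra[OF R])

lemmas cl = native_cring_closed[OF R]

lemma Fb_sub: "abelian_subgroup (Fb i) A"
proof (rule abelian_subgroupI3)
  show "additive_subgroup (Fb i) A"
    using fil_below_submodule[OF R, of i] unfolding submodule_def by (intro additive_subgroupI) auto
qed (rule A.M.abelian_group_axioms)

lemma native_A: "native_cring A"
  by (rule monoid_algebra_algebra[OF R zero_mem add_mem])

lemma diff_A: "P \<in> carrier A \<Longrightarrow> Q \<in> carrier A \<Longrightarrow> P - Q \<in> carrier A"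
  by (rule native_cring_closed(6)[OF native_A])

lemma Fb_coset_iff:
  assumes "P \<in> carrier A" "Q \<in> carrier A"
  shows "Fb i +>\<^bsub>A\<^esub> P = Fb i +>\<^bsub>A\<^esub> Q \<longleftrightarrow> P - Q \<in> Fb i"
proof -
  interpret abelian_subgroup "Fb i" A by (rule Fb_sub)
  have "P \<ominus>\<^bsub>A\<^esub> Q = P - Q" using native_a_minus[OF native_A assms(2)] by (simp add: a_minus_def)
  then show ?thesis
    using a_rcos_module_minus[OF A.ring_axioms, of Q P] assms a_repr_independence'[of P Q] a_repr_independenceD[of Q P] a_rcos_self[of P]
    by (metis)
qed

lemma Fb_coset_add:
  assumes "P \<in> carrier A" "Q \<in> carrier A"
  shows "(Fb i +>\<^bsub>A\<^esub> P) <+>\<^bsub>A\<^esub> (Fb i +>\<^bsub>A\<^esub> Q) = Fb i +>\<^bsub>A\<^esub> (P + Q)"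
  using abelian_subgroup.a_rcos_sum[OF Fb_sub assms] by simp

lemma Fb_coset_zero: "Fb i +>\<^bsub>A\<^esub> 0 = Fb i"
proof -
  have "Fb i \<subseteq> carrier A" by (auto simp: fil_below_eq[OF R])
  from A.M.a_coset_add_zero[OF this] show ?thesis by simp
qed

lemma Fb_coset_mem: "x \<in> Fb i +>\<^bsub>A\<^esub> P \<longleftrightarrow> (\<exists>f\<in>Fb i. x = f + P)"
  by (auto simp: a_r_coset_def')

lemma Fb_coset_nonempty: "Fb i +>\<^bsub>A\<^esub> P \<noteq> {}"
  using A.submodule_zero[OF fil_below_submodule[OF R], of i] by (auto simp: a_r_coset_def')

text \<open>A strict bound on one factor survives the subadditivity of \<open>w\<close>. This is
  what makes products of cosets well defined.\<close>

lemma Fb_mult: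
  assumes "P \<in> Fb i \<and> Q \<in> F j \<or> P \<in> F i \<and> Q \<in> Fb j"
  shows "P * Q \<in> Fb (i + j)"
proof -
  have PQ: "P \<in> carrier A" "Q \<in> carrier A" using assms by (auto simp: fil_below_eq[OF R] weight_fil_eq[OF R])
  have "w x < i + j" if x: "x \<in> keys (P * Q)" for x
  proof -
    obtain u v where uv: "u \<in> keys P" "v \<in> keys Q" "x = u + v" using subsetD[OF keys_mult x] by blast
    then have "u \<in> M" "v \<in> M" using PQ by auto
    then have "w x \<le> w u + w v" using w_add uv by simp
    moreover have "w u + w v < i + j" using assms uv by (force simp: fil_below_eq[OF R] weight_fil_eq[OF R])
    ultimately show ?thesis by simp
  qed
  then show ?thesis using A.m_closed[OF PQ] by (simp add: fil_below_eq[OF R])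
qed

lemma Fb_in_F: "P \<in> Fb i \<Longrightarrow> P \<in> F i"
  by (force simp: fil_below_eq[OF R] weight_fil_eq[OF R])

lemma F_in_A: "P \<in> F i \<Longrightarrow> P \<in> carrier A"
  by (simp add: weight_fil_eq[OF R])

lemma Fb_add: "P \<in> Fb i \<Longrightarrow> Q \<in> Fb i \<Longrightarrow> P + Q \<in> Fb i"
  using A.submoduleE(5)[OF fil_below_submodule[OF R], of P i Q] by simp

text \<open>(f + P)(f' + Q) - P Q = f (f' + Q) + P f', and both terms lie below degree i + j. Hence
  the union in the product of \<open>assoc_graded\<close> runs over copies of a single
  coset.\<close>

lemma Fb_coset_mult:
  assumes "P \<in> F i" "Q \<in> F j"
  shows "(\<Union>x\<in>Fb i +>\<^bsub>A\<^esub> P. \<Union>y\<in>Fb j +>\<^bsub>A\<^esub> Q. Fb (i + j) +>\<^bsub>A\<^esub> (x \<otimes>\<^bsub>A\<^esub> y)) = Fb (i + j) +>\<^bsub>A\<^esub> (P * Q)"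
proof -
  have "Fb (i + j) +>\<^bsub>A\<^esub> ((f + P) * (f' + Q)) = Fb (i + j) +>\<^bsub>A\<^esub> (P * Q)" if f: "f \<in> Fb i" "f' \<in> Fb j" for f f'
  proof -
    have c: "f \<in> carrier A" "f' \<in> carrier A" "P \<in> carrier A" "Q \<in> carrier A"
      using assms f Fb_in_F F_in_A by blast+
    have "f * (f' + Q) \<in> Fb (i + j)"
    proof -
      have "f' + Q \<in> F j"
        using keys_add[of f' Q] Fb_in_F[OF f(2)] assms(2) A.M.a_closed[OF c(2,4)] by (auto simp: weight_fil_eq[OF R] subset_iff)
      then show ?thesis using Fb_mult f by blast
    qed
    moreover have "P * f' \<in> Fb (i + j)" using Fb_mult f assms by blast
    ultimately have "(f + P) * (f' + Q) - P * Q \<in> Fb (i + j)"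
      using Fb_add by (simp add: algebra_simps)
    then show ?thesis using Fb_coset_iff A.m_closed A.M.a_closed c by simp
  qed
  then have "(\<Union>x\<in>Fb i +>\<^bsub>A\<^esub> P. \<Union>y\<in>Fb j +>\<^bsub>A\<^esub> Q. Fb (i + j) +>\<^bsub>A\<^esub> (x \<otimes>\<^bsub>A\<^esub> y)) =
      (\<Union>x\<in>Fb i +>\<^bsub>A\<^esub> P. \<Union>y\<in>Fb j +>\<^bsub>A\<^esub> Q. Fb (i + j) +>\<^bsub>A\<^esub> (P * Q))"
    by (intro SUP_cong refl) (auto simp: Fb_coset_mem)
  then show ?thesis using Fb_coset_nonempty by simp
qed

lemma Fb_coset_smult:
  assumes "P \<in> carrier A" "c \<in> carrier R"
  shows "(\<Union>x\<in>Fb i +>\<^bsub>A\<^esub> P. Fb i +>\<^bsub>A\<^esub> (c \<odot>\<^bsub>A\<^esub> x)) = Fb i +>\<^bsub>A\<^esub> (single 0 c * P)"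
proof -
  have "Fb i +>\<^bsub>A\<^esub> (single 0 c * (f + P)) = Fb i +>\<^bsub>A\<^esub> (single 0 c * P)" if f: "f \<in> Fb i" for f
  proof -
    have fc: "f \<in> carrier A" using f Fb_in_F F_in_A by blast
    have "single 0 c * f \<in> Fb i" using A.submoduleE(4)[OF fil_below_submodule[OF R] assms(2) f] by simp
    then show ?thesis
      using Fb_coset_iff[of "single 0 c * (f + P)" "single 0 c * P" i] A.smult_closed[OF assms(2), of "f + P"]
        A.smult_closed[OF assms(2,1)] A.M.a_closed[OF fc assms(1)] by (simp add: algebra_simps)
  qed
  then have "(\<Union>x\<in>Fb i +>\<^bsub>A\<^esub> P. Fb i +>\<^bsub>A\<^esub> (c \<odot>\<^bsub>A\<^esub> x)) = (\<Union>x\<in>Fb i +>\<^bsub>A\<^esub> P. Fb i +>\<^bsub>A\<^esub> (single 0 c * P))"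
    by (intro SUP_cong refl) (auto simp: Fb_coset_mem)
  then show ?thesis using Fb_coset_nonempty by simp
qed

text \<open>Evaluates the finite product in the quotient group by which \<open>assoc_graded\<close>
  defines its multiplication. Membership of the sum in the carrier is proved along with it, because
  the induction step adds cosets of carrier elements.\<close>

lemma Fb_finprod:
  assumes "finite S" "\<And>i. i \<in> S \<Longrightarrow> p i \<in> carrier A"
  shows "finprod (A A_Mod Fb n) (\<lambda>i. Fb n +>\<^bsub>A\<^esub> p i) S = Fb n +>\<^bsub>A\<^esub> (\<Sum>i\<in>S. p i) \<and> (\<Sum>i\<in>S. p i) \<in> carrier A"
proof -
  interpret q: comm_group "A A_Mod Fb n" by (rule abelian_subgroup.a_factorgroup_is_comm_group[OF Fb_sub])
  have in_q: "Fb n +>\<^bsub>A\<^esub> P \<in> carrier (A A_Mod Fb n)" if "P \<in> carrier A" for P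
    using that unfolding A_FactGroup_def' A_RCOSETS_def' a_r_coset_def' by auto
  show ?thesis using assms
  proof (induction S)
    case empty
    then show ?case using A.M.zero_closed by (simp add: Fb_coset_zero) (simp add: A_FactGroup_def')
  next
    case (insert i S)
    then have "finprod (A A_Mod Fb n) (\<lambda>i. Fb n +>\<^bsub>A\<^esub> p i) (insert i S) =
        (Fb n +>\<^bsub>A\<^esub> p i) <+>\<^bsub>A\<^esub> (Fb n +>\<^bsub>A\<^esub> (\<Sum>i\<in>S. p i))"
      by (subst q.finprod_insert) (use in_q in auto)
    then show ?case
      using insert Fb_coset_add[of "p i" "\<Sum>i\<in>S. p i" n] A.M.a_closed[of "p i" "\<Sum>i\<in>S. p i"] by simp
  qed
qed

lemma degree_part_F: "P \<in> carrier A \<Longrightarrow> degree_part i P \<in> F i"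
  using cl by (auto simp: weight_fil_eq[OF R] keys_degree_part lookup_degree_part)

lemma degree_part_A: "P \<in> carrier A \<Longrightarrow> degree_part i P \<in> carrier A"
  using degree_part_F F_in_A by blast

text \<open>The support of a degree part lies in weight exactly i, that of an element of
  \<open>Fb i\<close> in weights below i. So degree parts are canonical representatives of their
  classes.\<close>

lemma degree_part_Fb: "degree_part i P \<in> Fb i \<Longrightarrow> degree_part i P = 0"
  by (auto simp: fil_below_eq[OF R] keys_degree_part simp flip: keys_eq_empty)

lemma degree_part_zero [simp]: "degree_part i 0 = 0"
  by (rule poly_mapping_eqI) (simp add: lookup_degree_part)

lemma degree_part_sum: "degree_part i (sum f S) = (\<Sum>x\<in>S. degree_part i (f x))"
  by (induction S rule: infinite_finite_induct) (simp_all add: degree_part_add)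

lemma degree_part_diff: "degree_part i (P - Q) = degree_part i P - degree_part i (Q :: 'e \<Rightarrow>\<^sub>0 'k)"
  by (rule poly_mapping_eqI) (simp add: lookup_degree_part lookup_minus)

lemma graded_class_eq_Fb_iff:
  assumes "P \<in> carrier A"
  shows "graded_class R P i = Fb i \<longleftrightarrow> degree_part i P = 0"
proof -
  have "graded_class R P i = Fb i \<longleftrightarrow> degree_part i P - 0 \<in> Fb i"
    using Fb_coset_iff[OF degree_part_A[OF assms, of i] A.M.zero_closed, of i]
    by (simp add: graded_class_def Fb_coset_zero)
  then show ?thesis using degree_part_Fb[of i P] A.submodule_zero[OF fil_below_submodule[OF R], of i] by auto
qed

lemma finite_degree_part: "finite {i. degree_part i P \<noteq> 0}"
proof (rule finite_subset)
  show "{i. degree_part i P \<noteq> 0} \<subseteq> w ` keys P"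
    using keys_degree_part[of _ P] by (force simp flip: keys_eq_empty)
qed simp

lemma graded_class_closed:
  assumes "P \<in> carrier A"
  shows "graded_class R P \<in> carrier (assoc_graded A F)"
proof -
  have "{i. graded_class R P i \<noteq> Fb i} = {i. degree_part i P \<noteq> 0}"
    using graded_class_eq_Fb_iff[OF assms] by auto
  then show ?thesis
    unfolding assoc_graded_def using degree_part_F[OF assms] finite_degree_part[of P]
    by (auto simp: graded_class_def)
qed

lemma degree_part_mult:
  fixes P Q :: "'e \<Rightarrow>\<^sub>0 'k"
  shows
  "degree_part i P * degree_part j Q =
    (\<Sum>u\<in>keys P. \<Sum>v\<in>keys Q. if w u = i \<and> w v = j then single (u + v) (lookup P u * lookup Q v) else 0)"
proof -
  have d: "degree_part i P = (\<Sum>u\<in>keys P. if w u = i then single u (lookup P u) else 0)" for i and P :: "'e \<Rightarrow>\<^sub>0 'k"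
  proof -
    have "degree_part i P = (\<Sum>u\<in>keys P. degree_part i (single u (lookup P u)))"
      by (subst poly_mapping_sum_single[of P]) (rule degree_part_sum)
    also have "\<dots> = (\<Sum>u\<in>keys P. if w u = i then single u (lookup P u) else 0)"
      by (intro sum.cong refl poly_mapping_eqI) (auto simp: lookup_degree_part lookup_single when_def)
    finally show ?thesis .
  qed
  show ?thesis
    unfolding d[of i P] d[of j Q] sum_product
    by (intro sum.cong refl) (simp add: mult_single)
qed

text \<open>A term \<open>x\<^sup>u x\<^sup>v\<close> with \<open>w u + w v = n\<close> that \<open>tmul\<close> discards has \<open>w (u + v) < n\<close>.\<close>

lemma graded_product:
  assumes P: "P \<in> carrier A" and Q: "Q \<in> carrier A"
  shows "(\<Sum>i\<in>w ` keys P. degree_part i P * degree_part (n - i) Q) - degree_part n (tmul P Q) \<in> Fb n"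
proof -
  let ?t = "\<lambda>u v. single (u + v) (lookup P u * lookup Q v)"
  have "(\<Sum>i\<in>w ` keys P. degree_part i P * degree_part (n - i) Q) =
    (\<Sum>u\<in>keys P. \<Sum>v\<in>keys Q. \<Sum>i\<in>w ` keys P. if w u = i \<and> w v = n - i then ?t u v else 0)"
    unfolding degree_part_mult by (subst sum.swap, rule sum.cong[OF refl], rule sum.swap)
  also have "\<dots> = (\<Sum>u\<in>keys P. \<Sum>v\<in>keys Q. if w u + w v = n then ?t u v else 0)"
  proof (intro sum.cong refl)
    \<comment> \<open>For fixed u and v only the index i = \<open>w u\<close> contributes.\<close>
    fix u v assume uv: "u \<in> keys P" "v \<in> keys Q"
    have "(\<Sum>i\<in>w ` keys P. if w u = i \<and> w v = n - i then ?t u v else 0) =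
        (\<Sum>i\<in>w ` keys P. if w u = i then (if w v = n - w u then ?t u v else 0) else 0)"
      by (intro sum.cong refl) auto
    also have "\<dots> = (if w v = n - w u then ?t u v else 0)" using uv by simp
    also have "\<dots> = (if w u + w v = n then ?t u v else 0)" by (auto simp: algebra_simps)
    finally show "(\<Sum>i\<in>w ` keys P. if w u = i \<and> w v = n - i then ?t u v else 0) = (if w u + w v = n then ?t u v else 0)" .
  qed
  finally have "(\<Sum>i\<in>w ` keys P. degree_part i P * degree_part (n - i) Q) - degree_part n (tmul P Q) =
    (\<Sum>u\<in>keys P. \<Sum>v\<in>keys Q. (if w u + w v = n then ?t u v else 0) - degree_part n (tterm u v (lookup P u * lookup Q v)))"
    by (simp add: tmul_def degree_part_sum sum_subtractf)
  moreover have "keys ((if w u + w v = n then ?t u v else 0) - degree_part n (tterm u v (lookup P u * lookup Q v))) \<subseteq> {x. w x < n}"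
    if "u \<in> keys P" "v \<in> keys Q" for u v
  proof -
    have uv: "u \<in> M" "v \<in> M" using that P Q by auto
    have dt: "degree_part n (?t u v) = (if w (u + v) = n then ?t u v else 0)"
      by (rule poly_mapping_eqI) (auto simp: lookup_degree_part lookup_single when_def)
    \<comment> \<open>For an additive pair the two terms cancel if \<open>w u + w v = n\<close> and
      both vanish otherwise; for any other pair \<open>tterm\<close> is 0.\<close>
    show ?thesis
      using w_add[OF uv] w_add_iff[OF uv] by (auto simp: tterm_def dt split: if_splits)
  qed
  ultimately have "keys ((\<Sum>i\<in>w ` keys P. degree_part i P * degree_part (n - i) Q) - degree_part n (tmul P Q)) \<subseteq> {x. w x < n}"
    by (simp only:) (intro order_trans[OF keys_sum] UN_least, blast)
  moreover have "(\<Sum>i\<in>w ` keys P. degree_part i P * degree_part (n - i) Q) \<in> carrier A"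
    using Fb_finprod[of "w ` keys P" "\<lambda>i. degree_part i P * degree_part (n - i) Q" n]
      A.m_closed degree_part_A[OF P] degree_part_A[OF Q] by simp
  moreover have "degree_part n (tmul P Q) \<in> carrier A"
    by (rule degree_part_A[OF tmul_closed[OF R P Q]])
  ultimately show ?thesis using diff_A unfolding fil_below_eq[OF R] by blast
qed

lemma graded_class_mult:
  assumes P: "P \<in> carrier A" and Q: "Q \<in> carrier A"
  shows "graded_class R (tmul P Q) = graded_class R P \<otimes>\<^bsub>assoc_graded A F\<^esub> graded_class R Q"
proof
  fix n
  let ?S = "{i. graded_class R P i \<noteq> Fb i \<and> graded_class R Q (n - i) \<noteq> Fb (n - i)}"
  let ?p = "\<lambda>i. degree_part i P * degree_part (n - i) Q"
  have S: "?S = {i. degree_part i P \<noteq> 0 \<and> degree_part (n - i) Q \<noteq> 0}"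
    using graded_class_eq_Fb_iff[OF P] graded_class_eq_Fb_iff[OF Q] by auto
  have fin: "finite ?S" unfolding S by (rule finite_subset[OF _ finite_degree_part[of P]]) auto
  have p: "?p i \<in> carrier A" for i
    using A.m_closed[OF degree_part_A[OF P] degree_part_A[OF Q]] by simp
  have "(graded_class R P \<otimes>\<^bsub>assoc_graded A F\<^esub> graded_class R Q) n =
    finprod (A A_Mod Fb n) (\<lambda>i. Fb n +>\<^bsub>A\<^esub> ?p i) ?S"
  proof -
    have "(\<Union>x\<in>graded_class R P i. \<Union>y\<in>graded_class R Q (n - i). Fb n +>\<^bsub>A\<^esub> (x \<otimes>\<^bsub>A\<^esub> y)) = Fb n +>\<^bsub>A\<^esub> ?p i" for i
      using Fb_coset_mult[OF degree_part_F[OF P] degree_part_F[OF Q], of i "n - i"] unfolding graded_class_def by simp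
    then show ?thesis unfolding assoc_graded_def by simp
  qed
  also have "\<dots> = Fb n +>\<^bsub>A\<^esub> (\<Sum>i\<in>?S. ?p i)" using Fb_finprod[OF fin p] by simp
  \<comment> \<open>\<open>assoc_graded\<close> multiplies only in degrees where both components are
    nonzero; the indices added here contribute 0.\<close>
  also have "(\<Sum>i\<in>?S. ?p i) = (\<Sum>i\<in>w ` keys P. ?p i)"
  proof (rule sum.mono_neutral_left)
    show "?S \<subseteq> w ` keys P" unfolding S using keys_degree_part[of _ P] by (force simp flip: keys_eq_empty)
  qed (auto simp: S)
  also have "Fb n +>\<^bsub>A\<^esub> (\<Sum>i\<in>w ` keys P. ?p i) = Fb n +>\<^bsub>A\<^esub> degree_part n (tmul P Q)"
    using graded_product[OF P Q, of n] Fb_finprod[OF _ p, of "w ` keys P" n] degree_part_A[OF tmul_closed[OF R P Q]]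
    by (subst Fb_coset_iff) auto
  finally show "graded_class R (tmul P Q) n = (graded_class R P \<otimes>\<^bsub>assoc_graded A F\<^esub> graded_class R Q) n"
    by (simp add: graded_class_def)
qed

lemma graded_class_add:
  assumes P: "P \<in> carrier A" and Q: "Q \<in> carrier A"
  shows "graded_class R (P + Q) = graded_class R P \<oplus>\<^bsub>assoc_graded A F\<^esub> graded_class R Q"
  by (rule ext) (simp add: assoc_graded_def graded_class_def Fb_coset_add degree_part_A P Q degree_part_add del: monoid_algebra_simps)

lemma graded_class_smult:
  assumes P: "P \<in> carrier A" and c: "c \<in> carrier R"
  shows "graded_class R (single 0 c * P) = c \<odot>\<^bsub>assoc_graded A F\<^esub> graded_class R P"
proof
  fix i
  have "lookup (single 0 c * P) v = c * lookup P v" for P :: "'e \<Rightarrow>\<^sub>0 'k" and v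
  proof -
    have "single 0 c * P = Poly_Mapping.map ((*) c) P" by (rule mult_map_scale_conv_mult[symmetric])
    then show ?thesis by (simp add: Poly_Mapping.map.rep_eq when_def)
  qed
  then have "degree_part i (single 0 c * P) = single 0 c * degree_part i P"
    by (intro poly_mapping_eqI) (simp add: lookup_degree_part)
  then show "graded_class R (single 0 c * P) i = (c \<odot>\<^bsub>assoc_graded A F\<^esub> graded_class R P) i"
    using Fb_coset_smult[OF degree_part_A[OF P] c, of i i] by (simp add: assoc_graded_def graded_class_def)
qed

lemma graded_class_zero: "graded_class R 0 = Fb"
  by (rule ext) (simp add: graded_class_def Fb_coset_zero)

lemma graded_class_one: "graded_class R 1 = \<one>\<^bsub>assoc_graded A F\<^esub>"
proof
  fix i
  have "degree_part i (1 :: 'e \<Rightarrow>\<^sub>0 'k) = (if i = 0 then 1 else 0)"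
    by (rule poly_mapping_eqI) (auto simp: lookup_degree_part lookup_one when_def w_zero)
  then show "graded_class R 1 i = \<one>\<^bsub>assoc_graded A F\<^esub> i"
    by (simp add: graded_class_def assoc_graded_def Fb_coset_zero)
qed

lemma graded_class_inj: "inj_on (graded_class R) (carrier A)"
proof (rule inj_onI)
  fix P Q assume PQ: "P \<in> carrier A" "Q \<in> carrier A" "graded_class R P = graded_class R Q"
  have "degree_part i (P - Q) = 0" for i
  proof -
    have "degree_part i P - degree_part i Q \<in> Fb i"
      using Fb_coset_iff[OF degree_part_A[OF PQ(1)] degree_part_A[OF PQ(2)], of i i i] fun_cong[OF PQ(3), of i]
      by (simp add: graded_class_def)
    then show ?thesis using degree_part_Fb[of i "P - Q"] by (simp add: degree_part_diff)
  qed
  then have "P - Q = 0" using sum_degree_part[of "w ` keys (P - Q)" "P - Q"] by simp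
  then show "P = Q" by simp
qed

lemma graded_class_surj:
  assumes "g \<in> carrier (assoc_graded A F)"
  shows "\<exists>P\<in>carrier A. g = graded_class R P"
proof -
  define S where "S = {i. g i \<noteq> Fb i}"
  have fin: "finite S" and "\<forall>i. \<exists>x\<in>F i. g i = Fb i +>\<^bsub>A\<^esub> x"
    using assms unfolding assoc_graded_def S_def by auto
  then obtain x where x: "\<And>i. x i \<in> F i" "\<And>i. g i = Fb i +>\<^bsub>A\<^esub> x i" by metis
  \<comment> \<open>Of each representative \<open>x i\<close> only the part of degree i matters; the
    rest lies below i and disappears in the coset.\<close>
  define P where "P = (\<Sum>i\<in>S. degree_part i (x i))"
  have xA: "x i \<in> carrier A" for i using x F_in_A by blast
  have P: "P \<in> carrier A" unfolding P_def
    using Fb_finprod[OF fin, of "\<lambda>i. degree_part i (x i)" 0] degree_part_A[OF xA] by simp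
  have dd: "degree_part j (degree_part i p) = (if i = j then degree_part i p else 0)" for i j and p :: "'e \<Rightarrow>\<^sub>0 'k"
    by (rule poly_mapping_eqI) (auto simp: lookup_degree_part)
  have "graded_class R P j = g j" for j
  proof -
    have d: "degree_part j P = (if j \<in> S then degree_part j (x j) else 0)"
      unfolding P_def degree_part_sum dd using fin by simp
    have "Fb j +>\<^bsub>A\<^esub> degree_part j (x j) = Fb j +>\<^bsub>A\<^esub> x j"
    proof (subst Fb_coset_iff)
      show "degree_part j (x j) - x j \<in> Fb j"
      proof -
        have "w v < j" if "v \<in> keys (degree_part j (x j) - x j)" for v
        proof -
          have "lookup (x j) v \<noteq> 0" "w v \<noteq> j" using that by (auto simp: in_keys_iff lookup_minus lookup_degree_part split: if_splits)
          then show ?thesis using x(1)[of j] by (force simp: weight_fil_eq[OF R] in_keys_iff)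
        qed
        then show ?thesis using diff_A[OF degree_part_A[OF xA] xA] by (auto simp: fil_below_eq[OF R])
      qed
    qed (use degree_part_A xA in blast)+
    then show ?thesis using d x(2)[of j] by (auto simp: graded_class_def S_def Fb_coset_zero)
  qed
  then show ?thesis using P by (intro bexI[of _ P]) auto
qed

lemma graded_class_iso:
  "graded_class R \<in> ring_iso D (assoc_graded A F)"
  "linear_over R D (assoc_graded A F) (graded_class R)"
  "graded_class R \<zero>\<^bsub>D\<^esub> = \<zero>\<^bsub>assoc_graded A F\<^esub>"
proof -
  have "bij_betw (graded_class R) (carrier D) (carrier (assoc_graded A F))"
    unfolding bij_betw_def using graded_class_inj graded_class_closed graded_class_surj by auto
  then show "graded_class R \<in> ring_iso D (assoc_graded A F)"
    unfolding ring_iso_def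
    using graded_class_closed graded_class_mult graded_class_add graded_class_one
    by (auto intro!: ring_hom_memI)
  show "linear_over R D (assoc_graded A F) (graded_class R)"
    unfolding linear_over_def using graded_class_closed graded_class_smult graded_class_add by auto
  show "graded_class R \<zero>\<^bsub>D\<^esub> = \<zero>\<^bsub>assoc_graded A F\<^esub>"
    by (simp add: graded_class_zero) (simp add: assoc_graded_def)
qed

lemma graded_class_homogeneous:
  "graded_class R ` homogeneous_part R i = assoc_graded_piece A F i"
proof
  show "graded_class R ` homogeneous_part R i \<subseteq> assoc_graded_piece A F i"
  proof
    fix g assume "g \<in> graded_class R ` homogeneous_part R i"
    then obtain P where P: "P \<in> carrier A" "\<forall>v\<in>keys P. w v = i" "g = graded_class R P"
      by (auto simp: homogeneous_part_def)
    have "degree_part j P = 0" if "j \<noteq> i" for j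
      using P(2) that keys_degree_part[of j P] by (auto simp flip: keys_eq_empty)
    then show "g \<in> assoc_graded_piece A F i"
      unfolding assoc_graded_piece_def using graded_class_closed[OF P(1)] graded_class_eq_Fb_iff[OF P(1)] P(3) by simp
  qed
  show "assoc_graded_piece A F i \<subseteq> graded_class R ` homogeneous_part R i"
  proof
    fix g assume g: "g \<in> assoc_graded_piece A F i"
    then obtain P where P: "P \<in> carrier A" "g = graded_class R P"
      using graded_class_surj unfolding assoc_graded_piece_def by blast
    have "degree_part j P = 0" if "j \<noteq> i" for j
      using g that graded_class_eq_Fb_iff[OF P(1)] P(2) unfolding assoc_graded_piece_def by blast
    then have "w v = i" if "v \<in> keys P" for v
      using keys_degree_part[of "w v" P] that by fastforce
    then show "g \<in> graded_class R ` homogeneous_part R i" using P by (auto simp: homogeneous_part_def)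
  qed
qed

lemma assoc_graded_graded: "graded_algebra R (assoc_graded A F) (assoc_graded_piece A F)"
  by (rule graded_algebra_transport[OF degenerate_algebra_graded[OF R] graded_class_iso])
    (simp add: graded_class_homogeneous)

text \<open>Links \<open>xbar\<close>, defined by a class in a single degree, with the image of a
  monomial of the model.\<close>

lemma gr_class_single:
  "gr_class A F (w v) (single v a) = graded_class R (single v a)"
proof
  fix j
  have "degree_part j (single v a) = (if j = w v then single v a else 0)"
    by (rule poly_mapping_eqI) (auto simp: lookup_degree_part lookup_single when_def)
  then show "gr_class A F (w v) (single v a) j = graded_class R (single v a) j"
    by (simp add: gr_class_def graded_class_def Fb_coset_zero)
qed

end

section \<open>The deformation ring and its special fibre\<close>

lemma submodule_subgroup: "submodule H R M \<Longrightarrow> subgroup H (add_monoid M)"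
  by (simp add: submodule_def)

section \<open>Monomial ideals and quotient algebras\<close>

lemma monoid_algebra_ideal:
  assumes R: "native_cring R" and E: "0 \<in> E" "\<And>u v. u \<in> E \<Longrightarrow> v \<in> E \<Longrightarrow> u + v \<in> E"
    and V: "V \<subseteq> E" "\<And>u v. u \<in> V \<Longrightarrow> v \<in> E \<Longrightarrow> u + v \<in> V"
  shows "ideal {P \<in> carrier (monoid_algebra (carrier R) E). keys P \<subseteq> V} (monoid_algebra (carrier R) E)"
    (is "ideal ?I ?A")
proof -
  interpret Module.algebra R ?A by (rule monoid_algebra_algebra[OF R E])
  have 1: "Q * P \<in> ?I" if "P \<in> ?I" "Q \<in> carrier ?A" for P Q
  proof -
    have "keys (P * Q) \<subseteq> V"
    proof
      fix x assume "x \<in> keys (P * Q)"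
      then obtain u v where "u \<in> keys P" "v \<in> keys Q" "x = u + v" using subsetD[OF keys_mult] by blast
      moreover from this have "u \<in> V" "v \<in> E" using that by (blast, simp, blast)
      ultimately show "x \<in> V" using V(2) by simp
    qed
    moreover have "P * Q \<in> carrier ?A" using m_closed[of P Q] that by simp
    ultimately show ?thesis by (simp add: mult.commute)
  qed
  show ?thesis
  proof (rule idealI[OF ring_axioms])
    have "submodule (lin_span R ?A {single v 1 | v. v \<in> V}) R ?A"
      by (rule lin_span_submodule) (use V native_cring_closed[OF R] in \<open>auto simp: lookup_single when_def\<close>)
    moreover have "lin_span R ?A {single v 1 | v. v \<in> V} = ?I"
      by (rule lin_span_monoid_algebra[OF R E V(1)])
    ultimately show "subgroup ?I (add_monoid ?A)" by (simp only: submodule_subgroup)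
  qed (use 1 in \<open>auto simp: mult.commute\<close>)
qed

lemma genideal_monoid_algebra:
  assumes R: "native_cring R" and E: "0 \<in> E" "\<And>u v. u \<in> E \<Longrightarrow> v \<in> E \<Longrightarrow> u + v \<in> E"
    and V: "V \<subseteq> E" "\<And>u v. u \<in> V \<Longrightarrow> v \<in> E \<Longrightarrow> u + v \<in> V"
    and U: "U \<subseteq> carrier (monoid_algebra (carrier R) E)" "\<And>P. P \<in> U \<Longrightarrow> keys P \<subseteq> V"
    and gen: "\<And>v. v \<in> V \<Longrightarrow> \<exists>g e. single g 1 \<in> U \<and> e \<in> E \<and> v = g + e"
  shows "genideal (monoid_algebra (carrier R) E) U = {P \<in> carrier (monoid_algebra (carrier R) E). keys P \<subseteq> V}"
    (is "genideal ?A U = ?I")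
proof
  interpret Module.algebra R ?A by (rule monoid_algebra_algebra[OF R E])
  interpret U: ideal "genideal ?A U" ?A by (rule genideal_ideal[OF U(1)])
  show "genideal ?A U \<subseteq> ?I"
  proof (rule genideal_minimal)
    show "ideal ?I ?A" by (rule monoid_algebra_ideal[OF R E V])
    show "U \<subseteq> ?I" by (intro subsetI CollectI conjI subsetD[OF U(1)] U(2))
  qed
  show "?I \<subseteq> genideal ?A U"
  proof
    fix P assume "P \<in> ?I"
    then have "P \<in> carrier (monoid_algebra (carrier R) V)" by simp
    then show "P \<in> genideal ?A U" using R refl
    proof (induction P rule: monoid_algebra_induct)
      case zero
      then show ?case using U.zero_closed by simp
    next
      case (single v a)
      obtain g e where ge: "single g 1 \<in> U" "e \<in> E" "v = g + e" using gen[OF single(1)] by blast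
      have "single e a \<in> carrier ?A"
        using single_in_monoid_algebra[OF ge(2) single(2) native_cring_closed(1)[OF R]] .
      moreover have "single g 1 \<in> genideal ?A U" using genideal_self[OF U(1)] ge by blast
      ultimately have "single g 1 * single e a \<in> genideal ?A U" using U.I_r_closed by simp
      then show ?case by (simp add: mult_single ge)
    next
      case (add P P')
      then show ?case using U.a_closed[of P P'] by simp
    qed
  qed
qed

lemma restrict_scalars_algebra:
  assumes A: "Module.algebra k' A" and k: "cring k" and h: "h \<in> ring_hom k k'"
  shows "Module.algebra k (with_smult A (\<lambda>c x. h c \<odot>\<^bsub>A\<^esub> x))"
proof -
  interpret A: Module.algebra k' A by fact
  note hm = ring_hom_memE[OF h]
  show ?thesis
    by (rule algebraI[OF k with_smult_cring[OF A.M_cring]])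
      (auto simp: hm A.smult_l_distr A.smult_r_distr A.smult_assoc1 A.smult_assoc2)
qed

text \<open>Replacing s by s + i changes the product by i t, which lies in \<open>J\<close> because
  \<open>I\<close> is contained in \<open>J\<close>. So the union over representatives that defines
  the scalar action is a single coset.\<close>

lemma quotient_algebra:
  fixes T S :: "('k, 'x, 'm) module_scheme"
  assumes T: "cring T" and S: "cring S" and sub: "carrier S \<subseteq> carrier T"
    and ops: "monoid.mult S = monoid.mult T" "add S = add T" "one S = one T"
    and I: "ideal I S" and J: "ideal J T" and IJ: "I \<subseteq> J"
  defines "B \<equiv> with_smult (T Quot J) (\<lambda>x y. \<Union>s\<in>x. \<Union>t\<in>y. J +>\<^bsub>T\<^esub> (s \<otimes>\<^bsub>T\<^esub> t))"
  shows "s \<in> carrier S \<Longrightarrow> t \<in> carrier T \<Longrightarrow> (I +>\<^bsub>S\<^esub> s) \<odot>\<^bsub>B\<^esub> (J +>\<^bsub>T\<^esub> t) = J +>\<^bsub>T\<^esub> (s \<otimes>\<^bsub>T\<^esub> t)"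
    and "Module.algebra (S Quot I) B"
proof -
  interpret T: cring T by fact
  interpret S: cring S by fact
  interpret I: ideal I S by fact
  interpret J: ideal J T by fact
  interpret TJ: cring "T Quot J" by (rule J.quotient_is_cring[OF T])
  have act: "(I +>\<^bsub>S\<^esub> s) \<odot>\<^bsub>B\<^esub> (J +>\<^bsub>T\<^esub> t) = J +>\<^bsub>T\<^esub> (s \<otimes>\<^bsub>T\<^esub> t)" if st: "s \<in> carrier S" "t \<in> carrier T" for s t
  proof -
    have "J +>\<^bsub>T\<^esub> (s' \<otimes>\<^bsub>T\<^esub> t') = J +>\<^bsub>T\<^esub> (s \<otimes>\<^bsub>T\<^esub> t)" if "s' \<in> I +>\<^bsub>S\<^esub> s" "t' \<in> J +>\<^bsub>T\<^esub> t" for s' t'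
    proof -
      have s: "s \<in> carrier T" using st sub by blast
      from that obtain i where i: "i \<in> I" "s' = i \<oplus>\<^bsub>T\<^esub> s" by (auto simp: a_r_coset_def' ops)
      have "s' \<in> J +>\<^bsub>T\<^esub> s" using i IJ by (auto simp: a_r_coset_def')
      then have "J +>\<^bsub>T\<^esub> (s' \<otimes>\<^bsub>T\<^esub> t') \<subseteq> [mod J:] (J +>\<^bsub>T\<^esub> s) \<Otimes>\<^bsub>T\<^esub> (J +>\<^bsub>T\<^esub> t)"
        using that(2) unfolding rcoset_mult_def by blast
      then have sub': "J +>\<^bsub>T\<^esub> (s' \<otimes>\<^bsub>T\<^esub> t') \<subseteq> J +>\<^bsub>T\<^esub> (s \<otimes>\<^bsub>T\<^esub> t)"
        using J.rcoset_mult_add[OF s st(2)] by simp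
      have "t' \<in> carrier T" using that(2) st(2) J.a_subset by (auto simp: a_r_coset_def')
      moreover have "s' \<in> carrier T" using i(1) IJ J.a_subset s unfolding i(2) by blast
      ultimately have c: "s' \<otimes>\<^bsub>T\<^esub> t' \<in> carrier T" by simp
      then have "s' \<otimes>\<^bsub>T\<^esub> t' \<in> J +>\<^bsub>T\<^esub> (s \<otimes>\<^bsub>T\<^esub> t)" using J.a_rcos_self sub' by blast
      then show ?thesis using J.a_repr_independence'[of "s' \<otimes>\<^bsub>T\<^esub> t'" "s \<otimes>\<^bsub>T\<^esub> t"] s st(2) by simp
    qed
    then have "(\<Union>s'\<in>I +>\<^bsub>S\<^esub> s. \<Union>t'\<in>J +>\<^bsub>T\<^esub> t. J +>\<^bsub>T\<^esub> (s' \<otimes>\<^bsub>T\<^esub> t')) =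
        (\<Union>s'\<in>I +>\<^bsub>S\<^esub> s. \<Union>t'\<in>J +>\<^bsub>T\<^esub> t. J +>\<^bsub>T\<^esub> (s \<otimes>\<^bsub>T\<^esub> t))"
      by (intro SUP_cong refl) simp
    moreover have "I +>\<^bsub>S\<^esub> s \<noteq> {}" "J +>\<^bsub>T\<^esub> t \<noteq> {}" using I.a_rcos_self[OF st(1)] J.a_rcos_self[OF st(2)] by auto
    ultimately show ?thesis by (simp add: B_def)
  qed
  then show "s \<in> carrier S \<Longrightarrow> t \<in> carrier T \<Longrightarrow> (I +>\<^bsub>S\<^esub> s) \<odot>\<^bsub>B\<^esub> (J +>\<^bsub>T\<^esub> t) = J +>\<^bsub>T\<^esub> (s \<otimes>\<^bsub>T\<^esub> t)" for s t .
  have repS: "\<exists>s\<in>carrier S. x = I +>\<^bsub>S\<^esub> s" if "x \<in> carrier (S Quot I)" for x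
    using that by (auto simp: FactRing_def A_RCOSETS_def' a_r_coset_def')
  have repT: "\<exists>t\<in>carrier T. x = J +>\<^bsub>T\<^esub> t" if "x \<in> carrier B" for x
    using that by (auto simp: B_def FactRing_def A_RCOSETS_def' a_r_coset_def')
  have inB: "J +>\<^bsub>T\<^esub> t \<in> carrier B" if "t \<in> carrier T" for t
    using that by (auto simp: B_def FactRing_def A_RCOSETS_def' a_r_coset_def')
  have addB: "(J +>\<^bsub>T\<^esub> t) \<oplus>\<^bsub>B\<^esub> (J +>\<^bsub>T\<^esub> t') = J +>\<^bsub>T\<^esub> (t \<oplus>\<^bsub>T\<^esub> t')" if "t \<in> carrier T" "t' \<in> carrier T" for t t'
    using J.a_rcos_sum[OF that] by (simp add: B_def FactRing_def)
  have multB: "(J +>\<^bsub>T\<^esub> t) \<otimes>\<^bsub>B\<^esub> (J +>\<^bsub>T\<^esub> t') = J +>\<^bsub>T\<^esub> (t \<otimes>\<^bsub>T\<^esub> t')" if "t \<in> carrier T" "t' \<in> carrier T" for t t'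
    using J.rcoset_mult_add[OF that] by (simp add: B_def FactRing_def)
  have addS: "(I +>\<^bsub>S\<^esub> t) \<oplus>\<^bsub>S Quot I\<^esub> (I +>\<^bsub>S\<^esub> t') = I +>\<^bsub>S\<^esub> (t \<oplus>\<^bsub>S\<^esub> t')" if "t \<in> carrier S" "t' \<in> carrier S" for t t'
    using I.a_rcos_sum[OF that] by (simp add: FactRing_def)
  have multS: "(I +>\<^bsub>S\<^esub> t) \<otimes>\<^bsub>S Quot I\<^esub> (I +>\<^bsub>S\<^esub> t') = I +>\<^bsub>S\<^esub> (t \<otimes>\<^bsub>S\<^esub> t')" if "t \<in> carrier S" "t' \<in> carrier S" for t t'
    using I.rcoset_mult_add[OF that] by (simp add: FactRing_def)
  have oneS: "\<one>\<^bsub>S Quot I\<^esub> = I +>\<^bsub>S\<^esub> \<one>\<^bsub>S\<^esub>" by (simp add: FactRing_def)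
  have ST: "s \<in> carrier S \<Longrightarrow> s \<in> carrier T" for s using sub by blast
  show "Module.algebra (S Quot I) B"
  proof (rule algebraI)
    show "cring (S Quot I)" by (rule I.quotient_is_cring[OF S])
    show "cring B" unfolding B_def by (rule with_smult_cring[OF TJ.cring_axioms])
  next
    fix a x assume "a \<in> carrier (S Quot I)" "x \<in> carrier B"
    then obtain s t where st: "s \<in> carrier S" "a = I +>\<^bsub>S\<^esub> s" "t \<in> carrier T" "x = J +>\<^bsub>T\<^esub> t"
      using repS[of a] repT[of x] by blast
    show "a \<odot>\<^bsub>B\<^esub> x \<in> carrier B" unfolding st(2,4) by (simp add: act st inB ST)
    show "(a \<oplus>\<^bsub>S Quot I\<^esub> b) \<odot>\<^bsub>B\<^esub> x = a \<odot>\<^bsub>B\<^esub> x \<oplus>\<^bsub>B\<^esub> b \<odot>\<^bsub>B\<^esub> x" 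
      "(a \<otimes>\<^bsub>S Quot I\<^esub> b) \<odot>\<^bsub>B\<^esub> x = a \<odot>\<^bsub>B\<^esub> (b \<odot>\<^bsub>B\<^esub> x)" if b: "b \<in> carrier (S Quot I)" for b
    proof -
      obtain s' where s': "s' \<in> carrier S" "b = I +>\<^bsub>S\<^esub> s'" using repS[OF b] by blast
      have cS: "s \<oplus>\<^bsub>T\<^esub> s' \<in> carrier S" "s \<otimes>\<^bsub>T\<^esub> s' \<in> carrier S" using S.a_closed[OF st(1) s'(1)] S.m_closed[OF st(1) s'(1)] by (simp_all add: ops)
      show "(a \<oplus>\<^bsub>S Quot I\<^esub> b) \<odot>\<^bsub>B\<^esub> x = a \<odot>\<^bsub>B\<^esub> x \<oplus>\<^bsub>B\<^esub> b \<odot>\<^bsub>B\<^esub> x"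
        unfolding st(2,4) s'(2) using st(1,3) s'(1) cS by (simp add: act addS addB ops T.l_distr ST)
      show "(a \<otimes>\<^bsub>S Quot I\<^esub> b) \<odot>\<^bsub>B\<^esub> x = a \<odot>\<^bsub>B\<^esub> (b \<odot>\<^bsub>B\<^esub> x)"
        unfolding st(2,4) s'(2) using st(1,3) s'(1) cS by (simp add: act multS ops T.m_assoc ST)
    qed
    show "a \<odot>\<^bsub>B\<^esub> (x \<oplus>\<^bsub>B\<^esub> y) = a \<odot>\<^bsub>B\<^esub> x \<oplus>\<^bsub>B\<^esub> a \<odot>\<^bsub>B\<^esub> y"
      "a \<odot>\<^bsub>B\<^esub> x \<otimes>\<^bsub>B\<^esub> y = a \<odot>\<^bsub>B\<^esub> (x \<otimes>\<^bsub>B\<^esub> y)" if y: "y \<in> carrier B" for y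
    proof -
      obtain t' where t': "t' \<in> carrier T" "y = J +>\<^bsub>T\<^esub> t'" using repT[OF y] by blast
      show "a \<odot>\<^bsub>B\<^esub> (x \<oplus>\<^bsub>B\<^esub> y) = a \<odot>\<^bsub>B\<^esub> x \<oplus>\<^bsub>B\<^esub> a \<odot>\<^bsub>B\<^esub> y"
        unfolding st(2,4) t'(2) using st(1,3) t'(1) by (simp add: act addB T.r_distr ST)
      show "a \<odot>\<^bsub>B\<^esub> x \<otimes>\<^bsub>B\<^esub> y = a \<odot>\<^bsub>B\<^esub> (x \<otimes>\<^bsub>B\<^esub> y)"
        unfolding st(2,4) t'(2) using st(1,3) t'(1) by (simp add: act multB T.m_assoc ST)
    qed
  next
    fix x assume "x \<in> carrier B"
    then obtain t where t: "t \<in> carrier T" "x = J +>\<^bsub>T\<^esub> t" using repT by blast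
    have "\<one>\<^bsub>T\<^esub> \<in> carrier S" using S.one_closed by (simp add: ops)
    then show "\<one>\<^bsub>S Quot I\<^esub> \<odot>\<^bsub>B\<^esub> x = x" unfolding t(2) oneS using t(1) by (simp add: act ops)
  qed
qed

lemma native_Fq: "native_cring (ring_of_type_algebra :: 'q::field ring)"
  unfolding native_cring_def ring_of_type_algebra_def
  using cring_from_type_algebra[where ?'a = 'q, unfolded ring_of_type_algebra_def] by simp

lemma carrier_Fq [simp]: "carrier ring_of_type_algebra = UNIV"
  by (simp add: ring_of_type_algebra_def)

text \<open>The interface between geometry and algebra. Beyond the degenerate product, the
  deformation ring needs that \<open>m\<close> takes values among the exponents of \<Lambda> and
  that W restricted to the graph of \<open>m\<close> is the weight \<open>w\<close>.\<close>

locale deformation = degenerate_monoid_algebra "Mmon f \<mu>" "mexp f \<mu> \<phi>" "wdeg f \<mu>"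
  for f :: "(int ^ 'n) \<Rightarrow>\<^sub>0 'q::field" and \<mu> :: "int ^ 'n" and \<phi> :: "(real ^ 'n) set \<Rightarrow> int ^ 'n" +
  fixes l :: "real ^ 'n \<Rightarrow> real"
  assumes Den_pos: "Den f \<mu> \<phi> > 0" and mexp_exps: "v \<in> Mmon f \<mu> \<Longrightarrow> mexp f \<mu> \<phi> v \<in> exps (Den f \<mu> \<phi>)"
    and Wdeg_eq: "v \<in> Mmon f \<mu> \<Longrightarrow> Wdeg l \<mu> (mexp f \<mu> \<phi> v, v) = wdeg f \<mu> v"
begin

abbreviation "Mm \<equiv> Mmon f \<mu>"
abbreviation "mx \<equiv> mexp f \<mu> \<phi>"
abbreviation "dn \<equiv> Den f \<mu> \<phi>"
abbreviation "T \<equiv> Tring f \<mu> \<phi>"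
abbreviation "S \<equiv> Sring f \<mu> \<phi>"
abbreviation "I \<equiv> mm f \<mu> \<phi>"
abbreviation "J \<equiv> mT f \<mu> \<phi>"
abbreviation "Et \<equiv> Mtilde f \<mu> \<phi>"

lemma exps_add: "r \<in> exps dn \<Longrightarrow> s \<in> exps dn \<Longrightarrow> r + s \<in> exps dn"
proof -
  assume "r \<in> exps dn" "s \<in> exps dn"
  then obtain i j where "r = real i / real dn" "s = real j / real dn" by (auto simp: exps_def)
  then have "r + s = real (i + j) / real dn" by (simp add: add_divide_distrib)
  then show ?thesis unfolding exps_def by blast
qed

lemma exps_zero: "0 \<in> exps dn"
  by (auto simp: exps_def intro: exI[of _ 0])

lemma exps_nonneg: "r \<in> exps dn \<Longrightarrow> r \<ge> 0"
  by (auto simp: exps_def)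

lemma exps_unit: "1 / real dn \<in> exps dn"
  by (auto simp: exps_def intro: exI[of _ 1])

text \<open>Exponents are multiples of 1/D, so a strict inequality leaves room for a full step
  1/D.\<close>

lemma exps_pred:
  assumes "r \<in> exps dn" "s \<in> exps dn" "s < r"
  shows "r - 1 / real dn \<in> exps dn" "s \<le> r - 1 / real dn"
proof -
  from assms obtain i j where ij: "r = real i / real dn" "s = real j / real dn" by (auto simp: exps_def)
  have "j < i" using assms(3) Den_pos unfolding ij by (simp add: divide_less_cancel)
  then have "r - 1 / real dn = real (i - 1) / real dn" by (simp add: ij diff_divide_distrib of_nat_diff)
  moreover have "j \<le> i - 1" using \<open>j < i\<close> by simp
  ultimately show "r - 1 / real dn \<in> exps dn" "s \<le> r - 1 / real dn"
    unfolding ij by (auto simp: exps_def intro!: divide_right_mono)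
qed

lemma Et_iff: "(r, v) \<in> Et \<longleftrightarrow> r \<in> exps dn \<and> v \<in> Mm \<and> mx v \<le> r"
  by (simp add: Mtilde_def)

lemma Et_zero: "0 \<in> Et"
  by (simp add: zero_prod_def Et_iff exps_zero zero_mem m_zero)

lemma Et_add: "u \<in> Et \<Longrightarrow> v \<in> Et \<Longrightarrow> u + v \<in> Et"
  using m_add by (cases u; cases v) (fastforce simp: Et_iff exps_add add_mem)

lemma T_eq: "T = monoid_algebra (carrier Fq) Et"
  by (simp add: Tring_def)

lemma S_eq: "S = monoid_algebra (carrier Fq) (exps dn \<times> {0})"
  by (simp add: Sring_def)

lemma Se_zero: "0 \<in> exps dn \<times> {0 :: int ^ 'n}"
  by (simp add: zero_prod_def exps_zero)

lemma Se_add: "u \<in> exps dn \<times> {0 :: int ^ 'n} \<Longrightarrow> v \<in> exps dn \<times> {0} \<Longrightarrow> u + v \<in> exps dn \<times> {0}"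
  by (auto simp: exps_add)

lemma Se_sub: "exps dn \<times> {0} \<subseteq> Et"
  using exps_nonneg by (auto simp: Et_iff zero_mem m_zero)

lemma T_algebra: "Module.algebra Fq T"
  unfolding T_eq by (rule monoid_algebra_algebra[OF native_Fq Et_zero Et_add])

lemma S_algebra: "Module.algebra Fq S"
  unfolding S_eq by (rule monoid_algebra_algebra[OF native_Fq Se_zero Se_add])

sublocale T: Module.algebra Fq T by (rule T_algebra)
sublocale S: Module.algebra Fq S by (rule S_algebra)

text \<open>\<open>Vs\<close> and \<open>Vt\<close> will be the exponents of the monomials in the
  maximal ideal of \<open>S\<close> and in the ideal it generates in \<open>T\<close>;
  \<open>Vt\<close> is the part of \<open>Et\<close> strictly above the graph of
  \<open>m\<close>.\<close>

definition "Vs = {r \<in> exps dn. r > 0} \<times> {0 :: int ^ 'n}"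
definition "Vt = {(r, v) \<in> Et. mx v < r}"

lemma I_eq: "I = {P \<in> carrier S. keys P \<subseteq> Vs}"
  unfolding mm_def S_eq
proof (rule genideal_monoid_algebra[OF native_Fq Se_zero Se_add])
  show "Vs \<subseteq> exps dn \<times> {0}" by (auto simp: Vs_def)
  show "u + v \<in> Vs" if "u \<in> Vs" "v \<in> exps dn \<times> {0}" for u v
    using that exps_nonneg by (auto simp: Vs_def exps_add add_pos_nonneg)
  show "{tmono (1 / real dn) 0} \<subseteq> carrier (monoid_algebra (carrier Fq) (exps dn \<times> {0}))"
    using exps_unit by simp
  show "keys P \<subseteq> Vs" if "P \<in> {tmono (1 / real dn) 0}" for P :: "(real \<times> (int ^ 'n)) \<Rightarrow>\<^sub>0 'q"
    using that exps_unit Den_pos by (simp add: Vs_def)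
  show "\<exists>g e. single g 1 \<in> {tmono (1 / real dn) 0 :: (real \<times> (int ^ 'n)) \<Rightarrow>\<^sub>0 'q} \<and> e \<in> exps dn \<times> {0} \<and> v = g + e" if v: "v \<in> Vs" for v
  proof -
    obtain r where r: "v = (r, 0)" "r \<in> exps dn" "r > 0" using v by (auto simp: Vs_def)
    then show ?thesis using exps_pred[OF r(2) exps_zero r(3)]
      by (intro exI[of _ "(1 / real dn, 0)"] exI[of _ "(r - 1 / real dn, 0)"]) simp
  qed
qed

lemma tmono_in_I: "tmono (1 / real dn) 0 \<in> I"
  unfolding I_eq S_eq using exps_unit Den_pos by (auto simp: Vs_def lookup_single when_def)

text \<open>A monomial of \<open>T\<close> strictly above the graph of \<open>m\<close> is
  \<Lambda>^(1/D) times another monomial of \<open>T\<close>, because lowering its exponent by 1/D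
  cannot pass below the graph. Conversely, subadditivity of \<open>m\<close> makes \<open>Vt\<close>
  stable under adding elements of \<open>Et\<close>.\<close>

lemma J_eq: "J = {P \<in> carrier T. keys P \<subseteq> Vt}"
  unfolding mT_def T_eq
proof (rule genideal_monoid_algebra[OF native_Fq Et_zero Et_add])
  show "Vt \<subseteq> Et" by (auto simp: Vt_def)
  show "u + v \<in> Vt" if "u \<in> Vt" "v \<in> Et" for u v
    using that Et_add[of u v] m_add[of "snd u" "snd v"] by (cases u; cases v) (fastforce simp: Vt_def Et_iff)
  show "I \<subseteq> carrier (monoid_algebra (carrier Fq) Et)"
    using Se_sub by (auto simp: I_eq S_eq)
  show "keys P \<subseteq> Vt" if "P \<in> I" for P
  proof -
    have "Vs \<subseteq> Vt" using Se_sub by (auto simp: Vs_def Vt_def m_zero)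
    then show ?thesis using that by (auto simp: I_eq)
  qed
  show "\<exists>g e. single g 1 \<in> I \<and> e \<in> Et \<and> v = g + e" if v: "v \<in> Vt" for v
  proof -
    obtain r u where r: "v = (r, u)" "r \<in> exps dn" "u \<in> Mm" "mx u < r" using v by (auto simp: Vt_def Et_iff)
    then show ?thesis using exps_pred[OF r(2) mexp_exps[OF r(3)] r(4)] tmono_in_I
      by (intro exI[of _ "(1 / real dn, 0)"] exI[of _ "(r - 1 / real dn, u)"]) (simp add: Et_iff)
  qed
qed

lemma I_ideal: "ideal I S"
  unfolding mm_def using exps_unit by (intro S.genideal_ideal) (simp add: S_eq)

lemma IJ: "I \<subseteq> J"
  unfolding mT_def by (rule T.genideal_self) (use Se_sub in \<open>auto simp: I_eq S_eq T_eq\<close>)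

lemma I_sub: "I \<subseteq> carrier T"
  using Se_sub by (auto simp: I_eq S_eq T_eq)

lemma J_ideal: "ideal J T"
  unfolding mT_def by (rule T.genideal_ideal[OF I_sub])

sublocale I: ideal I S by (rule I_ideal)
sublocale J: ideal J T by (rule J_ideal)

text \<open>Modulo the positive powers of \<Lambda> every element of \<open>S\<close> equals its
  constant term, and a constant is congruent to 0 only if it is 0.\<close>

lemma resid_iso: "resid f \<mu> \<phi> \<in> ring_iso Fq (S Quot I)"
proof -
  have sg: "single 0 c \<in> carrier S" for c :: 'q
    using single_in_monoid_algebra[OF Se_zero, of c UNIV] by (simp add: S_eq)
  have "resid f \<mu> \<phi> \<in> ring_hom Fq (S Quot I)"
  proof (rule ring_hom_memI)
    show "resid f \<mu> \<phi> c \<in> carrier (S Quot I)" for c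
      using sg[of c] by (auto simp: resid_def FactRing_def A_RCOSETS_def' a_r_coset_def')
    show "resid f \<mu> \<phi> (c \<otimes>\<^bsub>Fq\<^esub> c') = resid f \<mu> \<phi> c \<otimes>\<^bsub>S Quot I\<^esub> resid f \<mu> \<phi> c'" for c c'
      using I.rcoset_mult_add[OF sg sg, of c c'] by (simp add: resid_def FactRing_def native_cringD[OF native_Fq] S_eq mult_single)
    show "resid f \<mu> \<phi> (c \<oplus>\<^bsub>Fq\<^esub> c') = resid f \<mu> \<phi> c \<oplus>\<^bsub>S Quot I\<^esub> resid f \<mu> \<phi> c'" for c c'
      using I.a_rcos_sum[OF sg sg, of c c'] by (simp add: resid_def FactRing_def native_cringD[OF native_Fq] S_eq single_add)
    show "resid f \<mu> \<phi> \<one>\<^bsub>Fq\<^esub> = \<one>\<^bsub>S Quot I\<^esub>"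
      by (simp add: resid_def FactRing_def native_cringD[OF native_Fq] S_eq)
  qed
  moreover have "inj (resid f \<mu> \<phi>)"
  proof (rule injI)
    fix c c' assume "resid f \<mu> \<phi> c = resid f \<mu> \<phi> c'"
    then have "single 0 c \<in> I +>\<^bsub>S\<^esub> single 0 c'" using I.a_rcos_self[OF sg] by (auto simp: resid_def)
    then obtain i where i: "i \<in> I" "single 0 c = i + single 0 c'" by (auto simp: a_r_coset_def' S_eq)
    have "keys i \<subseteq> Vs" using i(1) unfolding I_eq by blast
    moreover have "0 \<notin> Vs" by (simp add: Vs_def zero_prod_def)
    ultimately have "lookup i 0 = 0" by (metis in_keys_iff subsetD)
    then show "c = c'" using arg_cong[OF i(2), of "\<lambda>P. lookup P 0"] by (simp add: lookup_add)
  qed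
  moreover have "\<exists>c. x = resid f \<mu> \<phi> c" if "x \<in> carrier (S Quot I)" for x
  proof -
    from that obtain P where P: "P \<in> carrier S" "x = I +>\<^bsub>S\<^esub> P" by (auto simp: FactRing_def A_RCOSETS_def' a_r_coset_def')
    define c where "c = lookup P 0"
    have "P - single 0 c \<in> I"
    proof -
      have "P - single 0 c \<in> carrier S"
        using native_cring_closed(6)[OF monoid_algebra_algebra(2)[OF native_Fq Se_zero Se_add]] P(1) sg[of c] unfolding S_eq by blast
      moreover have "keys (P - single 0 c) \<subseteq> Vs"
      proof
        fix e assume e: "e \<in> keys (P - single 0 c)"
        then have "e \<in> exps dn \<times> {0}" using calculation unfolding S_eq by auto
        then obtain r where r: "e = (r, 0)" "r \<in> exps dn" by auto
        have "lookup (P - single 0 c) 0 = 0" by (simp add: lookup_minus c_def)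
        then have "e \<noteq> 0" using e by (auto simp: in_keys_iff)
        then have "r \<noteq> 0" using r(1) by (simp add: zero_prod_def)
        then show "e \<in> Vs" using r exps_nonneg[OF r(2)] by (simp add: Vs_def)
      qed
      ultimately show ?thesis unfolding I_eq by blast
    qed
    moreover have "P = (P - single 0 c) \<oplus>\<^bsub>S\<^esub> single 0 c" by (simp add: S_eq)
    ultimately have "P \<in> I +>\<^bsub>S\<^esub> single 0 c" unfolding a_r_coset_def' by blast
    from I.a_repr_independence'[OF this sg] show ?thesis using P(2) unfolding resid_def by blast
  qed
  ultimately show ?thesis
    unfolding ring_iso_def bij_betw_def using ring_hom_memE(1) by (fastforce simp: inj_on_def)
qed

lemma resid_algebra:
  "s \<in> carrier S \<Longrightarrow> t \<in> carrier T \<Longrightarrow> (I +>\<^bsub>S\<^esub> s) \<odot>\<^bsub>Tbar_resid f \<mu> \<phi>\<^esub> (J +>\<^bsub>T\<^esub> t) = J +>\<^bsub>T\<^esub> (s * t)"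
  "Module.algebra (S Quot I) (Tbar_resid f \<mu> \<phi>)"
proof -
  have sub: "carrier S \<subseteq> carrier T" using Se_sub by (auto simp: S_eq T_eq)
  have B: "Tbar_resid f \<mu> \<phi> = with_smult (T Quot J) (\<lambda>x y. \<Union>s\<in>x. \<Union>t\<in>y. J +>\<^bsub>T\<^esub> (s \<otimes>\<^bsub>T\<^esub> t))"
    by (simp add: Tbar_resid_def T_eq)
  note q = quotient_algebra[OF T.M_cring S.M_cring sub _ _ _ I_ideal J_ideal IJ, folded B]
  show "s \<in> carrier S \<Longrightarrow> t \<in> carrier T \<Longrightarrow> (I +>\<^bsub>S\<^esub> s) \<odot>\<^bsub>Tbar_resid f \<mu> \<phi>\<^esub> (J +>\<^bsub>T\<^esub> t) = J +>\<^bsub>T\<^esub> (s * t)"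
    using q(1)[of s t] by (simp add: S_eq T_eq)
  show "Module.algebra (S Quot I) (Tbar_resid f \<mu> \<phi>)" by (rule q(2)) (simp_all add: S_eq T_eq)
qed

lemma Tbar_algebra: "Module.algebra Fq (Tbar f \<mu> \<phi>)"
proof -
  have "Tbar f \<mu> \<phi> = with_smult (Tbar_resid f \<mu> \<phi>) (\<lambda>c y. resid f \<mu> \<phi> c \<odot>\<^bsub>Tbar_resid f \<mu> \<phi>\<^esub> y)"
    by (simp add: Tbar_def Tbar_resid_def with_smult_def)
  then show ?thesis
    using restrict_scalars_algebra[OF resid_algebra(2) native_cringD(1)[OF native_Fq], of "resid f \<mu> \<phi>"] resid_iso
    by (simp add: ring_iso_def)
qed

sublocale Tb: Module.algebra Fq "Tbar f \<mu> \<phi>" by (rule Tbar_algebra)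

lemma Tbar_ops:
  "x \<in> carrier (Tbar f \<mu> \<phi>) \<longleftrightarrow> (\<exists>t\<in>carrier T. x = J +>\<^bsub>T\<^esub> t)"
  "t \<in> carrier T \<Longrightarrow> t' \<in> carrier T \<Longrightarrow> (J +>\<^bsub>T\<^esub> t) \<oplus>\<^bsub>Tbar f \<mu> \<phi>\<^esub> (J +>\<^bsub>T\<^esub> t') = J +>\<^bsub>T\<^esub> (t + t')"
  "t \<in> carrier T \<Longrightarrow> t' \<in> carrier T \<Longrightarrow> (J +>\<^bsub>T\<^esub> t) \<otimes>\<^bsub>Tbar f \<mu> \<phi>\<^esub> (J +>\<^bsub>T\<^esub> t') = J +>\<^bsub>T\<^esub> (t * t')"
  "\<one>\<^bsub>Tbar f \<mu> \<phi>\<^esub> = J +>\<^bsub>T\<^esub> 1"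
  "t \<in> carrier T \<Longrightarrow> c \<odot>\<^bsub>Tbar f \<mu> \<phi>\<^esub> (J +>\<^bsub>T\<^esub> t) = J +>\<^bsub>T\<^esub> (single 0 c * t)"
proof -
  show "x \<in> carrier (Tbar f \<mu> \<phi>) \<longleftrightarrow> (\<exists>t\<in>carrier T. x = J +>\<^bsub>T\<^esub> t)"
    by (auto simp: Tbar_def FactRing_def A_RCOSETS_def' a_r_coset_def')
  show "t \<in> carrier T \<Longrightarrow> t' \<in> carrier T \<Longrightarrow> (J +>\<^bsub>T\<^esub> t) \<oplus>\<^bsub>Tbar f \<mu> \<phi>\<^esub> (J +>\<^bsub>T\<^esub> t') = J +>\<^bsub>T\<^esub> (t + t')"
    using J.a_rcos_sum[of t t'] by (simp add: Tbar_def FactRing_def T_eq)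
  show "t \<in> carrier T \<Longrightarrow> t' \<in> carrier T \<Longrightarrow> (J +>\<^bsub>T\<^esub> t) \<otimes>\<^bsub>Tbar f \<mu> \<phi>\<^esub> (J +>\<^bsub>T\<^esub> t') = J +>\<^bsub>T\<^esub> (t * t')"
    using J.rcoset_mult_add[of t t'] by (simp add: Tbar_def FactRing_def T_eq)
  show "\<one>\<^bsub>Tbar f \<mu> \<phi>\<^esub> = J +>\<^bsub>T\<^esub> 1" by (simp add: Tbar_def FactRing_def T_eq)
  have "single 0 c \<in> carrier S"
    using single_in_monoid_algebra[OF Se_zero, of c UNIV] by (simp add: S_eq)
  then show "t \<in> carrier T \<Longrightarrow> c \<odot>\<^bsub>Tbar f \<mu> \<phi>\<^esub> (J +>\<^bsub>T\<^esub> t) = J +>\<^bsub>T\<^esub> (single 0 c * t)"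
    using resid_algebra(1)[of "single 0 c" t] by (simp add: Tbar_def resid_def)
qed

section \<open>Coordinates along the graph of \<open>m\<close>\<close>

definition coord :: "((real \<times> (int ^ 'n)) \<Rightarrow>\<^sub>0 'q) \<Rightarrow> ((int ^ 'n) \<Rightarrow>\<^sub>0 'q)" where
  "coord P = Poly_Mapping.map_key (\<lambda>v. (mx v, v)) P"

lemma inj_graph: "inj (\<lambda>v. (mx v, v))"
  by (auto simp: inj_def)

lemma lookup_coord: "lookup (coord P) v = lookup P (mx v, v)"
  by (simp add: coord_def map_key.rep_eq[OF inj_graph])

lemma coord_add: "coord (P + Q) = coord P + coord Q"
  by (rule poly_mapping_eqI) (simp add: lookup_coord lookup_add)

lemma coord_zero [simp]: "coord 0 = 0"
  by (rule poly_mapping_eqI) (simp add: lookup_coord)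

lemma coord_single: "coord (single (r, v) a) = (if r = mx v then single v a else 0)"
  by (rule poly_mapping_eqI) (auto simp: lookup_coord lookup_single when_def)

lemma coord_closed: "P \<in> carrier T \<Longrightarrow> coord P \<in> carrier (degenerate_algebra Fq)"
  by (auto simp: T_eq in_keys_iff lookup_coord Et_iff subset_iff)

text \<open>In m(u + v) \<le> m(u) + m(v) \<le> r + s the outer terms agree only if both
  inequalities are equalities. So a product of monomials lands on the graph of \<open>m\<close>
  exactly when both factors are on it and the pair is additive, which is the rule defining
  \<open>tmul\<close>.\<close>

lemma coord_mult:
  assumes P: "P \<in> carrier T" and Q: "Q \<in> carrier T"
  shows "coord (P * Q) = tmul (coord P) (coord Q)"
  using P[unfolded T_eq] native_Fq refl
proof (induction P rule: monoid_algebra_induct)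
  case (single e a)
  obtain r u where e: "e = (r, u)" by (cases e)
  show ?case using Q[unfolded T_eq] native_Fq refl
  proof (induction Q rule: monoid_algebra_induct)
    case (single e' b)
    obtain s v where e': "e' = (s, v)" by (cases e')
    have "u \<in> Mm" "v \<in> Mm" "mx u \<le> r" "mx v \<le> s" using single \<open>e \<in> Et\<close> by (simp_all add: e e' Et_iff)
    moreover from this have "mx (u + v) \<le> mx u + mx v" using m_add by blast
    ultimately show ?case
      by (auto simp: e e' mult_single coord_single tmul_single tterm_def)
  qed (simp_all add: distrib_left coord_add tmul_add_right)
qed (simp_all add: distrib_right coord_add tmul_add_left)

lemma coord_hom: "coord \<in> ring_hom T (degenerate_algebra Fq)"
  "linear_over Fq T (degenerate_algebra Fq) coord"
proof -
  have one: "coord 1 = 1"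
    using coord_single[of 0 0 1] by (simp add: m_zero flip: zero_prod_def)
  have single0: "coord (single 0 c) = single 0 c" for c
    using coord_single[of 0 0 c] by (simp add: m_zero zero_prod_def)
  show "coord \<in> ring_hom T (degenerate_algebra Fq)"
    by (rule ring_hom_memI) (use coord_closed coord_mult coord_add one in \<open>simp_all add: T_eq\<close>)
  have "single 0 c \<in> carrier T" for c
    using single_in_monoid_algebra[OF Et_zero, of c UNIV] by (simp add: T_eq)
  then show "linear_over Fq T (degenerate_algebra Fq) coord"
    unfolding linear_over_def using coord_closed coord_mult coord_add single0
    by (auto simp: T_eq single_mult_eq_tmul simp del: degenerate_algebra_simps(1) monoid_algebra_simps(1))
qed

text \<open>The exponents of \<open>T\<close> outside \<open>Vt\<close> are exactly the points on
  the graph of \<open>m\<close>, so vanishing along the graph means lying in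
  \<open>J\<close>.\<close>

lemma coord_eq_iff:
  assumes "P \<in> carrier T" "Q \<in> carrier T"
  shows "coord P = coord Q \<longleftrightarrow> J +>\<^bsub>T\<^esub> P = J +>\<^bsub>T\<^esub> Q"
proof -
  have d: "P - Q \<in> carrier T"
    using native_cring_closed(6)[OF monoid_algebra_algebra(2)[OF native_Fq Et_zero Et_add]] assms unfolding T_eq by blast
  have "P \<ominus>\<^bsub>T\<^esub> Q = P - Q"
    using native_a_minus[OF monoid_algebra_algebra(2)[OF native_Fq Et_zero Et_add]] assms by (simp add: a_minus_def T_eq)
  then have "J +>\<^bsub>T\<^esub> P = J +>\<^bsub>T\<^esub> Q \<longleftrightarrow> P - Q \<in> J"
    using T.quotient_eq_iff_same_a_r_cos[OF J_ideal assms] by simp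
  also have "\<dots> \<longleftrightarrow> keys (P - Q) \<subseteq> Vt" using d unfolding J_eq by blast
  also have "\<dots> \<longleftrightarrow> (\<forall>v. lookup (P - Q) (mx v, v) = 0)"
  proof
    assume "keys (P - Q) \<subseteq> Vt"
    then show "\<forall>v. lookup (P - Q) (mx v, v) = 0" by (auto simp: Vt_def in_keys_iff)
  next
    assume z: "\<forall>v. lookup (P - Q) (mx v, v) = 0"
    show "keys (P - Q) \<subseteq> Vt"
    proof
      fix e assume e: "e \<in> keys (P - Q)"
      then have "e \<in> Et" using d by (auto simp: T_eq)
      moreover obtain r v where "e = (r, v)" by (cases e)
      moreover have "r \<noteq> mx v" using z e calculation(2) by (auto simp: in_keys_iff)
      ultimately show "e \<in> Vt" by (auto simp: Vt_def Et_iff)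
    qed
  qed
  also have "\<dots> \<longleftrightarrow> coord P = coord Q"
    by (auto simp: poly_mapping_eq_iff fun_eq_iff lookup_coord lookup_minus)
  finally show ?thesis by simp
qed

lemma coord_surj:
  assumes "P \<in> carrier (degenerate_algebra Fq)"
  shows "\<exists>t\<in>carrier T. coord t = P"
  using assms[unfolded degenerate_algebra_simps] native_Fq refl
proof (induction P rule: monoid_algebra_induct)
  case zero
  then show ?case using T.M.zero_closed by (intro bexI[of _ 0]) (simp_all add: T_eq)
next
  case (single v a)
  then show ?case
    using mexp_exps by (intro bexI[of _ "single (mx v, v) a"]) (simp_all add: T_eq coord_single Et_iff)
next
  case (add P P')
  then obtain t t' where "t \<in> carrier T" "t' \<in> carrier T" "coord t = P" "coord t' = P'" by blast
  then show ?case using T.M.a_closed[of t t']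
    by (intro bexI[of _ "t + t'"]) (simp_all add: T_eq coord_add)
qed

definition coordbar :: "((real \<times> (int ^ 'n)) \<Rightarrow>\<^sub>0 'q) set \<Rightarrow> ((int ^ 'n) \<Rightarrow>\<^sub>0 'q)" where
  "coordbar x = the_elem (coord ` x)"

lemma coordbar_coset:
  assumes "t \<in> carrier T"
  shows "coordbar (J +>\<^bsub>T\<^esub> t) = coord t"
proof -
  have "coord t' = coord t" if t': "t' \<in> J +>\<^bsub>T\<^esub> t" for t'
  proof -
    have "t' \<in> carrier T" using t' J.a_subset assms by (auto simp: a_r_coset_def')
    then show ?thesis using coord_eq_iff[OF _ assms] J.a_repr_independence'[OF t' assms] by blast
  qed
  then have "coord ` (J +>\<^bsub>T\<^esub> t) = (\<lambda>_. coord t) ` (J +>\<^bsub>T\<^esub> t)"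
    by (rule image_cong[OF refl])
  also have "\<dots> = {coord t}" by (rule image_constant[OF J.a_rcos_self[OF assms]])
  finally have "coord ` (J +>\<^bsub>T\<^esub> t) = {coord t}" .
  then show ?thesis by (simp add: coordbar_def)
qed

lemma coordbar_iso:
  "coordbar \<in> ring_iso (Tbar f \<mu> \<phi>) (degenerate_algebra Fq)"
  "linear_over Fq (Tbar f \<mu> \<phi>) (degenerate_algebra Fq) coordbar"
proof -
  note cl = T.M.a_closed T.m_closed T.smult_closed
  have c: "t + t' \<in> carrier T" "t * t' \<in> carrier T" "single 0 a * t \<in> carrier T"
    if "t \<in> carrier T" "t' \<in> carrier T" for t t' a
    using that cl(1,2)[of t t'] cl(3)[of a t] by (simp_all add: T_eq)
  note ch = linear_overD[OF coord_hom(2)]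
  have sm: "coord (single 0 a * t) = single 0 a * coord t" if "t \<in> carrier T" for a t
    using ch(3)[of a t] that by (simp add: T_eq)
  have "coordbar \<in> ring_hom (Tbar f \<mu> \<phi>) (degenerate_algebra Fq)"
  proof (rule ring_hom_memI)
    show "coordbar \<one>\<^bsub>Tbar f \<mu> \<phi>\<^esub> = \<one>\<^bsub>degenerate_algebra Fq\<^esub>"
      using coordbar_coset[OF T.one_closed] ring_hom_memE(4)[OF coord_hom(1)] by (simp add: Tbar_ops T_eq)
  qed (auto simp: Tbar_ops coordbar_coset c coord_mult coord_add simp del: degenerate_algebra_simps(1) intro: coord_closed)
  moreover have "bij_betw coordbar (carrier (Tbar f \<mu> \<phi>)) (carrier (degenerate_algebra Fq))"
    unfolding bij_betw_def
  proof
    show "inj_on coordbar (carrier (Tbar f \<mu> \<phi>))"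
      by (rule inj_onI) (auto simp: Tbar_ops coordbar_coset coord_eq_iff)
    show "coordbar ` carrier (Tbar f \<mu> \<phi>) = carrier (degenerate_algebra Fq)"
    proof
      show "coordbar ` carrier (Tbar f \<mu> \<phi>) \<subseteq> carrier (degenerate_algebra Fq)"
        using ring_hom_memE(1)[OF calculation] by blast
      show "carrier (degenerate_algebra Fq) \<subseteq> coordbar ` carrier (Tbar f \<mu> \<phi>)"
      proof
        fix P :: "(int ^ 'n) \<Rightarrow>\<^sub>0 'q" assume "P \<in> carrier (degenerate_algebra Fq)"
        then obtain t where t: "t \<in> carrier T" "coord t = P" using coord_surj by blast
        then show "P \<in> coordbar ` carrier (Tbar f \<mu> \<phi>)"
          using coordbar_coset[OF t(1)] by (intro image_eqI[of _ _ "J +>\<^bsub>T\<^esub> t"]) (auto simp: Tbar_ops)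
      qed
    qed
  qed
  ultimately show "coordbar \<in> ring_iso (Tbar f \<mu> \<phi>) (degenerate_algebra Fq)"
    by (simp add: ring_iso_def)
  show "linear_over Fq (Tbar f \<mu> \<phi>) (degenerate_algebra Fq) coordbar"
    unfolding linear_over_def
  proof (intro conjI ballI Pi_I)
    show "coordbar x \<in> carrier (degenerate_algebra Fq)" if "x \<in> carrier (Tbar f \<mu> \<phi>)" for x
      using that coord_closed coordbar_coset unfolding Tbar_ops by metis
  qed (auto simp: Tbar_ops coordbar_coset c sm coord_add simp del: degenerate_algebra_simps(1))
qed

lemma mono_in_T: "v \<in> Mm \<Longrightarrow> tmono (mx v) v \<in> carrier T"
  using mexp_exps by (simp add: T_eq Et_iff)

lemma cls_in: "v \<in> Mm \<Longrightarrow> cls f \<mu> \<phi> v \<in> carrier (Tbar f \<mu> \<phi>)"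
  unfolding cls_def Tbar_ops using mono_in_T by blast

lemma coordbar_cls: "v \<in> Mm \<Longrightarrow> coordbar (cls f \<mu> \<phi> v) = single v 1"
  unfolding cls_def using coordbar_coset[OF mono_in_T] by (simp add: coord_single)

text \<open>\<open>Wdeg_eq\<close> turns the degree of a basis class into the weight of its
  monomial, so the pieces correspond to the homogeneous parts of the model.\<close>

lemma Tbar_grading_eq:
  "Tbar_grading f \<mu> \<phi> l i \<subseteq> carrier (Tbar f \<mu> \<phi>)"
  "coordbar ` Tbar_grading f \<mu> \<phi> l i = homogeneous_part Fq i"
proof -
  let ?B = "{cls f \<mu> \<phi> v | v. v \<in> Mm \<and> Wdeg l \<mu> (mx v, v) = i}"
  have B: "?B \<subseteq> carrier (Tbar f \<mu> \<phi>)" using cls_in by auto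
  show "Tbar_grading f \<mu> \<phi> l i \<subseteq> carrier (Tbar f \<mu> \<phi>)"
    unfolding Tbar_grading_def by (rule Tb.submoduleE(1)[OF Tb.lin_span_submodule[OF B]])
  have "coordbar ` ?B = {single v 1 | v. v \<in> Mm \<and> wdeg f \<mu> v = i}"
  proof
    show "coordbar ` ?B \<subseteq> {single v 1 | v. v \<in> Mm \<and> wdeg f \<mu> v = i}"
      using coordbar_cls Wdeg_eq by auto
    show "{single v 1 | v. v \<in> Mm \<and> wdeg f \<mu> v = i} \<subseteq> coordbar ` ?B"
    proof
      fix P :: "(int ^ 'n) \<Rightarrow>\<^sub>0 'q" assume "P \<in> {single v 1 | v. v \<in> Mm \<and> wdeg f \<mu> v = i}"
      then obtain v where v: "v \<in> Mm" "wdeg f \<mu> v = i" "P = single v 1" by blast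
      then have "cls f \<mu> \<phi> v \<in> ?B" using Wdeg_eq by blast
      then show "P \<in> coordbar ` ?B" using coordbar_cls[OF v(1)] v(3) by force
    qed
  qed
  then show "coordbar ` Tbar_grading f \<mu> \<phi> l i = homogeneous_part Fq i"
    unfolding Tbar_grading_def homogeneous_part_eq_lin_span[OF native_Fq]
    by (subst lin_span_image[OF Tb.module algebra.module[OF degenerate_algebra_algebra[OF native_Fq]] coordbar_iso(2) B]) simp
qed

lemma Tbar_graded: "graded_algebra Fq (Tbar f \<mu> \<phi>) (Tbar_grading f \<mu> \<phi> l)"
  by (rule graded_algebra_transport_inv[OF degenerate_algebra_graded[OF native_Fq] Tbar_algebra coordbar_iso Tbar_grading_eq])

lemma Tbar_basis: "family_basis Fq (Tbar f \<mu> \<phi>) Mm (cls f \<mu> \<phi>)"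
proof -
  interpret D: Module.algebra Fq "degenerate_algebra Fq" by (rule degenerate_algebra_algebra[OF native_Fq])
  have sum: "coordbar (\<Oplus>\<^bsub>Tbar f \<mu> \<phi>\<^esub>v\<in>F. c v \<odot>\<^bsub>Tbar f \<mu> \<phi>\<^esub> cls f \<mu> \<phi> v) = (\<Sum>v\<in>F. single v (c v))"
    if "F \<subseteq> Mm" for F c
  proof -
    have cl: "(\<lambda>v. c v \<odot>\<^bsub>Tbar f \<mu> \<phi>\<^esub> cls f \<mu> \<phi> v) \<in> F \<rightarrow> carrier (Tbar f \<mu> \<phi>)" using that cls_in by auto
    have tm: "coordbar (c v \<odot>\<^bsub>Tbar f \<mu> \<phi>\<^esub> cls f \<mu> \<phi> v) = single v (c v)" if "v \<in> F" for v
      using linear_overD(3)[OF coordbar_iso(2), of "c v" "cls f \<mu> \<phi> v"] cls_in coordbar_cls that \<open>F \<subseteq> Mm\<close>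
      by (auto simp: mult_single)
    have "coordbar (\<Oplus>\<^bsub>Tbar f \<mu> \<phi>\<^esub>v\<in>F. c v \<odot>\<^bsub>Tbar f \<mu> \<phi>\<^esub> cls f \<mu> \<phi> v) =
        finsum (degenerate_algebra Fq) (\<lambda>v. coordbar (c v \<odot>\<^bsub>Tbar f \<mu> \<phi>\<^esub> cls f \<mu> \<phi> v)) F"
      by (rule linear_over_finsum[OF Tb.module D.module coordbar_iso(2) cl])
    also have "\<dots> = (\<Sum>v\<in>F. coordbar (c v \<odot>\<^bsub>Tbar f \<mu> \<phi>\<^esub> cls f \<mu> \<phi> v))"
    proof (rule finsum_eq_sum)
      show "(\<lambda>v. coordbar (c v \<odot>\<^bsub>Tbar f \<mu> \<phi>\<^esub> cls f \<mu> \<phi> v)) \<in> F \<rightarrow> carrier (degenerate_algebra Fq)"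
        by (rule Pi_I, rule linear_overD(1)[OF coordbar_iso(2)]) (use cl in auto)
    qed (use D.abelian_monoid_axioms in simp_all)
    also have "\<dots> = (\<Sum>v\<in>F. single v (c v))" by (rule sum.cong) (simp_all add: tm)
    finally show ?thesis .
  qed
  have inj: "inj_on coordbar (carrier (Tbar f \<mu> \<phi>))"
    using coordbar_iso(1) unfolding ring_iso_def bij_betw_def by auto
  have in_Tb: "(\<Oplus>\<^bsub>Tbar f \<mu> \<phi>\<^esub>v\<in>F. c v \<odot>\<^bsub>Tbar f \<mu> \<phi>\<^esub> cls f \<mu> \<phi> v) \<in> carrier (Tbar f \<mu> \<phi>)" if "F \<subseteq> Mm" for F c
    by (rule Tb.M.finsum_closed) (use that cls_in in auto)
  show ?thesis
    unfolding family_basis_def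
  proof (intro conjI ballI allI impI)
    show "cls f \<mu> \<phi> \<in> Mm \<rightarrow> carrier (Tbar f \<mu> \<phi>)" using cls_in by auto
  next
    fix x assume x: "x \<in> carrier (Tbar f \<mu> \<phi>)"
    have k: "keys (coordbar x) \<subseteq> Mm" using linear_overD(1)[OF coordbar_iso(2) x] by simp
    \<comment> \<open>The coefficients of x are those of its image in the model; injectivity of
      \<open>coordbar\<close> gives the equality.\<close>
    have "x = (\<Oplus>\<^bsub>Tbar f \<mu> \<phi>\<^esub>v\<in>keys (coordbar x). lookup (coordbar x) v \<odot>\<^bsub>Tbar f \<mu> \<phi>\<^esub> cls f \<mu> \<phi> v)"
      by (rule inj_onD[OF inj _ x in_Tb[OF k]]) (simp add: sum[OF k] flip: poly_mapping_sum_single)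
    then show "\<exists>F c. finite F \<and> F \<subseteq> Mm \<and> c \<in> F \<rightarrow> carrier Fq \<and> x = (\<Oplus>\<^bsub>Tbar f \<mu> \<phi>\<^esub>i\<in>F. c i \<odot>\<^bsub>Tbar f \<mu> \<phi>\<^esub> cls f \<mu> \<phi> i)"
      using k by (intro exI[of _ "keys (coordbar x)"] exI[of _ "lookup (coordbar x)"]) simp
  next
    fix F c v assume F: "finite F \<and> F \<subseteq> Mm \<and> c \<in> F \<rightarrow> carrier Fq \<and> (\<Oplus>\<^bsub>Tbar f \<mu> \<phi>\<^esub>i\<in>F. c i \<odot>\<^bsub>Tbar f \<mu> \<phi>\<^esub> cls f \<mu> \<phi> i) = \<zero>\<^bsub>Tbar f \<mu> \<phi>\<^esub>"
      and v: "v \<in> F"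
    have "(\<Sum>v\<in>F. single v (c v)) = 0"
      using sum[of F c] F linear_over_zero[OF Tb.module D.module coordbar_iso(2)] by simp
    then have "0 = lookup (\<Sum>u\<in>F. single u (c u)) v" by simp
    also have "\<dots> = (\<Sum>u\<in>F. if u = v then c u else 0)"
      unfolding lookup_sum by (rule sum.cong) (auto simp: lookup_single when_def)
    also have "\<dots> = c v" using F v by simp
    finally show "c v = \<zero>\<^bsub>Fq\<^esub>" by (simp add: native_cringD[OF native_Fq])
  qed
qed

end

section \<open>The fibres over the algebraic closure\<close>

lemma linear_over_comp:
  assumes "linear_over k A B g" "linear_over k B C h"
  shows "linear_over k A C (h \<circ> g)"
  using assms unfolding linear_over_def by (auto simp: Pi_iff)

lemma Kset_closed:
  fixes lam \<kappa> :: "'q::field alg_closure"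
  shows "to_ac c \<in> Kset lam \<kappa>" "\<kappa> \<in> Kset lam \<kappa>" "0 \<in> Kset lam \<kappa>" "1 \<in> Kset lam \<kappa>"
    "x \<in> Kset lam \<kappa> \<Longrightarrow> y \<in> Kset lam \<kappa> \<Longrightarrow> x + y \<in> Kset lam \<kappa>"
    "x \<in> Kset lam \<kappa> \<Longrightarrow> y \<in> Kset lam \<kappa> \<Longrightarrow> x * y \<in> Kset lam \<kappa>"
    "x \<in> Kset lam \<kappa> \<Longrightarrow> - x \<in> Kset lam \<kappa>"
    "x \<in> Kset lam \<kappa> \<Longrightarrow> inverse x \<in> Kset lam \<kappa>"
    "x \<in> Kset lam \<kappa> \<Longrightarrow> x ^ n \<in> Kset lam \<kappa>"
proof -
  let ?R = "ring_of_type_algebra :: 'q alg_closure ring"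
  interpret field ?R by (rule field_from_type_algebra)
  have ops: "x \<otimes>\<^bsub>?R\<^esub> y = x * y" "x \<oplus>\<^bsub>?R\<^esub> y = x + y" "\<one>\<^bsub>?R\<^esub> = 1" "\<zero>\<^bsub>?R\<^esub> = 0" for x y
    by (simp_all add: native_cringD[OF native_Fq])
  have ainv: "\<ominus>\<^bsub>?R\<^esub> x = - x" for x by (simp add: native_a_minus[OF native_Fq])
  have minv: "inv\<^bsub>?R\<^esub> x = inverse x" if "x \<noteq> 0" for x
    by (rule comm_inv_char) (use that in \<open>simp_all add: ops\<close>)
  show one: "1 \<in> Kset lam \<kappa>" unfolding Kset_def using generate_field.one[of ?R] by (simp add: ops)
  show "to_ac c \<in> Kset lam \<kappa>" "\<kappa> \<in> Kset lam \<kappa>" for c unfolding Kset_def by (rule generate_field.incl; simp)+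
  show add: "x \<in> Kset lam \<kappa> \<Longrightarrow> y \<in> Kset lam \<kappa> \<Longrightarrow> x + y \<in> Kset lam \<kappa>" for x y
    unfolding Kset_def using generate_field.eng_add[of x ?R _ y] by (simp add: ops)
  show mult: "x \<in> Kset lam \<kappa> \<Longrightarrow> y \<in> Kset lam \<kappa> \<Longrightarrow> x * y \<in> Kset lam \<kappa>" for x y
    unfolding Kset_def using generate_field.eng_mult[of x ?R _ y] by (simp add: ops)
  show neg: "x \<in> Kset lam \<kappa> \<Longrightarrow> - x \<in> Kset lam \<kappa>" for x
    unfolding Kset_def using generate_field.a_inv[of x ?R] by (simp add: ainv)
  show zero: "0 \<in> Kset lam \<kappa>" using add[OF one neg[OF one]] by simp
  show "inverse x \<in> Kset lam \<kappa>" if "x \<in> Kset lam \<kappa>" for x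
  proof (cases "x = 0")
    \<comment> \<open>\<open>generate_field\<close> inverts only nonzero elements, while
      \<open>inverse 0\<close> is 0 by convention.\<close>
    case True
    then show ?thesis using zero by simp
  next
    case False
    then show ?thesis using that generate_field.m_inv[of x ?R] unfolding Kset_def by (simp add: minv ops)
  qed
  show "x ^ n \<in> Kset lam \<kappa>" if "x \<in> Kset lam \<kappa>" for x
    by (induction n) (use one mult that in simp_all)
qed

lemma KF_simps [simp]:
  "carrier (KF lam \<kappa>) = Kset lam \<kappa>" "s \<odot>\<^bsub>KF lam \<kappa>\<^esub> c = to_ac s * c"
  by (simp_all add: KF_def)

lemma native_KF: "native_cring (KF lam \<kappa>)"
  by (rule native_cringI) (use Kset_closed in \<open>auto simp: KF_def ring_of_type_algebra_def\<close>)

lemma KF_algebra: "Module.algebra Fq (KF lam \<kappa>)"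
  by (rule algebraI[OF native_cringD(1)[OF native_Fq] native_cringD(1)[OF native_KF]])
    (auto simp: native_cringD[OF native_Fq] native_cringD[OF native_KF] Kset_closed algebra_simps)

context deformation
begin

text \<open>\<open>real dn * r\<close> is a natural number for r in \<open>exps dn\<close>, so the
  floor in \<open>frac_pow\<close> is exact there.\<close>

lemma frac_pow_add:
  assumes "r \<in> exps dn" "s \<in> exps dn"
  shows "frac_pow \<kappa> dn (r + s) = frac_pow \<kappa> dn r * frac_pow \<kappa> dn s"
proof -
  from assms obtain i j where ij: "r = real i / real dn" "s = real j / real dn" by (auto simp: exps_def)
  have "real dn * (r + s) = real (i + j)" "real dn * r = real i" "real dn * s = real j"
    using Den_pos by (simp_all add: ij field_simps)
  then show ?thesis unfolding frac_pow_def by (simp only: floor_of_nat nat_int power_add)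
qed

text \<open>\<open>\<rho>\<close> identifies the model with the graded ring after rescaling
  monomials by \<kappa>^(D m(v)). The maps \<open>\<gamma>T\<close> and \<open>\<gamma>\<close> from
  the two base changes to the model are compatible with passing to cosets of \<open>J\<close>, so
  \<open>\<rho> \<circ> \<gamma>T\<close> serves as pr and \<open>\<rho> \<circ> \<gamma>\<close> as
  the induced isomorphism.\<close>

lemma fibre_iso:
  fixes lam \<kappa> :: "'q alg_closure"
  assumes \<kappa>: "\<kappa> \<noteq> 0"
  defines "K \<equiv> KF lam \<kappa>" and "QT \<equiv> base_change Fq T (KF lam \<kappa>)" and "Qb \<equiv> base_change Fq (Tbar f \<mu> \<phi>) (KF lam \<kappa>)"
    and "Gb \<equiv> base_change_grading Fq (Tbar f \<mu> \<phi>) (KF lam \<kappa>) (Tbar_grading f \<mu> \<phi> l)"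
  shows "graded_algebra K Qb Gb"
    and "graded_algebra K (Rbar f \<mu> lam \<kappa>) (Rbar_grading f \<mu> lam \<kappa>)"
    and "\<exists>pr. is_pr f \<mu> \<phi> lam \<kappa> pr"
    and "is_pr f \<mu> \<phi> lam \<kappa> pr \<Longrightarrow>
      \<exists>\<Psi>. graded_algebra_iso K Qb Gb (Rbar f \<mu> lam \<kappa>) (Rbar_grading f \<mu> lam \<kappa>) \<Psi> \<and>
        (\<forall>t\<in>carrier T. \<forall>c\<in>Kset lam \<kappa>.
           \<Psi> (pure_tensor Fq (Tbar f \<mu> \<phi>) K (J +>\<^bsub>T\<^esub> t) c) = pr (pure_tensor Fq T K t c))"
proof -
  let ?pT = "pure_tensor Fq T K" and ?pB = "pure_tensor Fq (Tbar f \<mu> \<phi>) K"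
  let ?D = "degenerate_algebra K" and ?Rb = "Rbar f \<mu> lam \<kappa>"
  have natK: "native_cring K" unfolding K_def by (rule native_KF)
  have algK: "Module.algebra Fq K" unfolding K_def by (rule KF_algebra)
  have cK: "carrier K = Kset lam \<kappa>" and smK: "s \<odot>\<^bsub>K\<^esub> c = to_ac s * c" for s c by (simp_all add: K_def)
  interpret W: weight_filtration Mm mx "wdeg f \<mu>" K by unfold_locales (rule natK)
  have RA: "Rring f \<mu> lam \<kappa> = monoid_algebra (carrier K) Mm" by (simp add: Rring_def cK)
  have RF: "RFil f \<mu> lam \<kappa> = weight_fil K"
    by (rule ext) (simp add: RFil_def weight_fil_def RA flip: K_def)
  have Rb: "?Rb = assoc_graded (monoid_algebra (carrier K) Mm) (weight_fil K)" by (simp add: Rbar_def RA RF)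
  have Rg: "Rbar_grading f \<mu> lam \<kappa> = assoc_graded_piece (monoid_algebra (carrier K) Mm) (weight_fil K)"
    by (simp add: Rbar_grading_def RA RF)
  show gR: "graded_algebra K ?Rb (Rbar_grading f \<mu> lam \<kappa>)"
    unfolding Rb Rg by (rule W.assoc_graded_graded)
  then interpret Rb: Module.algebra K ?Rb unfolding graded_algebra_def by auto
  define gc where "gc = (graded_class K :: ((int ^ 'n) \<Rightarrow>\<^sub>0 'q alg_closure) \<Rightarrow> _)"
  note gc_iso = W.graded_class_iso[folded gc_def Rb]
  note gc_lin = linear_overD[OF gc_iso(2)]
  have xbar: "xbar f \<mu> lam \<kappa> v = gc (single v 1)" for v
    by (simp add: xbar_def RA RF W.gr_class_single gc_def)
  define g where "g v = frac_pow \<kappa> dn (mx v)" for v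
  \<comment> \<open>The inverse factor is a power of \<open>inverse \<kappa>\<close>, which stays in
    the coefficient field.\<close>
  define g' where "g' v = frac_pow (inverse \<kappa>) dn (mx v)" for v
  have mx0: "mx 0 = 0" by (rule m_zero)
  note tw = twist_iso[of K g g', OF natK]
  have gK: "g v \<in> carrier K" "g' v \<in> carrier K" "g v * g' v = 1" for v
    using \<kappa> by (simp_all add: g_def g'_def frac_pow_def cK Kset_closed flip: power_mult_distrib)
  have g0: "g 0 = 1" by (simp add: g_def frac_pow_def mx0)
  have gadd: "g (u + v) = g u * g v" if "u \<in> Mm" "v \<in> Mm" "mx (u + v) = mx u + mx v" for u v
    unfolding g_def that(3) by (rule frac_pow_add[OF mexp_exps[OF that(1)] mexp_exps[OF that(2)]])
  define t where "t = Poly_Mapping.mapp (\<lambda>v a. g v * a)"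
  have t_iso: "t \<in> ring_iso ?D ?D" and t_lin: "linear_over K ?D ?D t" and t_hom: "t ` homogeneous_part K i = homogeneous_part K i" for i
    unfolding t_def using tw[OF gK g0 gadd] by blast+
  have t_single: "t (single v a) = single v (g v * a)" for v a
    unfolding t_def by (subst mapp_single) simp_all
  define \<rho> where "\<rho> = gc \<circ> t"
  have \<rho>_lin: "linear_over K ?D ?Rb \<rho>" unfolding \<rho>_def by (rule linear_over_comp[OF t_lin gc_iso(2)])
  have \<rho>_iso: "\<rho> \<in> ring_iso ?D ?Rb" unfolding \<rho>_def by (rule ring_iso_set_trans[OF t_iso gc_iso(1)])
  have \<rho>_hom: "\<rho> ` homogeneous_part K i = Rbar_grading f \<mu> lam \<kappa> i" for i
    unfolding \<rho>_def image_comp[symmetric] t_hom gc_def Rg by (rule W.graded_class_homogeneous)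
  have \<rho>0: "\<rho> 0 = \<zero>\<^bsub>?Rb\<^esub>" using linear_over_zero[OF W.D.module Rb.module \<rho>_lin] by simp
  have \<rho>_single: "\<rho> (single v a) = (a * g v) \<odot>\<^bsub>?Rb\<^esub> xbar f \<mu> lam \<kappa> v" if "v \<in> Mm" "a \<in> carrier K" for v a
  proof -
    have "single v 1 \<in> carrier ?D"
      using single_in_monoid_algebra[OF that(1), of 1 "carrier K"] native_cring_closed[OF natK] by simp
    then show ?thesis
      using gc_lin(3)[of "a * g v" "single v 1"] that gK native_cring_closed[OF natK]
      by (simp add: \<rho>_def t_single xbar mult_single mult.commute)
  qed
  have \<iota>: "to_ac (x + y) = to_ac x + to_ac y" "to_ac (x * y) = to_ac x * to_ac y" "to_ac 1 = 1" "to_ac x \<in> carrier K" for x y :: 'q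
    by (simp_all add: cK Kset_closed)
  let ?cm = "Poly_Mapping.mapp (\<lambda>_. to_ac) :: ((int ^ 'n) \<Rightarrow>\<^sub>0 'q) \<Rightarrow> ((int ^ 'n) \<Rightarrow>\<^sub>0 'q alg_closure)"
  obtain \<gamma>T where \<gamma>T: "\<gamma>T \<in> ring_hom QT ?D" "linear_over K QT ?D \<gamma>T"
    "\<And>a b. a \<in> carrier T \<Longrightarrow> b \<in> carrier K \<Longrightarrow> \<gamma>T (?pT a b) = single 0 b * ?cm (coord a)"
    unfolding QT_def K_def[symmetric]
    by (rule base_change_to_degenerate[OF native_Fq natK T_algebra algK \<iota> smK coord_hom]) auto
  obtain \<gamma> where \<gamma>: "\<gamma> \<in> ring_iso Qb ?D" "linear_over K Qb ?D \<gamma>"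
    "\<And>a b. a \<in> carrier (Tbar f \<mu> \<phi>) \<Longrightarrow> b \<in> carrier K \<Longrightarrow> \<gamma> (?pB a b) = single 0 b * ?cm (coordbar a)"
    "\<And>i. Gb i \<subseteq> carrier Qb" "\<And>i. \<gamma> ` Gb i = homogeneous_part K i"
    unfolding Qb_def Gb_def K_def[symmetric]
    by (rule base_change_degenerate_iso[OF native_Fq natK Tbar_algebra algK \<iota> smK coordbar_iso Tbar_grading_eq]) auto
  interpret TT: tensor_algebras Fq T K by (intro tensor_algebras.intro T_algebra algK)
  interpret TB: tensor_algebras Fq "Tbar f \<mu> \<phi>" K by (intro tensor_algebras.intro Tbar_algebra algK)
  have QT_alg: "Module.algebra K QT" unfolding QT_def K_def[symmetric] by (rule TT.base_change_algebra)
  have Qb_alg: "Module.algebra K Qb" unfolding Qb_def K_def[symmetric] by (rule TB.base_change_algebra)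
  interpret QT: Module.algebra K QT by (rule QT_alg)
  interpret Qb: Module.algebra K Qb by (rule Qb_alg)
  show "graded_algebra K Qb Gb"
    by (rule graded_algebra_transport_inv[OF degenerate_algebra_graded[OF natK] Qb_alg \<gamma>(1,2,4,5)])
  have oneK: "1 \<in> carrier K" by (rule native_cring_closed(2)[OF natK])
  have cm_single: "?cm (single v a) = single v (to_ac a)" for v a by (simp add: mapp_single[of "\<lambda>_. to_ac"])
  have cm0: "?cm 0 = 0" by (rule poly_mapping_eqI) (simp add: lookup_mapp)
  have cm_add: "?cm (P + P') = ?cm P + ?cm P'" for P P' by (rule mapp_add) simp_all
  show "\<exists>pr. is_pr f \<mu> \<phi> lam \<kappa> pr"
  proof
    have "linear_over K QT ?Rb (\<rho> \<circ> \<gamma>T)" by (rule linear_over_comp[OF \<gamma>T(2) \<rho>_lin])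
    moreover have "(\<rho> \<circ> \<gamma>T) (?pT (tmono r v) 1) =
        (if r = mx v then frac_pow \<kappa> dn (mx v) \<odot>\<^bsub>?Rb\<^esub> xbar f \<mu> lam \<kappa> v else \<zero>\<^bsub>?Rb\<^esub>)" if "(r, v) \<in> Et" for r v
    proof -
      have "tmono r v \<in> carrier T" using that by (simp add: T_eq)
      then have "\<gamma>T (?pT (tmono r v) 1) = (if r = mx v then single v 1 else 0)"
        using \<gamma>T(3)[OF _ oneK] by (simp add: coord_single cm_single cm0)
      then show ?thesis using that \<rho>_single[OF _ oneK, of v] \<rho>0 by (simp add: Et_iff g_def)
    qed
    ultimately show "is_pr f \<mu> \<phi> lam \<kappa> (\<rho> \<circ> \<gamma>T)"
      unfolding is_pr_def QT_def K_def[symmetric] by auto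
  qed
  show "\<exists>\<Psi>. graded_algebra_iso K Qb Gb ?Rb (Rbar_grading f \<mu> lam \<kappa>) \<Psi> \<and>
        (\<forall>t\<in>carrier T. \<forall>c\<in>Kset lam \<kappa>.
           \<Psi> (?pB (J +>\<^bsub>T\<^esub> t) c) = pr (?pT t c))" if "is_pr f \<mu> \<phi> lam \<kappa> pr"
  proof (intro exI[of _ "\<rho> \<circ> \<gamma>"] conjI ballI)
    show "graded_algebra_iso K Qb Gb ?Rb (Rbar_grading f \<mu> lam \<kappa>) (\<rho> \<circ> \<gamma>)"
      unfolding graded_algebra_iso_def
      by (intro conjI allI ring_iso_set_trans[OF \<gamma>(1) \<rho>_iso] linear_over_comp[OF \<gamma>(2) \<rho>_lin])
        (simp only: image_comp[symmetric] \<gamma>(5) \<rho>_hom)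
    have lin: "linear_over K QT ?Rb pr" and val: "\<And>r v. (r, v) \<in> Et \<Longrightarrow> pr (?pT (tmono r v) 1) =
        (if r = mx v then frac_pow \<kappa> dn (mx v) \<odot>\<^bsub>?Rb\<^esub> xbar f \<mu> lam \<kappa> v else \<zero>\<^bsub>?Rb\<^esub>)"
      using that unfolding is_pr_def QT_def K_def[symmetric] by auto
    note pl = linear_overD[OF lin]
    fix s c assume s: "s \<in> carrier T" and "c \<in> Kset lam \<kappa>"
    then have c: "c \<in> carrier K" by (simp add: cK)
    \<comment> \<open>The given pr is known only on monomials, so it is compared with the explicit
      map by induction on s.\<close>
    have "pr (?pT s c) = \<rho> (single 0 c * ?cm (coord s))"
      using s[unfolded T_eq] native_Fq refl
    proof (induction s rule: monoid_algebra_induct)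
      case zero
      have "?pT 0 c = \<zero>\<^bsub>QT\<^esub>"
      proof -
        have "0 \<odot>\<^bsub>T\<^esub> (0 :: (real \<times> (int ^ 'n)) \<Rightarrow>\<^sub>0 'q) = 0" "0 \<in> carrier T" using T.M.zero_closed by (simp_all add: T_eq)
        then have "?pT 0 c = ?pT 0 (0 \<odot>\<^bsub>K\<^esub> c)"
          using TT.pure_smult[of 0 0 c] c by simp
        also have "\<dots> = 0 \<odot>\<^bsub>QT\<^esub> ?pT 0 c"
          using TT.smult_pure[of 0 0 c] c \<open>0 \<in> carrier T\<close> native_cring_closed[OF natK]
          by (simp add: smK native_cringD[OF natK] QT_def flip: K_def)
        also have "\<dots> = \<zero>\<^bsub>QT\<^esub>"
          using QT.smult_l_null[of "?pT 0 c"] TT.pure_closed[OF \<open>0 \<in> carrier T\<close> c]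
          by (simp add: native_cringD[OF natK] QT_def flip: K_def)
        finally show ?thesis .
      qed
      then show ?case using linear_over_zero[OF QT.module Rb.module lin] \<rho>0 by (simp add: cm0)
    next
      case (single e a)
      obtain r v where e: "e = (r, v)" by (cases e)
      have E: "(r, v) \<in> Et" using single e by simp
      then have vM: "v \<in> Mm" by (simp add: Et_iff)
      have tm: "tmono r v \<in> carrier T" using E by (simp add: T_eq)
      have "single (r, v) a = a \<odot>\<^bsub>T\<^esub> tmono r v" by (simp add: T_eq mult_single)
      \<comment> \<open>The coefficient a crosses the tensor sign, and its product with c is then
        pulled out as a scalar of the base change.\<close>
      then have "?pT (single (r, v) a) c = ?pT (tmono r v) (to_ac a * c)"
        using TT.pure_smult[OF _ tm c, of a] by (simp add: smK)
      also have "\<dots> = (to_ac a * c) \<odot>\<^bsub>QT\<^esub> ?pT (tmono r v) 1"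
        using TT.smult_pure[OF _ tm oneK, of "to_ac a * c"] native_cring_closed(4)[OF natK \<iota>(4) c]
        by (simp add: native_cringD[OF natK] QT_def flip: K_def)
      finally have "pr (?pT (single (r, v) a) c) =
          (to_ac a * c) \<odot>\<^bsub>?Rb\<^esub> (if r = mx v then frac_pow \<kappa> dn (mx v) \<odot>\<^bsub>?Rb\<^esub> xbar f \<mu> lam \<kappa> v else \<zero>\<^bsub>?Rb\<^esub>)"
        using pl(3)[OF native_cring_closed(4)[OF natK \<iota>(4) c]] TT.pure_closed[OF tm oneK] val[OF E]
        by (simp add: QT_def flip: K_def)
      moreover have "xbar f \<mu> lam \<kappa> v \<in> carrier ?Rb"
        unfolding xbar using single_in_monoid_algebra[OF vM oneK] native_cring_closed(1)[OF natK] by (intro gc_lin(1)) simp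
      ultimately show ?case
        using native_cring_closed(4)[OF natK \<iota>(4) c] \<rho>_single[OF vM native_cring_closed(4)[OF natK c \<iota>(4)], of a] \<rho>0 gK(1)[of v]
          Rb.smult_assoc1[of "to_ac a * c" "frac_pow \<kappa> dn (mx v)" "xbar f \<mu> lam \<kappa> v"] Rb.smult_r_null
        by (auto simp: e coord_single cm_single cm0 mult_single g_def mult.commute native_cringD[OF natK])
    next
      case (add P P')
      have PT: "P \<in> carrier T" "P' \<in> carrier T" using add unfolding T_eq by blast+
      have cl: "single 0 c * ?cm (coord Q) \<in> carrier ?D" if "Q \<in> carrier T" for Q
        using linear_overD(1)[OF \<gamma>T(2), of "?pT Q c"] \<gamma>T(3)[OF that c] TT.pure_closed[OF that c]
        by (simp add: QT_def flip: K_def)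
      have "?pT (P + P') c = ?pT P c \<oplus>\<^bsub>QT\<^esub> ?pT P' c"
        using TT.pure_add_left[OF PT c] by (simp add: QT_def T_eq flip: K_def)
      then have "pr (?pT (P + P') c) = pr (?pT P c) \<oplus>\<^bsub>?Rb\<^esub> pr (?pT P' c)"
        using pl(2)[of "?pT P c" "?pT P' c"] TT.pure_closed[OF PT(1) c] TT.pure_closed[OF PT(2) c]
        by (simp add: QT_def flip: K_def)
      also have "\<dots> = \<rho> (single 0 c * ?cm (coord P) + single 0 c * ?cm (coord P'))"
        using linear_overD(2)[OF \<rho>_lin cl[OF PT(1)] cl[OF PT(2)]] add by simp
      finally show ?case by (simp add: coord_add cm_add distrib_left)
    qed
    moreover have "J +>\<^bsub>T\<^esub> s \<in> carrier (Tbar f \<mu> \<phi>)" using s Tbar_ops(1) by blast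
    ultimately show "(\<rho> \<circ> \<gamma>) (?pB (J +>\<^bsub>T\<^esub> s) c) = pr (?pT s c)"
      using \<gamma>(3)[OF _ c] coordbar_coset[OF s] by simp
  qed
qed

end

section \<open>Polyhedral geometry\<close>

lemma rvec_simps: "rvec 0 = 0" "rvec (u + v) = rvec u + rvec v" "rvec a \<bullet> rvec v = real_of_int (pairing a v)"
  by (simp_all add: rvec_def vec_eq_iff inner_vec_def pairing_def)

lemma finite_Gamma_one: "finite (Gamma_one f \<mu>)"
proof (rule finite_subset)
  show "Gamma_one f \<mu> \<subseteq> {F. F face_of Delta f}" by (auto simp: Gamma_one_def faces_codim2_def)
  show "finite {F. F face_of Delta f}"
    by (rule finite_polytope_faces) (auto simp: polytope_def Delta_def intro!: exI[of _ "insert 0 (rvec ` keys f)"])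
qed

locale newton_geometry =
  fixes f :: "(int ^ 'n) \<Rightarrow>\<^sub>0 'q::field" and \<mu> :: "int ^ 'n" and \<phi> :: "(real ^ 'n) set \<Rightarrow> int ^ 'n"
    and l :: "real ^ 'n \<Rightarrow> real"
  assumes full: "aff_dim (Delta f) = int CARD('n)" and lin: "linear l"
    and l_supp: "\<forall>u\<in>keys f. l (rvec u) = 1" and l_mu: "l (rvec \<mu>) < 1"
    and forms: "face_forms f \<phi>" and nz: "\<And>\<tau>. \<tau> \<in> Gamma_one f \<mu> \<Longrightarrow> pairing (\<phi> \<tau>) \<mu> \<noteq> 0"
begin

abbreviation "U \<equiv> rvec ` keys f"
abbreviation "z \<equiv> rvec \<mu>"
abbreviation "ph \<tau> \<equiv> rvec (\<phi> \<tau>)"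

text \<open>The vector representing \<open>l\<close>, used where hyperplanes and half-spaces are
  described by inner products.\<close>

definition "lv = adjoint l (1::real)"

lemma l_eq: "l x = lv \<bullet> x"
  using adjoint_works[OF lin, of x 1] by (simp add: lv_def inner_commute)

lemma l_add: "l (x + y) = l x + l y" and l_scale: "l (c *\<^sub>R x) = c * l x" and l_zero: "l 0 = 0" and l_diff: "l (x - y) = l x - l y"
  by (simp_all add: l_eq inner_right_distrib inner_diff_right)

lemma U_ne: "U \<noteq> {}"
proof
  assume "U = {}"
  then have "Delta f = {0}" by (simp add: Delta_def)
  then show False using full by simp
qed

lemma finite_U: "finite U" by simp

lemma Delta_convex: "convex (Delta f)" by (simp add: Delta_def)

lemma Delta_incl: "0 \<in> Delta f" "u \<in> U \<Longrightarrow> u \<in> Delta f"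
  unfolding Delta_def by (auto intro: hull_inc)

lemma hullU_l: "p \<in> convex hull U \<Longrightarrow> l p = 1"
proof -
  have "convex hull U \<subseteq> {x. lv \<bullet> x = 1}"
    by (rule hull_minimal) (use l_supp in \<open>auto simp: convex_hyperplane l_eq\<close>)
  then show "p \<in> convex hull U \<Longrightarrow> l p = 1" by (auto simp: l_eq)
qed

lemma hullU_Delta: "convex hull U \<subseteq> Delta f"
  unfolding Delta_def by (rule hull_mono) auto

text \<open>By quasihomogeneity the polytope is a pyramid with apex 0 over the hull of the support,
  on which \<open>l\<close> is 1. So \<open>l\<close> recovers the factor v.\<close>

lemma Delta_rep:
  assumes "y \<in> Delta f"
  obtains v p where "0 \<le> v" "v \<le> 1" "p \<in> convex hull U" "y = v *\<^sub>R p" "l y = v"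
proof -
  obtain a v p where "0 \<le> a" "0 \<le> v" "a + v = 1" "p \<in> convex hull U" "y = v *\<^sub>R p"
    using assms unfolding Delta_def convex_hull_insert[OF U_ne] by auto
  then show thesis using that[of v p] hullU_l[of p] by (simp add: l_scale)
qed

lemma Cone_rep:
  assumes "x \<in> Cone f"
  obtains p where "0 \<le> l x" "p \<in> convex hull U" "x = l x *\<^sub>R p"
proof -
  obtain c y where c: "0 \<le> c" "y \<in> Delta f" "x = c *\<^sub>R y"
    using assms unfolding Cone_def conic_hull_explicit by auto
  obtain v p where v: "0 \<le> v" "v \<le> 1" "p \<in> convex hull U" "y = v *\<^sub>R p" "l y = v"
    using Delta_rep[OF c(2)] .
  have "l x = c * v" using c v by (simp add: l_scale)
  then show thesis using that[of p] c v by simp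
qed

lemma Cone_eq: "Cone f = {x. \<forall>\<tau>\<in>faces_codim2 f. ph \<tau> \<bullet> x \<ge> 0}"
  using forms by (simp add: face_forms_def)

lemma Cone_add: "x \<in> Cone f \<Longrightarrow> y \<in> Cone f \<Longrightarrow> x + y \<in> Cone f"
  by (auto simp: Cone_eq inner_right_distrib)

lemma Cone_scale: "x \<in> Cone f \<Longrightarrow> 0 \<le> c \<Longrightarrow> c *\<^sub>R x \<in> Cone f"
  by (auto simp: Cone_eq)

lemma Delta_Cone: "x \<in> Delta f \<Longrightarrow> x \<in> Cone f"
  unfolding Cone_def by (rule hull_inc)

lemma Cone_zero: "0 \<in> Cone f"
  by (rule Delta_Cone[OF Delta_incl(1)])

lemma ph_nonneg: "\<tau> \<in> faces_codim2 f \<Longrightarrow> x \<in> Cone f \<Longrightarrow> ph \<tau> \<bullet> x \<ge> 0"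
  by (simp add: Cone_eq)

lemma Delta2_incl: "z \<in> Delta2 f \<mu>" "x \<in> Delta f \<Longrightarrow> x \<in> Delta2 f \<mu>"
  unfolding Delta2_def by (auto intro: hull_inc)

lemma Delta2_convex: "convex (Delta2 f \<mu>)"
  by (simp add: Delta2_def)

text \<open>\<open>Delta2 f \<mu>\<close> is the hull of 0, \<mu> and the support. A point of its
  b-fold dilate is s \<mu> + t p with s, t \<ge> 0, with p in the hull of the support and with s + t
  \<le> b, and t is read off as l(x - s \<mu>).\<close>

lemma scaled_Delta2_iff:
  assumes b: "0 \<le> b"
  shows "x \<in> (\<lambda>x. b *\<^sub>R x) ` Delta2 f \<mu> \<longleftrightarrow> (\<exists>s\<ge>0. x - s *\<^sub>R z \<in> Cone f \<and> l (x - s *\<^sub>R z) + s \<le> b)"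
proof
  assume "x \<in> (\<lambda>x. b *\<^sub>R x) ` Delta2 f \<mu>"
  then obtain y where y: "y \<in> Delta2 f \<mu>" "x = b *\<^sub>R y" by auto
  have "Delta f \<noteq> {}" using Delta_incl by auto
  then obtain s a d where d: "0 \<le> s" "0 \<le> a" "s + a = 1" "d \<in> Delta f" "y = s *\<^sub>R z + a *\<^sub>R d"
    using y(1) Delta_convex unfolding Delta2_def convex_hull_insert[OF \<open>Delta f \<noteq> {}\<close>] by (auto simp: hull_same)
  obtain v p where v: "0 \<le> v" "v \<le> 1" "d = v *\<^sub>R p" "l d = v" using Delta_rep[OF d(4)] .
  have e: "x - (b * s) *\<^sub>R z = (b * a) *\<^sub>R d" by (simp add: y d algebra_simps)
  have "b * a * v \<le> b * a" using b d v mult_left_mono[of v 1 "b * a"] by simp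
  then have "l (x - (b * s) *\<^sub>R z) + b * s \<le> b * (a + s)" unfolding e by (simp add: l_scale v(4) algebra_simps)
  then have "l (x - (b * s) *\<^sub>R z) + b * s \<le> b" using d(3) by (simp add: add.commute)
  moreover have "x - (b * s) *\<^sub>R z \<in> Cone f" unfolding e by (rule Cone_scale[OF Delta_Cone[OF d(4)]]) (use b d in simp)
  ultimately show "\<exists>s\<ge>0. x - s *\<^sub>R z \<in> Cone f \<and> l (x - s *\<^sub>R z) + s \<le> b"
    using b d by (intro exI[of _ "b * s"]) simp
next
  assume "\<exists>s\<ge>0. x - s *\<^sub>R z \<in> Cone f \<and> l (x - s *\<^sub>R z) + s \<le> b"
  then obtain s where s: "0 \<le> s" "x - s *\<^sub>R z \<in> Cone f" "l (x - s *\<^sub>R z) + s \<le> b" by blast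
  define t where "t = l (x - s *\<^sub>R z)"
  obtain p where p: "0 \<le> t" "p \<in> convex hull U" "x - s *\<^sub>R z = t *\<^sub>R p" using Cone_rep[OF s(2)] unfolding t_def .
  have x: "x = s *\<^sub>R z + t *\<^sub>R p" using p(3) by (simp add: algebra_simps)
  show "x \<in> (\<lambda>x. b *\<^sub>R x) ` Delta2 f \<mu>"
  \<comment> \<open>The coefficients are going to be divided by b; for b = 0 they all
    vanish.\<close>
  proof (cases "b = 0")
    case True
    then have "s = 0" "t = 0" using s p unfolding t_def by linarith+
    then show ?thesis using x True Delta2_incl by auto
  next
    case False
    then have b': "b > 0" using b by simp
    \<comment> \<open>The weight missing to 1 is put on the vertex 0.\<close>
    define q where "q = (s / b) *\<^sub>R z + (t / b) *\<^sub>R p + (1 - s / b - t / b) *\<^sub>R 0"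
    have "1 - s / b - t / b \<ge> 0" using s(3) b' unfolding t_def[symmetric] by (simp add: field_simps)
    moreover have "p \<in> Delta2 f \<mu>" using p hullU_Delta Delta2_incl by blast
    moreover have "1 - s / b - t / b + s / b + t / b = 1" by simp
    ultimately have "(s / b) *\<^sub>R z + (t / b) *\<^sub>R p + (1 - s / b - t / b) *\<^sub>R 0 \<in> convex hull {z, p, 0}"
      unfolding convex_hull_3 using b' s(1) p(1)
      by (intro CollectI exI[of _ "s / b"] exI[of _ "t / b"] exI[of _ "1 - s / b - t / b"]) simp
    moreover have "convex hull {z, p, 0} \<subseteq> Delta2 f \<mu>"
      using \<open>p \<in> Delta2 f \<mu>\<close> Delta2_incl(1) Delta2_incl(2)[OF Delta_incl(1)] by (intro hull_minimal Delta2_convex) auto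
    ultimately have "q \<in> Delta2 f \<mu>" unfolding q_def by blast
    moreover have "x = b *\<^sub>R q" using b' by (simp add: q_def x algebra_simps)
    ultimately show ?thesis by blast
  qed
qed

lemma Cone2_iff: "x \<in> Cone2 f \<mu> \<longleftrightarrow> (\<exists>s\<ge>0. x - s *\<^sub>R z \<in> Cone f)"
proof
  assume "x \<in> Cone2 f \<mu>"
  then obtain b where "0 \<le> b" "x \<in> (\<lambda>x. b *\<^sub>R x) ` Delta2 f \<mu>"
    unfolding Cone2_def conic_hull_explicit by auto
  then show "\<exists>s\<ge>0. x - s *\<^sub>R z \<in> Cone f" using scaled_Delta2_iff by blast
next
  assume "\<exists>s\<ge>0. x - s *\<^sub>R z \<in> Cone f"
  then obtain s where s: "0 \<le> s" "x - s *\<^sub>R z \<in> Cone f" by blast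
  \<comment> \<open>The smallest dilation factor that \<open>scaled_Delta2_iff\<close> allows for
    this s.\<close>
  define b where "b = l (x - s *\<^sub>R z) + s"
  have "0 \<le> b" using Cone_rep[OF s(2)] s(1) unfolding b_def by (metis add_nonneg_nonneg)
  then have "x \<in> (\<lambda>x. b *\<^sub>R x) ` Delta2 f \<mu>" using s scaled_Delta2_iff[of b x] unfolding b_def by blast
  then show "x \<in> Cone2 f \<mu>" using \<open>0 \<le> b\<close> unfolding Cone2_def conic_hull_explicit by blast
qed

section \<open>Codimension-2 faces and their linear forms\<close>

lemma ph_nonzero:
  assumes "\<tau> \<in> faces_codim2 f"
  shows "ph \<tau> \<noteq> 0"
proof
  assume "ph \<tau> = 0"
  then have "\<phi> \<tau> $ i = 0" for i by (simp add: rvec_def vec_eq_iff)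
  then have "{\<phi> \<tau> $ i | i. True} = {0}" by auto
  moreover have "Gcd {\<phi> \<tau> $ i | i. True} = 1" using forms assms by (simp add: face_forms_def)
  ultimately show False by simp
qed

text \<open>Otherwise the support, and with it the full-dimensional polytope, would lie in the
  hyperplane where the form vanishes.\<close>

lemma ph_pos_ex:
  assumes "\<tau> \<in> faces_codim2 f"
  obtains q where "q \<in> U" "ph \<tau> \<bullet> q > 0"
proof -
  have "\<exists>q\<in>U. ph \<tau> \<bullet> q > 0"
  proof (rule ccontr)
    assume "\<not> ?thesis"
    then have "ph \<tau> \<bullet> q = 0" if "q \<in> U" for q
      using ph_nonneg[OF assms Delta_Cone[OF Delta_incl(2)[OF that]]] that by force
    then have "Delta f \<subseteq> {x. ph \<tau> \<bullet> x = 0}"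
      unfolding Delta_def by (intro hull_minimal) (auto simp: convex_hyperplane)
    then have "aff_dim (Delta f) \<le> aff_dim {x. ph \<tau> \<bullet> x = 0}" by (rule aff_dim_subset)
    then show False using full ph_nonzero[OF assms] by simp
  qed
  then show thesis using that by blast
qed

text \<open>A face of a convex hull is the hull of some of the generators, and 0 is not among them
  because it is not in \<tau>.\<close>

lemma face_sub: "\<tau> \<in> faces_codim2 f \<Longrightarrow> \<tau> \<subseteq> convex hull U"
proof -
  assume t: "\<tau> \<in> faces_codim2 f"
  then have "\<tau> face_of convex hull (insert 0 U)" "0 \<notin> \<tau>" by (auto simp: faces_codim2_def Delta_def)
  then obtain s where s: "s \<subseteq> insert 0 U" "\<tau> = convex hull s"
    using face_of_convex_hull_subset[of "insert 0 U"] finite_imp_compact by (metis finite_U finite_insert)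
  then have "0 \<notin> s" using \<open>0 \<notin> \<tau>\<close> hull_inc by metis
  then show "\<tau> \<subseteq> convex hull U" using s by (metis hull_mono subset_insert)
qed

lemma face_l: "\<tau> \<in> faces_codim2 f \<Longrightarrow> x \<in> \<tau> \<Longrightarrow> l x = 1"
  using face_sub hullU_l by blast

lemma face_ph: "\<tau> \<in> faces_codim2 f \<Longrightarrow> x \<in> \<tau> \<Longrightarrow> ph \<tau> \<bullet> x = 0"
  using forms by (simp add: face_forms_def)

text \<open>A dimension count: the hyperplane of the form contains 0, so it is not contained in the
  hyperplane l = 1. The intersection therefore has dimension at most CARD('n) - 2, which is already
  the dimension of \<tau>.\<close>

lemma face_affine_hull:
  assumes t: "\<tau> \<in> faces_codim2 f"
  shows "affine hull \<tau> = {x. ph \<tau> \<bullet> x = 0} \<inter> {x. lv \<bullet> x = 1}" (is "_ = ?H \<inter> ?L")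
proof -
  have affF: "affine (?H \<inter> ?L)" by (intro affine_Int affine_hyperplane)
  have sub: "affine hull \<tau> \<subseteq> ?H \<inter> ?L"
  proof (rule hull_minimal)
    show "\<tau> \<subseteq> ?H \<inter> ?L" using face_l[OF t] face_ph[OF t] by (auto simp: l_eq)
  qed (rule affF)
  have dimH: "aff_dim ?H = int CARD('n) - 1" using ph_nonzero[OF t] by simp
  have "aff_dim (?H \<inter> ?L) \<noteq> aff_dim ?H"
  proof
    assume e: "aff_dim (?H \<inter> ?L) = aff_dim ?H"
    \<comment> \<open>\<open>?H\<close> has dimension CARD('n) - 1, which is at least 0, so equal
      dimensions rule out an empty intersection.\<close>
    have "int CARD('n) > 0" by simp
    then have "?H \<inter> ?L \<noteq> {}" using dimH e by auto
    then have "?H \<inter> ?L = ?H" using affine_dim_equal[OF affF affine_hyperplane _ Int_lower1 e] by blast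
    moreover have "0 \<in> ?H" by simp
    ultimately have "(0 :: real ^ 'n) \<in> ?L" by blast
    then show False by simp
  qed
  then have "aff_dim (?H \<inter> ?L) \<le> int CARD('n) - 2"
    using aff_dim_subset[of "?H \<inter> ?L" ?H] dimH by simp
  moreover have "aff_dim (affine hull \<tau>) = int CARD('n) - 2" using t by (simp add: faces_codim2_def)
  ultimately have e: "aff_dim (affine hull \<tau>) = aff_dim (?H \<inter> ?L)"
    using aff_dim_subset[OF sub] by linarith
  show ?thesis
  proof (cases "\<tau> = {}")
    \<comment> \<open>This is the case CARD('n) = 1: the face is empty, of dimension -1, and
      equality of dimensions shows that the intersection is empty too.\<close>
    case True
    then show ?thesis using e by (metis aff_dim_empty affine_hull_empty)
  next
    case False
    then show ?thesis by (intro affine_dim_equal[OF affine_affine_hull affF _ sub e]) simp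
  qed
qed

text \<open>A face is cut out of the polytope by its affine hull.\<close>

lemma face_mem:
  assumes t: "\<tau> \<in> faces_codim2 f" and x: "x \<in> Delta f" "ph \<tau> \<bullet> x = 0" "l x = 1"
  shows "x \<in> \<tau>"
proof -
  have "\<tau> face_of Delta f" using t by (simp add: faces_codim2_def)
  then have "\<tau> = affine hull \<tau> \<inter> Delta f" by (rule face_of_imp_eq_affine_Int[OF Delta_convex])
  then show ?thesis using x face_affine_hull[OF t] by (auto simp: l_eq)
qed

text \<open>The hyperplane \<open>ha \<tau> \<bullet> x = \<phi>\<^sup>\<tau>(\<mu>)\<close> passes through \<open>\<tau>\<close> and \<open>\<mu>\<close>. The side of \<open>0\<close> is governed by the
  sign of \<open>\<phi>\<^sup>\<tau>(\<mu>)\<close>, and the rest of the support of \<open>f\<close> lies on the positive side; so it supports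
  \<open>Delta2 f \<mu>\<close> exactly when that sign is negative.\<close>

definition "ha \<tau> = (1 - l z) *\<^sub>R ph \<tau> + (ph \<tau> \<bullet> z) *\<^sub>R lv"

lemma ha: "ha \<tau> \<bullet> x = (1 - l z) * (ph \<tau> \<bullet> x) + (ph \<tau> \<bullet> z) * l x"
  by (simp add: ha_def inner_left_distrib l_eq)

lemma Gamma_one_iff: "\<tau> \<in> Gamma_one f \<mu> \<longleftrightarrow> \<tau> \<in> faces_codim2 f \<and> ph \<tau> \<bullet> z < 0"
proof
  assume t: "\<tau> \<in> faces_codim2 f \<and> ph \<tau> \<bullet> z < 0"
  let ?b = "ph \<tau> \<bullet> z"
  have hu: "ha \<tau> \<bullet> u = (1 - l z) * (ph \<tau> \<bullet> u) + ?b" if "u \<in> U" for u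
    using that l_supp by (auto simp: ha)
  have gens: "Delta2 f \<mu> = convex hull (insert z (insert 0 U))"
    unfolding Delta2_def Delta_def by (metis hull_insert)
  have "Delta2 f \<mu> \<subseteq> {x. ha \<tau> \<bullet> x \<ge> ?b}"
    unfolding gens
  proof (rule hull_minimal)
    have "(1 - l z) * (ph \<tau> \<bullet> u) \<ge> 0" if "u \<in> U" for u
      using ph_nonneg[OF conjunct1[OF t] Delta_Cone[OF Delta_incl(2)[OF that]]] l_mu by simp
    then show "insert z (insert 0 U) \<subseteq> {x. ha \<tau> \<bullet> x \<ge> ?b}"
      using t hu by (auto simp: ha algebra_simps l_zero)
  qed (simp add: convex_halfspace_ge)
  then have face: "(Delta2 f \<mu> \<inter> {x. ha \<tau> \<bullet> x = ?b}) face_of Delta2 f \<mu>"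
    by (intro face_of_Int_supporting_hyperplane_ge[OF Delta2_convex]) auto
  have "Delta2 f \<mu> \<inter> {x. ha \<tau> \<bullet> x = ?b} = convex hull (insert z \<tau>)"
  proof
    obtain s where s: "s \<subseteq> insert z (insert 0 U)" "Delta2 f \<mu> \<inter> {x. ha \<tau> \<bullet> x = ?b} = convex hull s"
      using face_of_convex_hull_subset[of "insert z (insert 0 U)"] face unfolding gens
      by (metis finite_U finite_imp_compact finite_insert)
    \<comment> \<open>Only generators on the hyperplane occur: 0 is excluded because
      \<open>?b\<close> is not 0, and a support point stays only if the form vanishes on it.\<close>
    have "s \<subseteq> insert z \<tau>"
    proof
      fix u assume u: "u \<in> s"
      then have "u \<in> Delta2 f \<mu> \<inter> {x. ha \<tau> \<bullet> x = ?b}" unfolding s(2) by (rule hull_inc)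
      then have b: "ha \<tau> \<bullet> u = ?b" by blast
      consider "u = z" | "u = 0" | "u \<in> U" using u s(1) by auto
      then show "u \<in> insert z \<tau>"
      proof cases
        case 2
        then show ?thesis using b t by simp
      next
        case 3
        then have "ph \<tau> \<bullet> u = 0" using hu[OF 3] b l_mu by simp
        then have "u \<in> \<tau>" using face_mem[of \<tau> u] t Delta_incl(2)[OF 3] l_supp 3 by auto
        then show ?thesis by simp
      qed simp
    qed
    then show "Delta2 f \<mu> \<inter> {x. ha \<tau> \<bullet> x = ?b} \<subseteq> convex hull (insert z \<tau>)"
      unfolding s(2) by (rule hull_mono)
    have "insert z \<tau> \<subseteq> Delta2 f \<mu> \<inter> {x. ha \<tau> \<bullet> x = ?b}"
      using t face_l face_ph face_sub hullU_Delta Delta2_incl by (auto simp: ha algebra_simps subset_iff)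
    then show "convex hull (insert z \<tau>) \<subseteq> Delta2 f \<mu> \<inter> {x. ha \<tau> \<bullet> x = ?b}"
      by (rule hull_minimal) (intro convex_Int Delta2_convex convex_hyperplane)
  qed
  then show "\<tau> \<in> Gamma_one f \<mu>" using t face by (simp add: Gamma_one_def)
next
  assume g: "\<tau> \<in> Gamma_one f \<mu>"
  then have t: "\<tau> \<in> faces_codim2 f" and face: "convex hull (insert z \<tau>) face_of Delta2 f \<mu>"
    by (auto simp: Gamma_one_def)
  let ?b = "ph \<tau> \<bullet> z" and ?F = "convex hull (insert z \<tau>)" and ?H = "{x. ha \<tau> \<bullet> x = ph \<tau> \<bullet> z}"
  have "?b \<noteq> 0" using nz[OF g] by (simp add: rvec_simps)
  moreover have "\<not> ?b > 0"
  proof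
    assume b: "?b > 0"
    have haz: "ha \<tau> \<bullet> z = ?b" by (simp add: ha algebra_simps)
    then have ha0: "ha \<tau> \<noteq> 0" using b by auto
    have "insert z \<tau> \<subseteq> ?H" using haz face_l[OF t] face_ph[OF t] by (auto simp: ha)
    then have sub: "affine hull ?F \<subseteq> ?H"
      by (intro hull_minimal affine_hyperplane) (auto simp: convex_hyperplane)
    \<comment> \<open>As l(\<mu>) < 1 while l = 1 on \<tau>, adding \<mu> raises the dimension by
      one, so the affine hull of \<open>?F\<close> is the whole hyperplane.\<close>
    have "z \<notin> affine hull \<tau>" using face_affine_hull[OF t] l_mu by (auto simp: l_eq)
    then have "aff_dim (affine hull ?F) = aff_dim ?H"
      using t ha0 by (simp add: aff_dim_convex_hull aff_dim_insert faces_codim2_def)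
    then have aff: "affine hull ?F = ?H"
      by (intro affine_dim_equal[OF affine_affine_hull affine_hyperplane _ sub]) auto
    have F: "?F = ?H \<inter> Delta2 f \<mu>"
      using face_of_imp_eq_affine_Int[OF Delta2_convex face] unfolding aff .
    obtain q where q: "q \<in> U" "ph \<tau> \<bullet> q > 0" using ph_pos_ex[OF t] .
    have hq: "ha \<tau> \<bullet> q > ?b" using q l_supp l_mu by (auto simp: ha)
    \<comment> \<open>On the segment from 0 to q the value rises from 0 to more than
      \<open>?b\<close>, so the hyperplane is crossed at s q. The crossing point lies in the face,
      which then has to contain 0 as well, although 0 is not on the hyperplane.\<close>
    define s where "s = ?b / (ha \<tau> \<bullet> q)"
    have s: "0 < s" "s < 1" using hq b by (auto simp: s_def)
    have qD: "q \<in> Delta2 f \<mu>" "0 \<in> Delta2 f \<mu>" using q Delta_incl Delta2_incl by blast+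
    have os: "s *\<^sub>R q \<in> open_segment 0 q"
      using s q(2) unfolding in_segment by (intro conjI exI[of _ s]) auto
    have "s *\<^sub>R q \<in> Delta2 f \<mu>"
      using convexD_alt[OF Delta2_convex qD(2,1), of s] s by simp
    moreover have "ha \<tau> \<bullet> (s *\<^sub>R q) = ?b" using hq b by (simp add: s_def)
    ultimately have "s *\<^sub>R q \<in> ?F" using F by blast
    from face_ofD[OF face os qD(2,1) this] have "0 \<in> ?F" by blast
    then show False using F b by auto
  qed
  ultimately show "\<tau> \<in> faces_codim2 f \<and> ?b < 0" using t by auto
qed

text \<open>For \<phi>(\<mu>) < 0 the condition \<phi>(x - r \<mu>) \<ge> 0 says r \<ge>
  \<phi>(x)/\<phi>(\<mu>). The largest of these lower bounds and 0 extends the exponent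
  \<open>m\<close> from lattice points to real points.\<close>

definition "rho x = Max (insert 0 ((\<lambda>\<tau>. (ph \<tau> \<bullet> x) / (ph \<tau> \<bullet> z)) ` Gamma_one f \<mu>))"

lemma rho_fin: "finite (insert 0 ((\<lambda>\<tau>. (ph \<tau> \<bullet> x) / (ph \<tau> \<bullet> z)) ` Gamma_one f \<mu>))"
  by (simp add: finite_Gamma_one)

lemma rho_nonneg: "0 \<le> rho x"
  unfolding rho_def by (rule Max_ge[OF rho_fin]) simp

lemma rho_ge: "\<tau> \<in> Gamma_one f \<mu> \<Longrightarrow> (ph \<tau> \<bullet> x) / (ph \<tau> \<bullet> z) \<le> rho x"
  unfolding rho_def by (rule Max_ge[OF rho_fin]) simp

lemma rho_cases: "rho x = 0 \<or> (\<exists>\<tau>\<in>Gamma_one f \<mu>. rho x = (ph \<tau> \<bullet> x) / (ph \<tau> \<bullet> z))"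
  using Max_in[OF rho_fin[of x]] unfolding rho_def[symmetric] by auto

lemma rho_le:
  assumes "0 \<le> r" "x - r *\<^sub>R z \<in> Cone f"
  shows "rho x \<le> r"
proof -
  have "(ph \<tau> \<bullet> x) / (ph \<tau> \<bullet> z) \<le> r" if "\<tau> \<in> Gamma_one f \<mu>" for \<tau>
  proof -
    have t: "\<tau> \<in> faces_codim2 f" "ph \<tau> \<bullet> z < 0" using that Gamma_one_iff by auto
    have "ph \<tau> \<bullet> (x - r *\<^sub>R z) \<ge> 0" by (rule ph_nonneg[OF t(1) assms(2)])
    then show ?thesis using t(2) by (simp add: inner_diff_right neg_divide_le_eq)
  qed
  then show ?thesis using rho_cases[of x] assms(1) by auto
qed

text \<open>Forms with \<phi>(\<mu>) \<ge> 0 become harder to satisfy as r grows. They hold at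
  \<open>rho x\<close> because x - s \<mu> lies in the cone for some s and \<open>rho x\<close> is
  at most s.\<close>

lemma rho_Cone:
  assumes "x \<in> Cone2 f \<mu>"
  shows "x - rho x *\<^sub>R z \<in> Cone f"
proof -
  obtain s where s: "0 \<le> s" "x - s *\<^sub>R z \<in> Cone f" using assms Cone2_iff by blast
  have rs: "rho x \<le> s" by (rule rho_le[OF s])
  have "ph \<tau> \<bullet> (x - rho x *\<^sub>R z) \<ge> 0" if t: "\<tau> \<in> faces_codim2 f" for \<tau>
  proof (cases "ph \<tau> \<bullet> z < 0")
    case True
    then have "(ph \<tau> \<bullet> x) / (ph \<tau> \<bullet> z) \<le> rho x" using t by (intro rho_ge) (simp add: Gamma_one_iff)
    then show ?thesis using True by (simp add: inner_diff_right neg_divide_le_eq)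
  next
    case False
    have "ph \<tau> \<bullet> (x - s *\<^sub>R z) \<ge> 0" by (rule ph_nonneg[OF t s(2)])
    moreover have "rho x * (ph \<tau> \<bullet> z) \<le> s * (ph \<tau> \<bullet> z)" using rs False by (intro mult_right_mono) auto
    ultimately show ?thesis by (simp add: inner_diff_right)
  qed
  then show ?thesis by (simp add: Cone_eq)
qed

text \<open>Subtracting \<open>rho x\<close> times \<mu> leaves a point y of the cone of f. The
  maximum is attained at \<tau> exactly when the form of \<tau> vanishes on y, that is, when y lies
  in the cone over \<tau> or is 0.\<close>

lemma face_cone_iff:
  assumes g: "\<tau> \<in> Gamma_one f \<mu>" and x: "x \<in> Cone2 f \<mu>"
  shows "x \<in> face_cone \<tau> \<mu> \<longleftrightarrow> rho x = (ph \<tau> \<bullet> x) / (ph \<tau> \<bullet> z)"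
proof
  have t: "\<tau> \<in> faces_codim2 f" "ph \<tau> \<bullet> z < 0" using g Gamma_one_iff by auto
  {
    assume "x \<in> face_cone \<tau> \<mu>"
    then obtain c y where cy: "0 \<le> c" "y \<in> convex hull (insert z \<tau>)" "x = c *\<^sub>R y"
      unfolding face_cone_def conic_hull_explicit by auto
    obtain s d where sd: "0 \<le> s" "d \<in> Cone f" "ph \<tau> \<bullet> d = 0" "y = s *\<^sub>R z + d"
    proof (cases "\<tau> = {}")
      \<comment> \<open>An empty face leaves only the point \<mu> in the hull.\<close>
      case True
      then show ?thesis using cy(2) that[of 1 0] Cone_zero by simp
    next
      case False
      then obtain s a e where "0 \<le> s" "0 \<le> a" "s + a = 1" "e \<in> convex hull \<tau>" "y = s *\<^sub>R z + a *\<^sub>R e"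
        using cy(2) unfolding convex_hull_insert[OF False] by auto
      moreover have "convex hull \<tau> = \<tau>"
        using t face_of_imp_convex[of \<tau> "Delta f"] by (intro hull_same) (auto simp: faces_codim2_def)
      ultimately show ?thesis
        using that[of s "a *\<^sub>R e"] face_ph[OF t(1)] face_sub[OF t(1)] hullU_Delta Delta_Cone Cone_scale by (auto simp: subset_iff)
    qed
    have "x - (c * s) *\<^sub>R z = c *\<^sub>R d" by (simp add: cy sd algebra_simps)
    then have "rho x \<le> c * s" using rho_le[of "c * s" x] Cone_scale[OF sd(2) cy(1)] sd(1) cy(1) by simp
    moreover have "(ph \<tau> \<bullet> x) / (ph \<tau> \<bullet> z) = c * s" using t(2) sd(3) by (simp add: cy sd(4) inner_right_distrib)
    ultimately show "rho x = (ph \<tau> \<bullet> x) / (ph \<tau> \<bullet> z)" using rho_ge[OF g, of x] by simp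
  }
  assume r: "rho x = (ph \<tau> \<bullet> x) / (ph \<tau> \<bullet> z)"
  define y where "y = x - rho x *\<^sub>R z"
  have y: "y \<in> Cone f" unfolding y_def by (rule rho_Cone[OF x])
  have py: "ph \<tau> \<bullet> y = 0" using t(2) by (simp add: y_def inner_diff_right r)
  obtain p where p: "0 \<le> l y" "p \<in> convex hull U" "y = l y *\<^sub>R p" using Cone_rep[OF y] .
  have xe: "x = rho x *\<^sub>R z + l y *\<^sub>R p" using p(3) by (simp add: y_def algebra_simps)
  show "x \<in> face_cone \<tau> \<mu>"
  proof (cases "l y = 0")
    \<comment> \<open>Here x is a multiple of \<mu>; with an empty \<tau> only this case can
      occur.\<close>
    case True
    have "z \<in> convex hull (insert z \<tau>)" by (simp add: hull_inc)
    then show ?thesis using xe True rho_nonneg[of x] unfolding face_cone_def conic_hull_explicit by auto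
  next
    case False
    then have ly: "l y > 0" using p(1) by simp
    have "ph \<tau> \<bullet> p = 0" using py False arg_cong[OF p(3), of "\<lambda>y. ph \<tau> \<bullet> y"] by simp
    then have pt: "p \<in> \<tau>" using face_mem[OF t(1)] hullU_Delta hullU_l p(2) by blast
    \<comment> \<open>Normalises the two coefficients to sum 1; the factor c is absorbed by the
      conic hull.\<close>
    define c where "c = rho x + l y"
    have c: "c > 0" using ly rho_nonneg[of x] by (simp add: c_def)
    have "(rho x / c) *\<^sub>R z + (l y / c) *\<^sub>R p \<in> convex hull (insert z \<tau>)"
      using c ly rho_nonneg[of x] pt
      by (intro convexD[OF convex_convex_hull]) (auto intro: hull_inc simp: c_def add_divide_distrib[symmetric])
    moreover have "x = c *\<^sub>R ((rho x / c) *\<^sub>R z + (l y / c) *\<^sub>R p)"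
      using c by (subst xe) (simp add: scaleR_add_right)
    ultimately show ?thesis using c unfolding face_cone_def conic_hull_explicit
      by (smt (verit) mem_Collect_eq)
  qed
qed

text \<open>Every clause that applies yields \<open>rho\<close>, by \<open>face_cone_iff\<close> and
  minimality, and some clause applies because the maximum is attained. So the description is well
  defined where the cones overlap.\<close>

lemma mexp_eq:
  assumes v: "v \<in> Mmon f \<mu>"
  shows "mexp f \<mu> \<phi> v = rho (rvec v)"
  unfolding mexp_def
proof (rule the_equality)
  have x: "rvec v \<in> Cone2 f \<mu>" using v by (simp add: Mmon_def)
  note fc = face_cone_iff[OF _ x]
  show "rvec v \<in> Cone f \<and> rho (rvec v) = 0 \<or>
    (\<exists>\<tau>\<in>Gamma_one f \<mu>. rvec v \<in> face_cone \<tau> \<mu> \<and> rho (rvec v) = real_of_int (pairing (\<phi> \<tau>) v) / real_of_int (pairing (\<phi> \<tau>) \<mu>))"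
    using rho_cases[of "rvec v"] rho_Cone[OF x] fc by (auto simp: rvec_simps)
  fix c assume c: "rvec v \<in> Cone f \<and> c = 0 \<or>
    (\<exists>\<tau>\<in>Gamma_one f \<mu>. rvec v \<in> face_cone \<tau> \<mu> \<and> c = real_of_int (pairing (\<phi> \<tau>) v) / real_of_int (pairing (\<phi> \<tau>) \<mu>))"
  then show "c = rho (rvec v)"
    using fc rho_le[of 0 "rvec v"] rho_nonneg[of "rvec v"] by (auto simp: rvec_simps)
qed

text \<open>\<open>Gamma_one\<close> is finite and no form vanishes on \<mu>; an infinite set or a
  zero entry would make \<open>Lcm\<close> equal to 0.\<close>

lemma Den_pos: "Den f \<mu> \<phi> > 0"
proof -
  have "Den f \<mu> \<phi> \<noteq> 0" unfolding Den_def
    using nz by (subst Lcm_0_iff) (auto simp: finite_Gamma_one)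
  then show ?thesis by simp
qed

lemma mexp_exps:
  assumes v: "v \<in> Mmon f \<mu>"
  shows "mexp f \<mu> \<phi> v \<in> exps (Den f \<mu> \<phi>)"
  using rho_cases[of "rvec v"]
proof
  assume "rho (rvec v) = 0"
  then show ?thesis unfolding mexp_eq[OF v] exps_def by (auto intro: exI[of _ 0])
next
  assume "\<exists>\<tau>\<in>Gamma_one f \<mu>. rho (rvec v) = (ph \<tau> \<bullet> rvec v) / (ph \<tau> \<bullet> z)"
  then obtain \<tau> where t: "\<tau> \<in> Gamma_one f \<mu>" "rho (rvec v) = real_of_int (pairing (\<phi> \<tau>) v) / real_of_int (pairing (\<phi> \<tau>) \<mu>)"
    by (auto simp: rvec_simps)
  have neg: "pairing (\<phi> \<tau>) \<mu> < 0" using t(1) Gamma_one_iff by (simp add: rvec_simps)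
  have "nat \<bar>pairing (\<phi> \<tau>) \<mu>\<bar> dvd Den f \<mu> \<phi>" unfolding Den_def by (rule dvd_Lcm) (use t in simp)
  then obtain e where e: "Den f \<mu> \<phi> = nat \<bar>pairing (\<phi> \<tau>) \<mu>\<bar> * e" by (auto simp: dvd_def)
  have e0: "e > 0" using Den_pos e by (cases e) auto
  \<comment> \<open>\<phi>(\<mu>) is negative, so the absolute value in \<open>Den\<close> is its
    negative; the numerator of the exponent is nonpositive since \<open>rho\<close> is nonnegative,
    and both signs are flipped.\<close>
  have D: "real (Den f \<mu> \<phi>) = - real_of_int (pairing (\<phi> \<tau>) \<mu>) * real e" using neg by (simp add: e)
  have "pairing (\<phi> \<tau>) v \<le> 0"
    using rho_nonneg[of "rvec v"] neg unfolding t(2) by (auto simp: zero_le_divide_iff)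
  then have "rho (rvec v) = real (nat (- pairing (\<phi> \<tau>) v) * e) / real (Den f \<mu> \<phi>)"
    unfolding t(2) D using neg e0 by (simp add: divide_simps)
  then show ?thesis unfolding mexp_eq[OF v] exps_def by blast
qed

section \<open>The monoid of lattice points and its weight\<close>

lemma Mmon_zero: "0 \<in> Mmon f \<mu>"
  using Cone_zero by (auto simp: Mmon_def Cone2_iff rvec_simps intro: exI[of _ 0])

text \<open>Adding the optimal decompositions x = rho(x) \<mu> + y of the two points gives an
  admissible decomposition of their sum, and \<open>rho\<close> is minimal among those.\<close>

lemma Mmon_add:
  assumes "u \<in> Mmon f \<mu>" "v \<in> Mmon f \<mu>"
  shows "u + v \<in> Mmon f \<mu>" "mexp f \<mu> \<phi> (u + v) \<le> mexp f \<mu> \<phi> u + mexp f \<mu> \<phi> v"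
proof -
  have "rvec u - rho (rvec u) *\<^sub>R z + (rvec v - rho (rvec v) *\<^sub>R z) \<in> Cone f"
    by (intro Cone_add rho_Cone) (use assms in \<open>simp_all add: Mmon_def\<close>)
  then have c: "rvec (u + v) - (rho (rvec u) + rho (rvec v)) *\<^sub>R z \<in> Cone f"
    by (simp add: rvec_simps algebra_simps)
  have n: "0 \<le> rho (rvec u) + rho (rvec v)" using rho_nonneg by simp
  show uv: "u + v \<in> Mmon f \<mu>" using c n unfolding Mmon_def Cone2_iff by blast
  show "mexp f \<mu> \<phi> (u + v) \<le> mexp f \<mu> \<phi> u + mexp f \<mu> \<phi> v"
    unfolding mexp_eq[OF assms(1)] mexp_eq[OF assms(2)] mexp_eq[OF uv] by (rule rho_le[OF n c])
qed

lemma mexp_zero: "mexp f \<mu> \<phi> 0 = 0"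
  using rho_le[of 0 0] rho_nonneg[of 0] Cone_zero by (simp add: mexp_eq[OF Mmon_zero] rvec_simps)

text \<open>The cost l(x) + s (1 - l(\<mu>)) of writing x = s \<mu> + y with y in the cone increases
  with s, since l(\<mu>) < 1. Its minimum is reached at the smallest admissible s, which is
  \<open>rho\<close>.\<close>

lemma wdeg_eq:
  assumes v: "v \<in> Mmon f \<mu>"
  shows "wdeg f \<mu> v = l (rvec v) + mexp f \<mu> \<phi> v * (1 - l z)"
  unfolding wdeg_def mexp_eq[OF v]
proof (rule Least_equality)
  let ?x = "rvec v"
  have c: "?x - rho ?x *\<^sub>R z \<in> Cone f" by (rule rho_Cone) (use v in \<open>simp add: Mmon_def\<close>)
  have e: "l ?x + rho ?x * (1 - l z) = l (?x - rho ?x *\<^sub>R z) + rho ?x" by (simp add: l_diff l_scale algebra_simps)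
  have n: "0 \<le> l ?x + rho ?x * (1 - l z)"
    unfolding e using Cone_rep[OF c] rho_nonneg[of ?x] by (metis add_nonneg_nonneg)
  then show "0 \<le> l ?x + rho ?x * (1 - l z) \<and> ?x \<in> (\<lambda>x. (l ?x + rho ?x * (1 - l z)) *\<^sub>R x) ` Delta2 f \<mu>"
    using scaled_Delta2_iff[OF n, of ?x] c rho_nonneg[of ?x] e by auto
  fix b assume "0 \<le> b \<and> ?x \<in> (\<lambda>x. b *\<^sub>R x) ` Delta2 f \<mu>"
  then obtain s where s: "0 \<le> s" "?x - s *\<^sub>R z \<in> Cone f" "l (?x - s *\<^sub>R z) + s \<le> b" using scaled_Delta2_iff by blast
  have "rho ?x * (1 - l z) \<le> s * (1 - l z)" using rho_le[OF s(1,2)] l_mu by (intro mult_right_mono) auto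
  then show "l ?x + rho ?x * (1 - l z) \<le> b" using s(3) by (simp add: l_diff l_scale algebra_simps)
qed

lemma deformation: "deformation f \<mu> \<phi> l"
proof unfold_locales
  show "0 \<in> Mmon f \<mu>" by (rule Mmon_zero)
  show "u + v \<in> Mmon f \<mu>" "mexp f \<mu> \<phi> (u + v) \<le> mexp f \<mu> \<phi> u + mexp f \<mu> \<phi> v"
    if "u \<in> Mmon f \<mu>" "v \<in> Mmon f \<mu>" for u v by (rule Mmon_add[OF that])+
  show "mexp f \<mu> \<phi> 0 = 0" by (rule mexp_zero)
  show "wdeg f \<mu> 0 = 0" by (simp add: wdeg_eq[OF Mmon_zero] mexp_zero rvec_simps l_zero)
  \<comment> \<open>The defect of additivity of \<open>w\<close> is that of \<open>m\<close> times
    the positive number 1 - l(\<mu>). Subadditivity of \<open>w\<close> and the equivalence both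
    follow.\<close>
  have sum: "wdeg f \<mu> u + wdeg f \<mu> v - wdeg f \<mu> (u + v) = (mexp f \<mu> \<phi> u + mexp f \<mu> \<phi> v - mexp f \<mu> \<phi> (u + v)) * (1 - l z)"
    if "u \<in> Mmon f \<mu>" "v \<in> Mmon f \<mu>" for u v
    unfolding wdeg_eq[OF that(1)] wdeg_eq[OF that(2)] wdeg_eq[OF Mmon_add(1)[OF that]]
    by (simp add: rvec_simps l_add algebra_simps)
  show "wdeg f \<mu> (u + v) \<le> wdeg f \<mu> u + wdeg f \<mu> v" if "u \<in> Mmon f \<mu>" "v \<in> Mmon f \<mu>" for u v
  proof -
    have "0 \<le> (mexp f \<mu> \<phi> u + mexp f \<mu> \<phi> v - mexp f \<mu> \<phi> (u + v)) * (1 - l z)"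
      using Mmon_add(2)[OF that] l_mu by simp
    then show ?thesis using sum[OF that] by linarith
  qed
  show "wdeg f \<mu> (u + v) = wdeg f \<mu> u + wdeg f \<mu> v \<longleftrightarrow> mexp f \<mu> \<phi> (u + v) = mexp f \<mu> \<phi> u + mexp f \<mu> \<phi> v"
    if "u \<in> Mmon f \<mu>" "v \<in> Mmon f \<mu>" for u v
  proof -
    have "wdeg f \<mu> (u + v) = wdeg f \<mu> u + wdeg f \<mu> v \<longleftrightarrow> wdeg f \<mu> u + wdeg f \<mu> v - wdeg f \<mu> (u + v) = 0" by auto
    also have "\<dots> \<longleftrightarrow> mexp f \<mu> \<phi> u + mexp f \<mu> \<phi> v - mexp f \<mu> \<phi> (u + v) = 0" unfolding sum[OF that] using l_mu by simp
    finally show ?thesis by auto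
  qed
  show "0 < Den f \<mu> \<phi>" by (rule Den_pos)
  show "mexp f \<mu> \<phi> v \<in> exps (Den f \<mu> \<phi>)" "Wdeg l \<mu> (mexp f \<mu> \<phi> v, v) = wdeg f \<mu> v" if "v \<in> Mmon f \<mu>" for v
    using mexp_exps[OF that] wdeg_eq[OF that] by (simp_all add: Wdeg_def)
qed

end

theorem theorem4p1:
  fixes f :: "(int ^ 'n) \<Rightarrow>\<^sub>0 'q::{field, finite}"
    and \<mu> :: "int ^ 'n"
    and l :: "real ^ 'n \<Rightarrow> real"
    and \<phi> :: "(real ^ 'n) set \<Rightarrow> int ^ 'n"
    and p a :: nat
  assumes "prime p" and "CARD('q) = p ^ a"
    and "aff_dim (Delta f) = int CARD('n)"
    and "linear l" and "\<forall>u\<in>Poly_Mapping.keys f. l (rvec u) = 1"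
    and "nondegenerate f"
    and "l (rvec \<mu>) < 1"
    and "face_forms f \<phi>"
    and "\<not> int p dvd (\<Prod>\<tau>\<in>Gamma_one f \<mu>. pairing (\<phi> \<tau>) \<mu>)"
  shows
    "resid f \<mu> \<phi> \<in> ring_iso Fq (Sring f \<mu> \<phi> Quot mm f \<mu> \<phi>) \<and>
     Module.algebra (Sring f \<mu> \<phi> Quot mm f \<mu> \<phi>) (Tbar_resid f \<mu> \<phi>) \<and>
     Module.algebra Fq (Tbar f \<mu> \<phi>) \<and>
     family_basis Fq (Tbar f \<mu> \<phi>) (Mmon f \<mu>) (cls f \<mu> \<phi>) \<and>
     graded_algebra Fq (Tbar f \<mu> \<phi>) (Tbar_grading f \<mu> \<phi> l) \<and>
     (\<forall>lam \<kappa> :: 'q alg_closure. lam \<noteq> 0 \<and> \<kappa> ^ Den f \<mu> \<phi> = lam \<longrightarrow>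
        graded_algebra (KF lam \<kappa>) (base_change Fq (Tbar f \<mu> \<phi>) (KF lam \<kappa>))
          (base_change_grading Fq (Tbar f \<mu> \<phi>) (KF lam \<kappa>) (Tbar_grading f \<mu> \<phi> l)) \<and>
        graded_algebra (KF lam \<kappa>) (Rbar f \<mu> lam \<kappa>) (Rbar_grading f \<mu> lam \<kappa>) \<and>
        (\<exists>pr. is_pr f \<mu> \<phi> lam \<kappa> pr) \<and>
        (\<forall>pr. is_pr f \<mu> \<phi> lam \<kappa> pr \<longrightarrow>
           (\<exists>\<Psi>. graded_algebra_iso (KF lam \<kappa>)
                  (base_change Fq (Tbar f \<mu> \<phi>) (KF lam \<kappa>))
                  (base_change_grading Fq (Tbar f \<mu> \<phi>) (KF lam \<kappa>) (Tbar_grading f \<mu> \<phi> l))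
                  (Rbar f \<mu> lam \<kappa>) (Rbar_grading f \<mu> lam \<kappa>) \<Psi> \<and>
                (\<forall>t\<in>carrier (Tring f \<mu> \<phi>). \<forall>c\<in>Kset lam \<kappa>.
                   \<Psi> (pure_tensor Fq (Tbar f \<mu> \<phi>) (KF lam \<kappa>) (mT f \<mu> \<phi> +>\<^bsub>Tring f \<mu> \<phi>\<^esub> t) c) =
                   pr (pure_tensor Fq (Tring f \<mu> \<phi>) (KF lam \<kappa>) t c)))))"
proof -
  \<comment> \<open>A vanishing factor would make the product 0, which p divides.\<close>
  have nz: "pairing (\<phi> \<tau>) \<mu> \<noteq> 0" if "\<tau> \<in> Gamma_one f \<mu>" for \<tau>
  proof
    assume z: "pairing (\<phi> \<tau>) \<mu> = 0"
    have "(\<Prod>\<tau>\<in>Gamma_one f \<mu>. pairing (\<phi> \<tau>) \<mu>) = 0" using z that by (auto simp: finite_Gamma_one)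
    then show False using assms(9) by simp
  qed
  interpret deformation f \<mu> \<phi> l
    by (rule newton_geometry.deformation, rule newton_geometry.intro) (fact assms nz)+
  \<comment> \<open>A zero \<open>\<kappa>\<close> would force \<open>lam = 0\<close>, because the
    exponent is positive.\<close>
  have \<kappa>: "\<kappa> \<noteq> 0" if "lam \<noteq> 0" "\<kappa> ^ Den f \<mu> \<phi> = lam" for lam \<kappa> :: "'q alg_closure"
    using that Den_pos by (auto simp: zero_power)
  show ?thesis
  proof (intro conjI allI impI)
    show "resid f \<mu> \<phi> \<in> ring_iso Fq (S Quot I)" by (rule resid_iso)
    show "Module.algebra (S Quot I) (Tbar_resid f \<mu> \<phi>)" by (rule resid_algebra)
    show "Module.algebra Fq (Tbar f \<mu> \<phi>)" by (rule Tbar_algebra)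
    show "family_basis Fq (Tbar f \<mu> \<phi>) Mm (cls f \<mu> \<phi>)" by (rule Tbar_basis)
    show "graded_algebra Fq (Tbar f \<mu> \<phi>) (Tbar_grading f \<mu> \<phi> l)" by (rule Tbar_graded)
  next
    fix lam \<kappa> :: "'q alg_closure" assume "lam \<noteq> 0 \<and> \<kappa> ^ Den f \<mu> \<phi> = lam"
    then have "\<kappa> \<noteq> 0" using \<kappa> by blast
    note fi = fibre_iso[OF this, of lam]
    show "graded_algebra (KF lam \<kappa>) (base_change Fq (Tbar f \<mu> \<phi>) (KF lam \<kappa>))
      (base_change_grading Fq (Tbar f \<mu> \<phi>) (KF lam \<kappa>) (Tbar_grading f \<mu> \<phi> l))" by (rule fi(1))
    show "graded_algebra (KF lam \<kappa>) (Rbar f \<mu> lam \<kappa>) (Rbar_grading f \<mu> lam \<kappa>)" by (rule fi(2))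
    show "\<exists>pr. is_pr f \<mu> \<phi> lam \<kappa> pr" by (rule fi(3))
    fix pr assume "is_pr f \<mu> \<phi> lam \<kappa> pr"
    from fi(4)[OF this] show "\<exists>\<Psi>. graded_algebra_iso (KF lam \<kappa>)
                  (base_change Fq (Tbar f \<mu> \<phi>) (KF lam \<kappa>))
                  (base_change_grading Fq (Tbar f \<mu> \<phi>) (KF lam \<kappa>) (Tbar_grading f \<mu> \<phi> l))
                  (Rbar f \<mu> lam \<kappa>) (Rbar_grading f \<mu> lam \<kappa>) \<Psi> \<and>
                (\<forall>t\<in>carrier (Tring f \<mu> \<phi>). \<forall>c\<in>Kset lam \<kappa>.
                   \<Psi> (pure_tensor Fq (Tbar f \<mu> \<phi>) (KF lam \<kappa>) (mT f \<mu> \<phi> +>\<^bsub>Tring f \<mu> \<phi>\<^esub> t) c) =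
                   pr (pure_tensor Fq (Tring f \<mu> \<phi>) (KF lam \<kappa>) t c))" .
  qed
qed

end
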